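(* For the complex special linear group $\mathrm{SL}_2(\mathbb{C})$ of $2\times 2$ matrices we have $\delta(\mathrm{SL}_2(\mathbb{C}))=3$.
   Context: Let $G$ be a linear algebraic group over an algebraically closed field $k$ (here $k=\mathbb{C}$). For a product $X=\prod_{i=1}^m X_i$ of affine $G$-varieties (with the diagonal action) and $I\subseteq\{1,\ldots,m\}$, put $X_I:=\prod_{i\in I}X_i$ and write $x_I\in X_I$ for the projection of $x\in X$. An orbit is closed if it is closed in the Zariski topology. Denote by $\delta(G,X)$ the minimal natural number $\delta$ such that for an arbitrary $x\in X$ with closed $G$-orbit there is a subset $I\subseteq\{1,\ldots,m\}$ with $|I|=\delta$ such that the orbit $G\cdot x_I$ is closed in $X_I$ and has the same dimension as the orbit $G\cdot x$ in $X$. Define $\delta(G)$ as the supremum of $\delta(G,X)$ as $X$ ranges over all finite products of affine $G$-varieties. *)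

theory Defs
  imports "HOL-Analysis.Analysis"
    "HOL-Computational_Algebra.Fundamental_Theorem_Algebra"
    "HOL-Library.Extended_Nat"
begin

section \<open>Polynomial functions and the Zariski topology\<close>

text \<open>The \<open>k\<close>-algebra of functions generated by a set \<open>S\<close> of functions; when \<open>S\<close> consists of
  coordinate functions these are the polynomial functions.\<close>

inductive_set polys :: "('p \<Rightarrow> 'k) set \<Rightarrow> ('p \<Rightarrow> 'k::comm_ring_1) set"
  for S :: "('p \<Rightarrow> 'k) set" where
  gen: "f \<in> S \<Longrightarrow> f \<in> polys S"
| const: "(\<lambda>_. c) \<in> polys S"
| add: "f \<in> polys S \<Longrightarrow> g \<in> polys S \<Longrightarrow> (\<lambda>p. f p + g p) \<in> polys S"
| mult: "f \<in> polys S \<Longrightarrow> g \<in> polys S \<Longrightarrow> (\<lambda>p. f p * g p) \<in> polys S"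

definition zero_locus :: "('p \<Rightarrow> 'k::comm_ring_1) set \<Rightarrow> 'p set \<Rightarrow> 'p set" where
  "zero_locus F P = {p \<in> P. \<forall>f\<in>F. f p = 0}"

text \<open>The topology on \<open>P\<close> whose closed sets are the zero loci of sets of functions from \<open>polys S\<close>.\<close>

definition zariski :: "('p \<Rightarrow> 'k::idom) set \<Rightarrow> 'p set \<Rightarrow> 'p topology" where
  "zariski S P = topology (\<lambda>U. \<exists>F \<subseteq> polys S. U = P - zero_locus F P)"

lemma istopology_zariski:
  "istopology (\<lambda>U. \<exists>F \<subseteq> polys S. U = P - zero_locus F (P :: 'p set))"
  for S :: "('p \<Rightarrow> 'k::idom) set"
proof -
  let ?T = "\<lambda>U. \<exists>F \<subseteq> polys S. U = P - zero_locus F P"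
  have 1: "?T (U \<inter> V)" if U: "?T U" and V: "?T V" for U V
  proof -
    obtain F G where F: "F \<subseteq> polys S" "U = P - zero_locus F P"
      and G: "G \<subseteq> polys S" "V = P - zero_locus G P"
      using U V by auto
    let ?H = "{(\<lambda>p. f p * g p) | f g. f \<in> F \<and> g \<in> G}"
    have "?H \<subseteq> polys S"
      using F G by (auto intro!: polys.mult)
    moreover have "U \<inter> V = P - zero_locus ?H P"
      unfolding F G zero_locus_def by fastforce
    ultimately show ?thesis by blast
  qed
  have 2: "?T (\<Union>K)" if K: "\<forall>U\<in>K. ?T U" for K
  proof -
    obtain F where F: "\<And>U. U \<in> K \<Longrightarrow> F U \<subseteq> polys S \<and> U = P - zero_locus (F U) P"
      using K by metis
    have "(\<Union>U\<in>K. F U) \<subseteq> polys S" using F by blast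
    moreover have "\<Union>K = (\<Union>U\<in>K. P - zero_locus (F U) P)" using F by auto
    then have "\<Union>K = P - zero_locus (\<Union>U\<in>K. F U) P"
      by (auto simp: zero_locus_def)
    ultimately show ?thesis by blast
  qed
  show ?thesis
    unfolding istopology_def using 1 2 by blast
qed

lemma openin_zariski:
  "openin (zariski S P) U \<longleftrightarrow> (\<exists>F \<subseteq> polys S. U = P - zero_locus F P)"
  unfolding zariski_def by (simp add: istopology_zariski topology_inverse')

lemma topspace_zariski [simp]: "topspace (zariski S P) = P"
proof
  show "topspace (zariski S P) \<subseteq> P"
    unfolding topspace_def openin_zariski by auto
  have "openin (zariski S P) P"
    unfolding openin_zariski
    by (rule exI[of _ "{\<lambda>_. 1}"]) (auto simp: zero_locus_def intro: polys.const)
  then show "P \<subseteq> topspace (zariski S P)" by (rule openin_subset)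
qed

lemma closedin_zariski:
  "closedin (zariski S P) C \<longleftrightarrow> (\<exists>F \<subseteq> polys S. C = zero_locus F P)"
proof -
  have "zero_locus F P \<subseteq> P" for F
    by (auto simp: zero_locus_def)
  then have "C \<subseteq> P \<and> P - C = P - zero_locus F P \<longleftrightarrow> C = zero_locus F P" for F
    by (metis Diff_Diff_Int inf.absorb_iff2)
  then show ?thesis
    unfolding closedin_def openin_zariski topspace_zariski by metis
qed

section \<open>Krull dimension of a topological space\<close>

definition irreducible_space :: "'p topology \<Rightarrow> bool" where
  "irreducible_space T \<longleftrightarrow> topspace T \<noteq> {} \<and>
     (\<forall>A B. closedin T A \<and> closedin T B \<and> topspace T = A \<union> B \<longrightarrow>
        A = topspace T \<or> B = topspace T)"

text \<open>Supremum of the lengths of chains of irreducible closed subsets. The empty space gets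
  dimension 0; only orbits, which are nonempty, are measured below.\<close>

definition krull_dim :: "'p topology \<Rightarrow> enat" where
  "krull_dim T = Sup {enat n | n. \<exists>Z :: nat \<Rightarrow> 'p set.
     (\<forall>i\<le>n. closedin T (Z i) \<and> irreducible_space (subtopology T (Z i))) \<and>
     (\<forall>i<n. Z i \<subset> Z (Suc i))}"

section \<open>Linear algebraic groups\<close>

text \<open>The coordinate algebra of \<open>GL\<^sub>n\<close> is generated by the matrix entries and \<open>1 / det\<close>.\<close>

definition GL_coord :: "('k::field^'n^'n \<Rightarrow> 'k) set" where
  "GL_coord = insert (\<lambda>A. inverse (det A)) {\<lambda>A. A $ i $ j | i j. True}"

definition linear_algebraic_group :: "('k::field^'n^'n) set \<Rightarrow> bool" where
  "linear_algebraic_group G \<longleftrightarrow>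
     closedin (zariski GL_coord {A. invertible A}) G \<and> mat 1 \<in> G \<and>
     (\<forall>A\<in>G. \<forall>B\<in>G. A ** B \<in> G) \<and> (\<forall>A\<in>G. matrix_inv A \<in> G)"

definition SL2 :: "(complex^2^2) set" where
  "SL2 = {A. det A = 1}"

lemma linear_algebraic_group_SL2: "linear_algebraic_group SL2"
proof -
  have "invertible A" if "det A = 1" for A :: "complex^2^2"
    using that by (simp add: invertible_det_nz)
  moreover define f where "f = (\<lambda>A :: complex^2^2. inverse (det A) + (- 1))"
  have "f \<in> polys GL_coord"
    unfolding f_def by (intro polys.add polys.const polys.gen) (simp add: GL_coord_def)
  moreover have "f A = 0 \<longleftrightarrow> det A = 1" for A
    by (simp add: f_def)
  ultimately have "closedin (zariski GL_coord {A. invertible A}) SL2"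
    unfolding closedin_zariski SL2_def zero_locus_def
    by (intro exI[of _ "{f}"]) auto
  moreover have "det (matrix_inv A) = 1" if A: "det A = 1" for A :: "complex^2^2"
  proof -
    have "invertible A" using A by (simp add: invertible_det_nz)
    then have "A ** matrix_inv A = mat 1"
      unfolding invertible_def matrix_inv_def by (metis (mono_tags, lifting) someI_ex)
    then have "det A * det (matrix_inv A) = 1" by (metis det_I det_mul)
    then show ?thesis using A by simp
  qed
  ultimately show ?thesis
    by (simp add: linear_algebraic_group_def SL2_def det_mul)
qed

section \<open>Affine varieties with a group action\<close>

text \<open>The affine space with coordinates indexed by \<open>V\<close> is the set \<open>V \<rightarrow>\<^sub>E UNIV\<close> of extensional
  functions. An affine variety is a Zariski closed subset of such a space, not necessarily
  irreducible.\<close>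

abbreviation affine_coord :: "'v set \<Rightarrow> (('v \<Rightarrow> 'k) \<Rightarrow> 'k) set" where
  "affine_coord V \<equiv> {\<lambda>x. x v | v. v \<in> V}"

record ('k, 'n, 'v) gvar =
  coords :: "'v set"
  pts :: "('v \<Rightarrow> 'k) set"
  act :: "'k^'n^'n \<Rightarrow> ('v \<Rightarrow> 'k) \<Rightarrow> ('v \<Rightarrow> 'k)"

text \<open>Generators of the coordinate algebra of \<open>GL\<^sub>n \<times> k\<^sup>V\<close>.\<close>

definition GL_affine_coord :: "'v set \<Rightarrow> (('k::field^'n^'n) \<times> ('v \<Rightarrow> 'k) \<Rightarrow> 'k) set" where
  "GL_affine_coord V = {\<lambda>(A, x). h A | h. h \<in> GL_coord} \<union> {\<lambda>(A, x). x v | v. v \<in> V}"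

text \<open>The last condition says that the action map \<open>G \<times> X \<rightarrow> X\<close> is a morphism of varieties.\<close>

definition affine_gvar :: "('k::field^'n^'n) set \<Rightarrow> ('k, 'n, 'v) gvar \<Rightarrow> bool" where
  "affine_gvar G X \<longleftrightarrow>
     finite (coords X) \<and>
     closedin (zariski (affine_coord (coords X)) (coords X \<rightarrow>\<^sub>E UNIV)) (pts X) \<and>
     (\<forall>g\<in>G. \<forall>x\<in>pts X. act X g x \<in> pts X) \<and>
     (\<forall>x\<in>pts X. act X (mat 1) x = x) \<and>
     (\<forall>g\<in>G. \<forall>h\<in>G. \<forall>x\<in>pts X. act X (g ** h) x = act X g (act X h x)) \<and>
     (\<forall>v\<in>coords X. \<exists>f\<in>polys (GL_affine_coord (coords X)).
        \<forall>g\<in>G. \<forall>x\<in>pts X. act X g x v = f (g, x))"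

definition gvar_top :: "('k::field, 'n::finite, 'v) gvar \<Rightarrow> ('v \<Rightarrow> 'k) topology" where
  "gvar_top X = zariski (affine_coord (coords X)) (pts X)"

definition orbit :: "('k^'n^'n) set \<Rightarrow> ('k, 'n, 'v) gvar \<Rightarrow> ('v \<Rightarrow> 'k) \<Rightarrow> ('v \<Rightarrow> 'k) set" where
  "orbit G X x = (\<lambda>g. act X g x) ` G"

definition closed_orbit ::
    "('k::field^'n^'n) set \<Rightarrow> ('k, 'n, 'v) gvar \<Rightarrow> ('v \<Rightarrow> 'k) \<Rightarrow> bool" where
  "closed_orbit G X x \<longleftrightarrow> closedin (gvar_top X) (orbit G X x)"

definition orbit_dim ::
    "('k::field^'n^'n) set \<Rightarrow> ('k, 'n, 'v) gvar \<Rightarrow> ('v \<Rightarrow> 'k) \<Rightarrow> enat" where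
  "orbit_dim G X x = krull_dim (subtopology (gvar_top X) (orbit G X x))"

section \<open>Products\<close>

text \<open>The product \<open>X\<^sub>I\<close> of the \<open>X\<^sub>i\<close>, \<open>i \<in> I\<close>, with the diagonal action, embedded in the affine space
  whose coordinates are the pairs \<open>(i, v)\<close> with \<open>v\<close> a coordinate of \<open>X\<^sub>i\<close>. The function
  \<open>component X i\<close> is the projection to \<open>X\<^sub>i\<close>, and \<open>project X I\<close> the projection \<open>x \<mapsto> x\<^sub>I\<close>.\<close>

definition component :: "('i \<Rightarrow> ('k, 'n::finite, 'v) gvar) \<Rightarrow> 'i \<Rightarrow> ('i \<times> 'v \<Rightarrow> 'k) \<Rightarrow> ('v \<Rightarrow> 'k)" where
  "component X i x = (\<lambda>v\<in>coords (X i). x (i, v))"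

definition prod_coords :: "('i \<Rightarrow> ('k, 'n::finite, 'v) gvar) \<Rightarrow> 'i set \<Rightarrow> ('i \<times> 'v) set" where
  "prod_coords X I = (SIGMA i:I. coords (X i))"

definition prod_gvar :: "('i \<Rightarrow> ('k, 'n::finite, 'v) gvar) \<Rightarrow> 'i set \<Rightarrow> ('k, 'n, 'i \<times> 'v) gvar" where
  "prod_gvar X I =
     \<lparr>coords = prod_coords X I,
      pts = {x \<in> prod_coords X I \<rightarrow>\<^sub>E UNIV. \<forall>i\<in>I. component X i x \<in> pts (X i)},
      act = (\<lambda>g x. \<lambda>(i, v)\<in>prod_coords X I. act (X i) g (component X i x) v)\<rparr>"

definition project ::
    "('i \<Rightarrow> ('k, 'n::finite, 'v) gvar) \<Rightarrow> 'i set \<Rightarrow> ('i \<times> 'v \<Rightarrow> 'k) \<Rightarrow> ('i \<times> 'v \<Rightarrow> 'k)" where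
  "project X I x = restrict x (prod_coords X I)"

lemma project_in_pts:
  assumes "J \<subseteq> I" "x \<in> pts (prod_gvar X I)"
  shows "project X J x \<in> pts (prod_gvar X J)"
proof -
  have "component X i (project X J x) = component X i x" if "i \<in> J" for i
    using that by (auto simp: component_def project_def prod_coords_def restrict_def)
  then show ?thesis using assms by (auto simp: prod_gvar_def project_def)
qed

lemma polys_pullback:
  assumes "f \<in> polys S" and "\<And>h. h \<in> S \<Longrightarrow> (\<lambda>p. h (\<phi> p)) \<in> polys S'"
  shows "(\<lambda>p. f (\<phi> p)) \<in> polys S'"
  using assms(1) by induction (auto intro: assms(2) polys.intros)

lemma affine_gvar_prod_gvar:
  fixes X :: "'i \<Rightarrow> ('k::field, 'n::finite, 'v) gvar"
  assumes fin: "finite I" and X: "\<And>i. i \<in> I \<Longrightarrow> affine_gvar G (X i)"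
    and grp: "linear_algebraic_group G"
  shows "affine_gvar G (prod_gvar X I)"
proof -
  let ?C = "prod_coords X I" and ?P = "prod_gvar X I"
  have coords: "coords ?P = ?C" by (simp add: prod_gvar_def)
  have pts: "x \<in> pts ?P \<longleftrightarrow> x \<in> ?C \<rightarrow>\<^sub>E UNIV \<and> (\<forall>i\<in>I. component X i x \<in> pts (X i))" for x
    by (simp add: prod_gvar_def)
  have act: "act ?P g x (i, v) = act (X i) g (component X i x) v" if "(i, v) \<in> ?C" for g x i v
    using that by (simp add: prod_gvar_def)
  have pts_ext: "y \<in> extensional (coords (X i))" if "i \<in> I" "y \<in> pts (X i)" for i y
    using X[OF that(1)] that(2) closedin_subset[of _ "pts (X i)"]
    by (fastforce simp: affine_gvar_def PiE_def)
  have comp_act: "component X i (act ?P g x) = act (X i) g (component X i x)"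
    if "i \<in> I" "g \<in> G" "x \<in> pts ?P" for i g x
  proof -
    have "act (X i) g (component X i x) \<in> pts (X i)"
      using X[OF that(1)] that by (auto simp: affine_gvar_def pts)
    from pts_ext[OF that(1) this] show ?thesis
      using that(1)
      by (intro ext) (auto simp: component_def prod_gvar_def prod_coords_def restrict_def extensional_def)
  qed
  have eqI: "x = y" if "x \<in> ?C \<rightarrow>\<^sub>E UNIV" "y \<in> ?C \<rightarrow>\<^sub>E UNIV"
     "\<And>i. i \<in> I \<Longrightarrow> component X i x = component X i y" for x y :: "'i \<times> 'v \<Rightarrow> 'k"
  proof (rule PiE_ext[OF that(1,2)])
    fix p assume p: "p \<in> ?C"
    obtain i v where iv: "p = (i, v)" by force
    have "component X i x v = component X i y v"
      using that(3) p iv by (simp add: prod_coords_def)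
    then show "x p = y p" using p iv by (simp add: component_def prod_coords_def)
  qed
  have act_E: "act ?P g x \<in> ?C \<rightarrow>\<^sub>E UNIV" for g x
    by (simp add: prod_gvar_def)
  have act_pts: "act ?P g x \<in> pts ?P" if "g \<in> G" "x \<in> pts ?P" for g x
    using that X act_E by (simp add: pts comp_act) (auto simp: affine_gvar_def)
  have "finite ?C"
    using fin X by (auto simp: prod_coords_def affine_gvar_def)
  moreover have "closedin (zariski (affine_coord ?C) (?C \<rightarrow>\<^sub>E UNIV)) (pts ?P)"
  proof -
    have "\<forall>i\<in>I. \<exists>F. F \<subseteq> polys (affine_coord (coords (X i))) \<and>
        pts (X i) = zero_locus F (coords (X i) \<rightarrow>\<^sub>E UNIV)"
      using X by (auto simp: affine_gvar_def closedin_zariski)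
    from bchoice[OF this] obtain F where
      F: "\<And>i. i \<in> I \<Longrightarrow> F i \<subseteq> polys (affine_coord (coords (X i)))"
      "\<And>i. i \<in> I \<Longrightarrow> pts (X i) = zero_locus (F i) (coords (X i) \<rightarrow>\<^sub>E UNIV)"
      by blast
    let ?F = "\<Union>i\<in>I. (\<lambda>f x. f (component X i x)) ` F i"
    have "?F \<subseteq> polys (affine_coord ?C)"
    proof clarify
      fix i f assume i: "i \<in> I" and f: "f \<in> F i"
      show "(\<lambda>x. f (component X i x)) \<in> polys (affine_coord ?C)"
      proof (rule polys_pullback[where \<phi> = "component X i"])
        show "f \<in> polys (affine_coord (coords (X i)))" using F(1) i f by blast
        fix h :: "('v \<Rightarrow> 'k) \<Rightarrow> 'k" assume "h \<in> affine_coord (coords (X i))"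
        then obtain v where "v \<in> coords (X i)" "h = (\<lambda>x. x v)" by auto
        then show "(\<lambda>p. h (component X i p)) \<in> polys (affine_coord ?C)"
          using i by (auto simp: component_def prod_coords_def intro!: polys.gen)
      qed
    qed
    moreover have "pts ?P = zero_locus ?F (?C \<rightarrow>\<^sub>E UNIV)"
      using F(2) by (auto simp: pts zero_locus_def component_def)
    ultimately show ?thesis unfolding closedin_zariski by blast
  qed
  moreover have "act ?P (mat 1) x = x" if "x \<in> pts ?P" for x
  proof (rule eqI)
    show "component X i (act ?P (mat 1) x) = component X i x" if "i \<in> I" for i
      using that \<open>x \<in> pts ?P\<close> grp X[OF that]
      by (simp add: comp_act linear_algebraic_group_def affine_gvar_def pts)
  qed (use that act_E pts in auto)
  moreover have "act ?P (g ** h) x = act ?P g (act ?P h x)"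
    if gh: "g \<in> G" "h \<in> G" and x: "x \<in> pts ?P" for g h x
  proof (rule eqI)
    show "component X i (act ?P (g ** h) x) = component X i (act ?P g (act ?P h x))"
      if "i \<in> I" for i
      using that gh x grp X[OF that] act_pts[OF gh(2) x]
      by (simp add: comp_act linear_algebraic_group_def affine_gvar_def pts)
  qed (use act_E in auto)
  moreover have "\<exists>f\<in>polys (GL_affine_coord ?C). \<forall>g\<in>G. \<forall>x\<in>pts ?P. act ?P g x p = f (g, x)"
    if p: "p \<in> ?C" for p
  proof -
    obtain i v where iv: "p = (i, v)" "i \<in> I" "v \<in> coords (X i)"
      using p by (auto simp: prod_coords_def)
    obtain f where f: "f \<in> polys (GL_affine_coord (coords (X i)))"
      "\<And>g x. g \<in> G \<Longrightarrow> x \<in> pts (X i) \<Longrightarrow> act (X i) g x v = f (g, x)"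
      using X[OF iv(2)] iv(3) unfolding affine_gvar_def by blast
    have "(\<lambda>q. f ((\<lambda>(g, x). (g, component X i x)) q)) \<in> polys (GL_affine_coord ?C)"
    proof (rule polys_pullback[where \<phi> = "\<lambda>(g, x). (g, component X i x)", OF f(1)])
      fix h :: "('k^'n^'n) \<times> ('v \<Rightarrow> 'k) \<Rightarrow> 'k" assume "h \<in> GL_affine_coord (coords (X i))"
      then consider k where "k \<in> GL_coord" "h = (\<lambda>(A, x). k A)"
        | w where "w \<in> coords (X i)" "h = (\<lambda>(A, x). x w)"
        by (auto simp: GL_affine_coord_def)
      then show "(\<lambda>q. h ((\<lambda>(g, x). (g, component X i x)) q)) \<in> polys (GL_affine_coord ?C)"
      proof cases
        case 1
        then have "(\<lambda>q. h ((\<lambda>(g, x). (g, component X i x)) q)) = (\<lambda>(A, x). k A)" by auto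
        then show ?thesis using 1 by (auto simp: GL_affine_coord_def intro!: polys.gen)
      next
        case 2
        then have "(\<lambda>q. h ((\<lambda>(g, x). (g, component X i x)) q)) = (\<lambda>(A, x). x (i, w))"
          by (auto simp: component_def)
        then show ?thesis using 2 iv
          by (auto simp: GL_affine_coord_def prod_coords_def intro!: polys.gen)
      qed
    qed
    then show ?thesis
      using f(2) iv p by (intro bexI) (auto simp: act pts)
  qed
  ultimately show ?thesis
    unfolding affine_gvar_def coords using act_pts by blast
qed

section \<open>The invariant \<open>\<delta>\<close>\<close>

definition delta_prod ::
    "('k::field^'n^'n) set \<Rightarrow> nat \<Rightarrow> (nat \<Rightarrow> ('k, 'n, 'v) gvar) \<Rightarrow> nat" where
  "delta_prod G m X =
     (LEAST d. \<forall>x\<in>pts (prod_gvar X {1..m}). closed_orbit G (prod_gvar X {1..m}) x \<longrightarrow>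
        (\<exists>I\<subseteq>{1..m}. card I = d \<and>
           closed_orbit G (prod_gvar X I) (project X I x) \<and>
           orbit_dim G (prod_gvar X I) (project X I x) = orbit_dim G (prod_gvar X {1..m}) x))"

text \<open>Every affine \<open>G\<close>-variety is isomorphic to one with coordinates indexed by natural numbers, so
  the supremum over varieties with \<^typ>\<open>nat\<close>-indexed coordinates is the supremum over all of them.
  It is taken in \<^typ>\<open>enat\<close>, where it exists even if unbounded.\<close>

definition delta :: "('k::alg_closed_field^'n^'n) set \<Rightarrow> enat" where
  "delta G = Sup {enat (delta_prod G m X) | m (X :: nat \<Rightarrow> ('k, 'n, nat) gvar).
     \<forall>i\<in>{1..m}. affine_gvar G (X i)}"

end

theory Submission
  imports Defs
begin

text \<open>For a point \<open>x\<close> with closed orbit consider the set \<open>D x\<close> of points of the projective line whose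
  one-parameter subgroups have a limit at \<open>x\<close>. If \<open>D x\<close> is nonempty, the orbit contains a point fixed
  by a torus, and every component of it that is not fixed by the whole group has an orbit that is
  closed and of the same dimension. If \<open>D x\<close> is empty, then, since \<open>D x\<close> is the intersection of the sets
  \<open>D (x i)\<close> and each of these has at most two points unless it is everything, three of them already have
  empty intersection. In all cases the coordinate functions of the orbit of \<open>x\<close> are integral over
  those of its projection, by a valuation theoretic version of the Hilbert-Mumford criterion: in a
  valuation ring containing the coordinates of \<open>g \<cdot> x\<close> for the projected point, write
  \<open>g = k \<cdot> diag(a, 1/a) \<cdot> k'\<close> with \<open>k\<close>, \<open>k'\<close> over the valuation ring; if \<open>a\<close> is not in the ring, the residue
  of \<open>k'\<close> gives an element of \<open>D\<close>. An integral projection is closed and preserves the dimension.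

  For the lower bound take three binary quadratic forms \<open>l1 l2\<close>, \<open>l2 l3\<close>, \<open>l3 l1\<close>: their orbit is
  closed, but two of them have a common factor, so that no pair has a closed orbit. Triples of squares
  of linear forms rule out subsets with fewer than two elements.\<close>

section \<open>Functions modulo an ultrafilter\<close>

text \<open>Closedness of the projected orbit and equality of dimensions are drawn from one
  property, the integrality of the coordinate functions; stabilizers and a dimension formula for
  orbits never enter. A failure of integrality is an escape to infinity inside the orbit that the
  projection does not see. The orbit is not known to be irreducible, so it is not given a function
  field; functions modulo an ultrafilter on its points take that place, and the group element above
  each point may then be chosen arbitrarily. The number three comes from the two fixed points of a
  torus on the projective line: a component fixed by a torus but not by the group has limits in
  exactly two directions, and excluding each of them costs one more component. When the whole point
  is fixed by a torus, motion along the torus is invisible; only the combination a^2 b of the pivot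
  decomposition matters, and one component not fixed by the group controls it. Since
  \<open>delta_prod\<close> prescribes the number of components exactly, subsets are padded to three
  elements, and the lower bound excludes 0, 1 and 2 one by one.\<close>

text \<open>The functions on a set modulo equality almost everywhere with respect to an ultrafilter form
  a field. No quotient is taken: a subring of this field is represented by a set of functions that is
  closed under equality almost everywhere.\<close>

definition ultra :: "'y filter \<Rightarrow> bool" where
  "ultra U \<longleftrightarrow> U \<noteq> bot \<and> (\<forall>P. eventually P U \<or> eventually (\<lambda>y. \<not> P y) U)"

lemma ultra_exists:
  assumes "F \<noteq> bot"
  obtains U where "U \<le> F" "ultra U"
proof -
  let ?A = "{G. G \<noteq> bot \<and> G \<le> F}"
  have "\<exists>U\<in>?A. \<forall>G\<in>?A. G \<le> U \<longrightarrow> G = U"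
  proof (rule predicate_Zorn)
    show "partial_order_on ?A (relation_of (\<lambda>U G. G \<le> U) ?A)"
      by (rule partial_order_on_relation_ofI) auto
    fix C assume C: "C \<in> Chains (relation_of (\<lambda>U G. G \<le> U) ?A)"
    have sub: "C \<subseteq> ?A" using C by (auto simp: Chains_def relation_of_def)
    have lin: "G \<le> H \<or> H \<le> G" if "G \<in> C" "H \<in> C" for G H
      using C that by (auto simp: Chains_def relation_of_def)
    show "\<exists>u\<in>?A. \<forall>a\<in>C. u \<le> a"
    proof (cases "C = {}")
      case False
      \<comment> \<open>For a chain, whatever holds eventually for the infimum already holds
        eventually for one member.\<close>
      have "Inf C \<noteq> bot"
      proof
        assume "Inf C = bot"
        then have "eventually (\<lambda>_. False) (Inf C)" by simp
        then obtain G where "G \<in> C" "eventually (\<lambda>_. False) G"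
          using eventually_Inf_base[OF False, of "\<lambda>_. False"] lin by (metis inf.orderE inf_commute order_refl)
        then show False using sub by (auto simp: trivial_limit_def)
      qed
      moreover obtain G where "G \<in> C" using False by blast
      then have "Inf C \<le> F" using sub Inf_lower[of G C] by (force intro: order_trans)
      ultimately show ?thesis by (intro bexI[of _ "Inf C"]) (auto intro: Inf_lower)
    qed (use assms in auto)
  qed
  then obtain U where U: "U \<noteq> bot" "U \<le> F" and max: "\<And>G. G \<noteq> bot \<Longrightarrow> G \<le> U \<Longrightarrow> G = U"
    by (metis (mono_tags, lifting) mem_Collect_eq order_trans)
  have "eventually P U \<or> eventually (\<lambda>y. \<not> P y) U" for P
  proof (cases "inf U (principal {y. P y}) = bot")
    case True
    then have "eventually (\<lambda>_. False) (inf U (principal {y. P y}))" by simp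
    then show ?thesis by (simp add: eventually_inf_principal)
  next
    case False
    then have "inf U (principal {y. P y}) = U" using max by simp
    moreover have "eventually P (inf U (principal {y. P y}))"
      by (simp add: eventually_inf_principal)
    ultimately show ?thesis by simp
  qed
  with U show ?thesis using that by (auto simp: ultra_def)
qed

text \<open>The hypotheses make the family a filter base. It is applied to predicates saying that
  some function does not vanish, where a product of two functions witnesses
  \<open>mult\<close>.\<close>

lemma ultra_multiplicative:
  assumes ne: "\<P> \<noteq> {}" and nz: "\<And>P. P \<in> \<P> \<Longrightarrow> \<exists>y. P y"
    and mult: "\<And>P Q. P \<in> \<P> \<Longrightarrow> Q \<in> \<P> \<Longrightarrow> \<exists>R\<in>\<P>. \<forall>y. R y \<longrightarrow> P y \<and> Q y"
  obtains U where "ultra U" "\<And>P. P \<in> \<P> \<Longrightarrow> eventually P U"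
proof -
  let ?F = "INF P\<in>\<P>. principal {y. P y}"
  have ev: "eventually Q ?F \<longleftrightarrow> (\<exists>P\<in>\<P>. \<forall>y. P y \<longrightarrow> Q y)" for Q
  proof (subst eventually_INF_base[OF ne])
    show "\<exists>x\<in>\<P>. principal {y. x y} \<le> inf (principal {y. a y}) (principal {y. b y})"
      if "a \<in> \<P>" "b \<in> \<P>" for a b
      using mult[OF that] by (auto simp: subset_iff)
  qed (simp add: eventually_principal)
  have "?F \<noteq> bot"
    unfolding trivial_limit_def ev using nz by blast
  then obtain U where "U \<le> ?F" "ultra U" by (rule ultra_exists)
  moreover have "eventually P ?F" if "P \<in> \<P>" for P
    unfolding ev using that by blast
  ultimately show ?thesis using that filter_leD by blast
qed

locale function_algebra =
  fixes U :: "'y filter" and A :: "('y \<Rightarrow> 'k::field) set"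
  assumes const: "(\<lambda>_. c) \<in> A"
    and add: "f \<in> A \<Longrightarrow> g \<in> A \<Longrightarrow> (\<lambda>y. f y + g y) \<in> A"
    and mult: "f \<in> A \<Longrightarrow> g \<in> A \<Longrightarrow> (\<lambda>y. f y * g y) \<in> A"
    and cong: "f \<in> A \<Longrightarrow> eventually (\<lambda>y. f y = g y) U \<Longrightarrow> g \<in> A"
begin

lemma uminus: "f \<in> A \<Longrightarrow> (\<lambda>y. - f y) \<in> A"
  using mult[OF const[of "- 1"]] by simp

lemma diff: "f \<in> A \<Longrightarrow> g \<in> A \<Longrightarrow> (\<lambda>y. f y - g y) \<in> A"
  using add[OF _ uminus] by simp

lemma sum: "finite I \<Longrightarrow> (\<And>i. i \<in> I \<Longrightarrow> f i \<in> A) \<Longrightarrow> (\<lambda>y. \<Sum>i\<in>I. f i y) \<in> A"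
  by (induction I rule: finite_induct) (auto intro: const add)

lemma power: "f \<in> A \<Longrightarrow> (\<lambda>y. f y ^ n) \<in> A"
  by (induction n) (auto intro: const mult)

lemma poly: "f \<in> A \<Longrightarrow> (\<lambda>y. poly p (f y)) \<in> A"
  unfolding poly_altdef by (intro sum mult const power) auto

lemma pullback:
  assumes "f \<in> polys S" and "\<And>h. h \<in> S \<Longrightarrow> (\<lambda>y. h (\<gamma> y)) \<in> A"
  shows "(\<lambda>y. f (\<gamma> y)) \<in> A"
  using assms(1) by induction (auto intro: assms(2) const add mult)

end

lemma function_algebra_polys: "function_algebra top (polys S)"
proof
  show "g \<in> polys S" if "f \<in> polys S" "eventually (\<lambda>y. f y = g y) top" for f g :: "'a \<Rightarrow> 'b"
  proof -
    have "f = g" using that(2) by (auto simp: eventually_top)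
    then show ?thesis using that(1) by simp
  qed
qed (auto intro: polys.intros)

section \<open>Ideals and adjunction of one element\<close>

inductive_set ideal_gen :: "'y filter \<Rightarrow> ('y \<Rightarrow> 'k) set \<Rightarrow> ('y \<Rightarrow> 'k) set \<Rightarrow> ('y \<Rightarrow> 'k::field) set"
  for U M B where
  zero: "(\<lambda>_. 0) \<in> ideal_gen U M B"
| gen: "m \<in> M \<Longrightarrow> b \<in> B \<Longrightarrow> (\<lambda>y. m y * b y) \<in> ideal_gen U M B"
| add: "f \<in> ideal_gen U M B \<Longrightarrow> g \<in> ideal_gen U M B \<Longrightarrow> (\<lambda>y. f y + g y) \<in> ideal_gen U M B"
| cong: "f \<in> ideal_gen U M B \<Longrightarrow> eventually (\<lambda>y. f y = g y) U \<Longrightarrow> g \<in> ideal_gen U M B"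

text \<open>Each generator already carries a factor from \<open>B\<close>, which absorbs the new
  one.\<close>

lemma ideal_gen_mult:
  assumes "f \<in> ideal_gen U M B" "b \<in> B" "function_algebra U B"
  shows "(\<lambda>y. f y * b y) \<in> ideal_gen U M B"
  using assms(1)
proof induction
  case (gen m b')
  have "(\<lambda>y. m y * (b' y * b y)) \<in> ideal_gen U M B"
    using gen assms by (intro ideal_gen.gen) (auto intro: function_algebra.mult)
  then show ?case by (simp add: mult.assoc)
next
  case (add f g)
  then show ?case using ideal_gen.add by (fastforce simp: distrib_right)
next
  case (cong f g)
  show ?case by (rule ideal_gen.cong[OF cong.IH]) (use cong.hyps(2) in \<open>auto elim: eventually_mono\<close>)
qed (simp add: ideal_gen.zero)

lemma ideal_gen_sum:
  "finite I \<Longrightarrow> (\<And>i. i \<in> I \<Longrightarrow> f i \<in> ideal_gen U M B) \<Longrightarrow> (\<lambda>y. \<Sum>i\<in>I. f i y) \<in> ideal_gen U M B"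
  by (induction I rule: finite_induct) (auto intro: ideal_gen.zero ideal_gen.add)

lemma ideal_gen_subset:
  assumes "f \<in> ideal_gen U M B" "M \<subseteq> B" "function_algebra U B"
  shows "f \<in> B"
  using assms(1)
  by induction (use assms(2,3) in \<open>auto intro: function_algebra.add function_algebra.const
      function_algebra.mult function_algebra.cong\<close>)

text \<open>A polynomial over \<open>B\<close> is a family of polynomials of bounded degree over the ground field
  whose coefficient functions lie in \<open>B\<close>.\<close>

definition polyfam :: "('y \<Rightarrow> 'k::field) set \<Rightarrow> ('y \<Rightarrow> 'k poly) \<Rightarrow> nat \<Rightarrow> bool" where
  "polyfam B p n \<longleftrightarrow> (\<forall>i. (\<lambda>y. coeff (p y) i) \<in> B) \<and> (\<forall>y. degree (p y) \<le> n)"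

definition adjoin :: "'y filter \<Rightarrow> ('y \<Rightarrow> 'k) set \<Rightarrow> ('y \<Rightarrow> 'k) \<Rightarrow> ('y \<Rightarrow> 'k::field) set" where
  "adjoin U B u = {h. \<exists>p n. polyfam B p n \<and> eventually (\<lambda>y. h y = poly (p y) (u y)) U}"

lemma poly_polyfam: "polyfam B p n \<Longrightarrow> poly (p y) x = (\<Sum>i\<le>n. coeff (p y) i * x ^ i)"
  unfolding poly_altdef polyfam_def
  by (intro sum.mono_neutral_left) (auto simp: coeff_eq_0 intro: ccontr)

lemma (in function_algebra) polyfam_mult:
  assumes "polyfam A p n" "polyfam A q m"
  shows "polyfam A (\<lambda>y. p y * q y) (n + m)"
  unfolding polyfam_def
proof (intro conjI allI)
  show "(\<lambda>y. coeff (p y * q y) i) \<in> A" for i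
    unfolding coeff_mult using assms by (intro sum mult) (auto simp: polyfam_def)
  show "degree (p y * q y) \<le> n + m" for y
    using assms degree_mult_le[of "p y" "q y"] by (meson add_mono order_trans polyfam_def)
qed

context function_algebra
begin

lemma adjoin_superset: "A \<subseteq> adjoin V A u"
proof
  fix b assume b: "b \<in> A"
  have "polyfam A (\<lambda>y. [:b y:]) 0"
    unfolding polyfam_def
  proof (intro conjI allI)
    show "(\<lambda>y. coeff [:b y:] i) \<in> A" for i
      using b const[of 0] by (cases i) auto
  qed auto
  then show "b \<in> adjoin V A u" unfolding adjoin_def by force
qed

lemma adjoin_self: "u \<in> adjoin V A u"
proof -
  have "polyfam A (\<lambda>y. [:0, 1:]) 1"
    unfolding polyfam_def by (auto intro: const)
  then show "u \<in> adjoin V A u" unfolding adjoin_def by force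
qed

lemma function_algebra_adjoin: "function_algebra V (adjoin V A u)"
proof
  show "(\<lambda>_. c) \<in> adjoin V A u" for c using adjoin_superset const by blast
next
  fix f g assume "f \<in> adjoin V A u" "g \<in> adjoin V A u"
  then obtain p n q m where p: "polyfam A p n" "eventually (\<lambda>y. f y = poly (p y) (u y)) V"
    and q: "polyfam A q m" "eventually (\<lambda>y. g y = poly (q y) (u y)) V"
    unfolding adjoin_def by blast
  have "polyfam A (\<lambda>y. p y + q y) (max n m)"
    using p(1) q(1) by (auto simp: polyfam_def intro!: add degree_add_le intro: le_max_iff_disj[THEN iffD2])
  moreover have "eventually (\<lambda>y. f y + g y = poly (p y + q y) (u y)) V"
    using p(2) q(2) by eventually_elim simp
  ultimately show "(\<lambda>y. f y + g y) \<in> adjoin V A u" unfolding adjoin_def by blast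
  have "eventually (\<lambda>y. f y * g y = poly (p y * q y) (u y)) V"
    using p(2) q(2) by eventually_elim simp
  with polyfam_mult[OF p(1) q(1)] show "(\<lambda>y. f y * g y) \<in> adjoin V A u" unfolding adjoin_def by blast
next
  fix f g assume "f \<in> adjoin V A u" and fg: "eventually (\<lambda>y. f y = g y) V"
  then obtain p n where p: "polyfam A p n" "eventually (\<lambda>y. f y = poly (p y) (u y)) V"
    unfolding adjoin_def by blast
  have "eventually (\<lambda>y. g y = poly (p y) (u y)) V"
    using p(2) fg by eventually_elim simp
  then show "g \<in> adjoin V A u" using p(1) unfolding adjoin_def by blast
qed

text \<open>This turns the statement that \<open>M\<close> generates the unit ideal after adjoining
  \<open>u\<close> into an equation 1 = p(u) with coefficients in the ideal generated over
  \<open>A\<close>.\<close>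

lemma ideal_gen_adjoin:
  assumes "h \<in> ideal_gen U M (adjoin U A u)"
  shows "\<exists>p n. polyfam (ideal_gen U M A) p n \<and> eventually (\<lambda>y. h y = poly (p y) (u y)) U"
  using assms
proof induction
  case zero
  show ?case by (rule exI[of _ "\<lambda>_. 0"]) (auto simp: polyfam_def ideal_gen.zero)
next
  case (gen m b)
  then obtain q n where q: "polyfam A q n" "eventually (\<lambda>y. b y = poly (q y) (u y)) U"
    unfolding adjoin_def by blast
  have "polyfam (ideal_gen U M A) (\<lambda>y. smult (m y) (q y)) n"
    using q(1) gen(1) by (auto simp: polyfam_def intro: ideal_gen.gen order_trans[OF degree_smult_le])
  moreover have "eventually (\<lambda>y. m y * b y = poly (smult (m y) (q y)) (u y)) U"
    using q(2) by eventually_elim simp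
  ultimately show ?case by blast
next
  case (add f g)
  then obtain p n q m where p: "polyfam (ideal_gen U M A) p n" "eventually (\<lambda>y. f y = poly (p y) (u y)) U"
    and q: "polyfam (ideal_gen U M A) q m" "eventually (\<lambda>y. g y = poly (q y) (u y)) U"
    by blast
  have "polyfam (ideal_gen U M A) (\<lambda>y. p y + q y) (max n m)"
    using p(1) q(1)
    by (auto simp: polyfam_def intro!: ideal_gen.add degree_add_le intro: le_max_iff_disj[THEN iffD2])
  moreover have "eventually (\<lambda>y. f y + g y = poly (p y + q y) (u y)) U"
    using p(2) q(2) by eventually_elim simp
  ultimately show ?case by blast
next
  case (cong f g)
  then obtain p n where p: "polyfam (ideal_gen U M A) p n" "eventually (\<lambda>y. f y = poly (p y) (u y)) U"
    by blast
  have "eventually (\<lambda>y. g y = poly (p y) (u y)) U"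
    using p(2) cong.hyps(2) by eventually_elim simp
  then show ?case using p(1) by blast
qed

end

section \<open>Valuation rings\<close>

locale valuation_algebra = function_algebra +
  assumes ultra: "ultra U"
    and val: "u \<in> A \<or> (\<lambda>y. inverse (u y)) \<in> A"
begin

text \<open>These are the nonunits. That they are closed under addition rests on the valuation
  property and is shown in \<open>maxid_add\<close>.\<close>

definition maxid where
  "maxid = {f \<in> A. \<forall>g\<in>A. \<not> eventually (\<lambda>y. f y * g y = 1) U}"

end

text \<open>If 1 is a polynomial over the ideal both in \<open>u\<close> and in
  \<open>1 / u\<close>, the equation of larger degree can be shortened with the help of the other
  one, down to degree 0, where 1 would lie in the ideal. Induction on the sum of the degrees
  replaces the choice of minimal equations.\<close>

lemma valuation_step:
  fixes u :: "'y \<Rightarrow> 'k::field"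
  assumes U: "ultra U" and B: "function_algebra U B" and MB: "M \<subseteq> B"
    and one: "(\<lambda>_. 1) \<notin> ideal_gen U M B"
    and unit: "\<And>e. e \<in> B \<Longrightarrow> (\<lambda>y. e y - 1) \<in> ideal_gen U M B \<Longrightarrow> (\<lambda>y. inverse (e y)) \<in> B"
    and u: "eventually (\<lambda>y. u y \<noteq> 0) U"
    and p: "polyfam (ideal_gen U M B) p n" "eventually (\<lambda>y. poly (p y) (u y) = 1) U"
    and q: "polyfam (ideal_gen U M B) q m" "eventually (\<lambda>y. poly (q y) (inverse (u y)) = 1) U"
  shows False
  using u p q
proof (induction "n + m" arbitrary: n m u p q rule: less_induct)
  case less
  interpret B: function_algebra U B by fact
  let ?J = "ideal_gen U M B"
  have step: "\<exists>p'. polyfam ?J p' (n - 1) \<and> eventually (\<lambda>y. poly (p' y) (u y) = 1) U"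
    if mn: "m \<le> n" and n0: "n > 0" and u: "eventually (\<lambda>y. u y \<noteq> 0) U"
      and p: "polyfam ?J p n" "eventually (\<lambda>y. poly (p y) (u y) = 1) U"
      and q: "polyfam ?J q m" "eventually (\<lambda>y. poly (q y) (inverse (u y)) = 1) U" for n m p q u
  proof -
    define e where "e = (\<lambda>y. 1 - coeff (q y) 0)"
    have cp: "(\<lambda>y. coeff (p y) i) \<in> ?J" and cq: "(\<lambda>y. coeff (q y) i) \<in> ?J" for i
      using p(1) q(1) by (auto simp: polyfam_def)
    have "e \<in> B"
      unfolding e_def using ideal_gen_subset[OF cq MB B] by (intro B.diff B.const)
    moreover have "(\<lambda>y. e y - 1) \<in> ?J"
      using ideal_gen_mult[OF cq[of 0] B.const[of "- 1"] B] by (simp add: e_def)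
    ultimately have f: "(\<lambda>y. inverse (e y)) \<in> B" by (rule unit)
    have "eventually (\<lambda>y. e y \<noteq> 0) U"
    proof (rule ccontr)
      assume "\<not> eventually (\<lambda>y. e y \<noteq> 0) U"
      then have "eventually (\<lambda>y. e y = 0) U" using U by (auto simp: ultra_def)
      then have "eventually (\<lambda>y. coeff (q y) 0 = 1) U" by eventually_elim (simp add: e_def)
      then show False using one ideal_gen.cong[OF cq[of 0], of "\<lambda>_. 1"] by blast
    qed
    \<comment> \<open>The second equation reads e = q_1/u + ... + q_m/u^m. Multiplied by p_n u^n / e
      it expresses the top term p_n u^n through the lower powers c_j u^(n-j); these exponents are
      natural numbers because \<open>m \<le> n\<close>.\<close>
    define c where "c = (\<lambda>j y. coeff (p y) n * inverse (e y) * coeff (q y) j)"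
    have cJ: "c j \<in> ?J" for j
      using ideal_gen_mult[OF ideal_gen_mult[OF cp[of n] f B] ideal_gen_subset[OF cq[of j] MB B] B]
      by (simp add: c_def)
    define p' where "p' = (\<lambda>y. p y - monom (coeff (p y) n) n + (\<Sum>j\<in>{1..m}. monom (c j y) (n - j)))"
    have co: "coeff (p' y) i = (if i = n then 0 else coeff (p y) i)
        + (\<Sum>j\<in>{1..m}. if n - j = i then c j y else 0)" for y i
      by (simp add: p'_def coeff_sum)
    have "polyfam ?J p' (n - 1)"
      unfolding polyfam_def
    proof (intro conjI allI)
      fix i
      have "(\<lambda>y. if i = n then 0 else coeff (p y) i) \<in> ?J"
        using cp[of i] ideal_gen.zero by (cases "i = n") simp_all
      moreover have "(\<lambda>y. if n - j = i then c j y else 0) \<in> ?J" for j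
        using cJ[of j] ideal_gen.zero by (cases "n - j = i") simp_all
      ultimately show "(\<lambda>y. coeff (p' y) i) \<in> ?J"
        unfolding co by (intro ideal_gen.add ideal_gen_sum) simp_all
    next
      show "degree (p' y) \<le> n - 1" for y
      proof (rule degree_le, intro allI impI)
        fix i assume i: "n - 1 < i"
        have "degree (p y) \<le> n" using p(1) by (simp add: polyfam_def)
        then have "i \<noteq> n \<Longrightarrow> coeff (p y) i = 0" using i by (intro coeff_eq_0) linarith
        then show "coeff (p' y) i = 0" unfolding co using i n0 by (auto intro!: sum.neutral)
      qed
    qed
    moreover have "eventually (\<lambda>y. poly (p' y) (u y) = 1) U"
      using p(2) q(2) u \<open>eventually (\<lambda>y. e y \<noteq> 0) U\<close>
    proof eventually_elim
      case (elim y)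
      have "1 = (\<Sum>j\<le>m. coeff (q y) j * inverse (u y) ^ j)"
        using elim(2) poly_polyfam[OF q(1)] by metis
      also have "\<dots> = coeff (q y) 0 + (\<Sum>j\<in>{1..m}. coeff (q y) j * inverse (u y) ^ j)"
        by (simp add: atMost_atLeast0 sum.atLeast_Suc_atMost)
      finally have e: "(\<Sum>j\<in>{1..m}. coeff (q y) j * inverse (u y) ^ j) = e y" by (simp add: e_def algebra_simps)
      have "(\<Sum>j\<in>{1..m}. c j y * u y ^ (n - j))
          = (\<Sum>j\<in>{1..m}. coeff (p y) n * inverse (e y) * u y ^ n * (coeff (q y) j * inverse (u y) ^ j))"
        using mn elim(3) by (intro sum.cong) (auto simp: c_def power_diff field_simps)
      also have "\<dots> = coeff (p y) n * u y ^ n"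
        unfolding sum_distrib_left[symmetric] e using elim(4) by simp
      finally show ?case using elim(1) by (simp add: p'_def poly_sum poly_monom)
    qed
    ultimately show ?thesis by blast
  qed
  have zero: False if "polyfam ?J p 0" "eventually (\<lambda>y. poly (p y) (u y) = 1) U" for p and u :: "'y \<Rightarrow> 'k"
  proof -
    have "poly (p y) (u y) = coeff (p y) 0" for y
      using poly_polyfam[OF that(1)] by simp
    then show False using that one ideal_gen.cong[of "\<lambda>y. coeff (p y) 0" U M B "\<lambda>_. 1"]
      by (simp add: polyfam_def)
  qed
  show False
  proof (cases "m \<le> n")
    case True
    show False
    proof (cases "n = 0")
      case False
      then obtain p' where "polyfam ?J p' (n - 1)" "eventually (\<lambda>y. poly (p' y) (u y) = 1) U"
        using step[OF True _ less.prems] by auto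
      then show False using less.hyps[of "n - 1" m u p' q] less.prems False by auto
    qed (use zero less.prems in blast)
  next
    case False
    have "eventually (\<lambda>y. inverse (u y) \<noteq> 0) U" using less.prems(1) by simp
    then obtain q' where "polyfam ?J q' (m - 1)" "eventually (\<lambda>y. poly (q' y) (inverse (u y)) = 1) U"
      using step[of n m "\<lambda>y. inverse (u y)" q p] less.prems False by auto
    then show False using less.hyps[of n "m - 1" u p q'] less.prems False by auto
  qed
qed

text \<open>A ring that is maximal among those in which \<open>M\<close> generates a proper ideal is a valuation
  ring.\<close>

theorem valuation_algebra_exists:
  assumes U: "ultra U" and R: "function_algebra U R" and MR: "M \<subseteq> R"
    and one: "(\<lambda>_. 1) \<notin> ideal_gen U M R"
  obtains B where "R \<subseteq> B" "valuation_algebra U B" "M \<subseteq> valuation_algebra.maxid U B"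
proof -
  let ?F = "{B. R \<subseteq> B \<and> function_algebra U B \<and> (\<lambda>_. 1) \<notin> ideal_gen U M B}"
  have "\<exists>B\<in>?F. \<forall>X\<in>?F. B \<subseteq> X \<longrightarrow> X = B"
  proof (rule subset_Zorn_nonempty)
    show "?F \<noteq> {}" using R one by blast
    fix C assume ne: "C \<noteq> {}" and C: "subset.chain ?F C"
    have sub: "C \<subseteq> ?F" and lin: "\<And>X Y. X \<in> C \<Longrightarrow> Y \<in> C \<Longrightarrow> X \<subseteq> Y \<or> Y \<subseteq> X"
      using C by (auto simp: subset_chain_def)
    have two: "\<exists>Z\<in>C. f \<in> Z \<and> g \<in> Z" if "f \<in> \<Union>C" "g \<in> \<Union>C" for f g
      using that lin by blast
    have fa: "function_algebra U (\<Union>C)"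
    proof
      show "(\<lambda>_. c) \<in> \<Union>C" for c
        using ne sub function_algebra.const by blast
      show "(\<lambda>y. f y + g y) \<in> \<Union>C" "(\<lambda>y. f y * g y) \<in> \<Union>C" if "f \<in> \<Union>C" "g \<in> \<Union>C" for f g
        using two[OF that] sub function_algebra.add function_algebra.mult by blast+
      show "g \<in> \<Union>C" if "f \<in> \<Union>C" "eventually (\<lambda>y. f y = g y) U" for f g
        using that sub function_algebra.cong by blast
    qed
    have "\<exists>Z\<in>C. h \<in> ideal_gen U M Z" if "h \<in> ideal_gen U M (\<Union>C)" for h
      using that
    proof induction
      case (add f g)
      then obtain X Y where XY: "X \<in> C" "Y \<in> C" "f \<in> ideal_gen U M X" "g \<in> ideal_gen U M Y" by blast
      have mono: "h \<in> ideal_gen U M Y" if "h \<in> ideal_gen U M X" "X \<subseteq> Y" for h X Y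
        using that(1) by induction (use that(2) in \<open>auto intro: ideal_gen.intros\<close>)
      from lin[OF XY(1,2)] show ?case
      proof
        assume "X \<subseteq> Y"
        then show ?thesis using XY(2) ideal_gen.add[OF mono[OF XY(3)] XY(4)] by blast
      next
        assume "Y \<subseteq> X"
        then show ?thesis using XY(1) ideal_gen.add[OF XY(3) mono[OF XY(4)]] by blast
      qed
    qed (use ne in \<open>auto intro: ideal_gen.intros\<close>)
    then have "(\<lambda>_. 1) \<notin> ideal_gen U M (\<Union>C)" using sub by blast
    with fa show "\<Union>C \<in> ?F" using ne sub by auto
  qed
  then obtain B where "B \<in> ?F" and maximal: "\<forall>X\<in>?F. B \<subseteq> X \<longrightarrow> X = B" by (elim bexE)
  then have RB: "R \<subseteq> B" and B: "function_algebra U B" and one: "(\<lambda>_. 1) \<notin> ideal_gen U M B"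
    by simp_all
  have max: "X = B" if "R \<subseteq> X" "function_algebra U X" "(\<lambda>_. 1) \<notin> ideal_gen U M X" "B \<subseteq> X" for X
    using maximal that by simp
  interpret B: function_algebra U B by fact
  let ?J = "ideal_gen U M B"
  have MB: "M \<subseteq> B" using MR RB by blast
  \<comment> \<open>Adjoining \<open>u\<close> enlarges \<open>B\<close>, so by maximality
    \<open>M\<close> generates the unit ideal there.\<close>
  have rep: "\<exists>p n. polyfam ?J p n \<and> eventually (\<lambda>y. poly (p y) (u y) = 1) U" if "u \<notin> B" for u
  proof -
    have "adjoin U B u \<noteq> B" using that B.adjoin_self by metis
    then have "(\<lambda>_. 1) \<in> ideal_gen U M (adjoin U B u)"
      using max[of "adjoin U B u"] RB B.adjoin_superset B.function_algebra_adjoin by blast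
    then obtain p n where "polyfam ?J p n" and p: "eventually (\<lambda>y. 1 = poly (p y) (u y)) U"
      using B.ideal_gen_adjoin[of "\<lambda>_. 1" M u] by blast
    moreover from p have "eventually (\<lambda>y. poly (p y) (u y) = 1) U" by eventually_elim simp
    ultimately show ?thesis by blast
  qed
  \<comment> \<open>Otherwise 1 = p(1/e) over the ideal, and multiplication by e^n puts e^n into the
    ideal. But e^n is congruent to 1, so 1 would lie there too.\<close>
  have unit: "(\<lambda>y. inverse (e y)) \<in> B" if e: "e \<in> B" and e1: "(\<lambda>y. e y - 1) \<in> ?J" for e
  proof (rule ccontr)
    assume "(\<lambda>y. inverse (e y)) \<notin> B"
    then obtain p n where p: "polyfam ?J p n" "eventually (\<lambda>y. poly (p y) (inverse (e y)) = 1) U"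
      using rep by blast
    have "eventually (\<lambda>y. e y \<noteq> 0) U"
    proof (rule ccontr)
      assume "\<not> eventually (\<lambda>y. e y \<noteq> 0) U"
      then have "eventually (\<lambda>y. e y = 0) U" using U by (auto simp: ultra_def)
      then have "eventually (\<lambda>y. (e y - 1) * (- 1) = 1) U" by eventually_elim simp
      then show False
        using one ideal_gen.cong[OF ideal_gen_mult[OF e1 B.const[of "- 1"] B], of "\<lambda>_. 1"] by blast
    qed
    then have *: "eventually (\<lambda>y. (\<Sum>i\<le>n. coeff (p y) i * e y ^ (n - i)) = e y ^ n) U"
      using p(2)
    proof eventually_elim
      case (elim y)
      have "(\<Sum>i\<le>n. coeff (p y) i * e y ^ (n - i)) = e y ^ n * poly (p y) (inverse (e y))"
        using elim(1) unfolding poly_polyfam[OF p(1)] sum_distrib_left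
        by (intro sum.cong) (auto simp: power_diff field_simps)
      then show ?case using elim by simp
    qed
    have "(\<lambda>y. \<Sum>i\<le>n. coeff (p y) i * e y ^ (n - i)) \<in> ?J"
      using p(1) e by (intro ideal_gen_sum ideal_gen_mult[OF _ _ B] B.power) (auto simp: polyfam_def)
    from ideal_gen.cong[OF this *] have en: "(\<lambda>y. e y ^ n) \<in> ?J" .
    have en1: "(\<lambda>y. 1 - e y ^ k) \<in> ?J" for k
    proof (induction k)
      case (Suc k)
      have "(\<lambda>y. (1 - e y ^ k) * e y + (e y - 1) * (- 1)) \<in> ?J"
        using Suc e e1 by (intro ideal_gen.add ideal_gen_mult[OF _ _ B] B.const) auto
      then show ?case by (simp add: algebra_simps)
    qed (simp add: ideal_gen.zero)
    have "(\<lambda>y. (1 - e y ^ n) + e y ^ n) \<in> ?J" by (rule ideal_gen.add[OF en1 en])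
    then show False using one by simp
  qed
  have val: "u \<in> B \<or> (\<lambda>y. inverse (u y)) \<in> B" for u
  proof (rule ccontr)
    assume neg: "\<not> ?thesis"
    have u0: "eventually (\<lambda>y. u y \<noteq> 0) U"
    proof (rule ccontr)
      assume "\<not> eventually (\<lambda>y. u y \<noteq> 0) U"
      then have "eventually (\<lambda>y. u y = 0) U" using U by (auto simp: ultra_def)
      then have "eventually (\<lambda>y. 0 = u y) U" by eventually_elim simp
      then show False using B.cong[OF B.const[of 0], of u] neg by blast
    qed
    obtain p n q m where "polyfam ?J p n" "eventually (\<lambda>y. poly (p y) (u y) = 1) U"
      "polyfam ?J q m" "eventually (\<lambda>y. poly (q y) (inverse (u y)) = 1) U"
      using rep[of u] rep[of "\<lambda>y. inverse (u y)"] neg by blast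
    then show False using valuation_step[OF U B MB one _ u0] unit by blast
  qed
  interpret V: valuation_algebra U B by unfold_locales (use U val in auto)
  have "M \<subseteq> V.maxid"
  proof
    fix m assume m: "m \<in> M"
    have "\<not> eventually (\<lambda>y. m y * g y = 1) U" if "g \<in> B" for g
      using one ideal_gen.cong[OF ideal_gen.gen[OF m that], of "\<lambda>_. 1"] by blast
    then show "m \<in> V.maxid" using m MB by (auto simp: V.maxid_def)
  qed
  then show ?thesis using that RB V.valuation_algebra_axioms by blast
qed

section \<open>The maximal ideal and residues\<close>

context valuation_algebra
begin

lemma not_bot: "U \<noteq> bot"
  using ultra by (simp add: ultra_def)

lemma nonzero: "\<not> eventually (\<lambda>y. f y = g y) U \<Longrightarrow> eventually (\<lambda>y. f y \<noteq> g y) U"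
  using ultra by (auto simp: ultra_def)

lemma maxid_in: "f \<in> maxid \<Longrightarrow> f \<in> A"
  by (simp add: maxid_def)

lemma maxid_unit: "f \<in> maxid \<Longrightarrow> g \<in> A \<Longrightarrow> \<not> eventually (\<lambda>y. f y * g y = 1) U"
  by (simp add: maxid_def)

lemma maxidI: "f \<in> A \<Longrightarrow> (\<And>g. g \<in> A \<Longrightarrow> eventually (\<lambda>y. f y * g y = 1) U \<Longrightarrow> False) \<Longrightarrow> f \<in> maxid"
  by (auto simp: maxid_def)

lemma maxid_const: "(\<lambda>_. c) \<in> maxid \<Longrightarrow> c = 0"
  using maxid_unit[of "\<lambda>_. c" "\<lambda>_. inverse c"] const[of "inverse c"] by (cases "c = 0") auto

lemma maxid_zero: "(\<lambda>_. 0) \<in> maxid"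
  using not_bot by (intro maxidI const) (simp add: eventually_False)

lemma maxid_cong:
  assumes f: "f \<in> maxid" and fg: "eventually (\<lambda>y. f y = g y) U"
  shows "g \<in> maxid"
proof (rule maxidI)
  show "g \<in> A" using cong[OF maxid_in[OF f] fg] .
  fix h assume h: "h \<in> A" "eventually (\<lambda>y. g y * h y = 1) U"
  have "eventually (\<lambda>y. f y * h y = 1) U" using h(2) fg by eventually_elim simp
  then show False using maxid_unit[OF f h(1)] by blast
qed

lemma maxid_mult:
  assumes f: "f \<in> maxid" and g: "g \<in> A"
  shows "(\<lambda>y. f y * g y) \<in> maxid"
proof (rule maxidI)
  show "(\<lambda>y. f y * g y) \<in> A" using mult[OF maxid_in[OF f] g] .
  fix h assume h: "h \<in> A" "eventually (\<lambda>y. f y * g y * h y = 1) U"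
  then show False using maxid_unit[OF f mult[OF g h(1)]] by (simp add: mult.assoc)
qed

text \<open>One of f/g and g/f lies in the ring, so the sum is a multiple of \<open>g\<close> or of
  \<open>f\<close>. Functions that vanish almost everywhere are split off because of the
  quotients.\<close>

lemma maxid_add:
  assumes f: "f \<in> maxid" and g: "g \<in> maxid"
  shows "(\<lambda>y. f y + g y) \<in> maxid"
proof (cases "eventually (\<lambda>y. f y = 0) U \<or> eventually (\<lambda>y. g y = 0) U")
  case True
  then show ?thesis
  proof
    assume "eventually (\<lambda>y. f y = 0) U"
    then have "eventually (\<lambda>y. g y = f y + g y) U" by eventually_elim simp
    then show ?thesis by (rule maxid_cong[OF g])
  next
    assume "eventually (\<lambda>y. g y = 0) U"
    then have "eventually (\<lambda>y. f y = f y + g y) U" by eventually_elim simp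
    then show ?thesis by (rule maxid_cong[OF f])
  qed
next
  case False
  then have nz: "eventually (\<lambda>y. f y \<noteq> 0) U" "eventually (\<lambda>y. g y \<noteq> 0) U"
    by (auto intro: nonzero)
  from val[of "\<lambda>y. f y * inverse (g y)"] show ?thesis
  proof
    assume "(\<lambda>y. f y * inverse (g y)) \<in> A"
    then have "(\<lambda>y. g y * (f y * inverse (g y) + 1)) \<in> maxid"
      by (intro maxid_mult[OF g] add const)
    moreover have "eventually (\<lambda>y. g y * (f y * inverse (g y) + 1) = f y + g y) U"
      using nz(2) by eventually_elim (simp add: field_simps)
    ultimately show ?thesis by (rule maxid_cong)
  next
    assume "(\<lambda>y. inverse (f y * inverse (g y))) \<in> A"
    then have "(\<lambda>y. f y * (inverse (f y * inverse (g y)) + 1)) \<in> maxid"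
      by (intro maxid_mult[OF f] add const)
    moreover have "eventually (\<lambda>y. f y * (inverse (f y * inverse (g y)) + 1) = f y + g y) U"
      using nz(1) by eventually_elim (simp add: field_simps)
    ultimately show ?thesis by (rule maxid_cong)
  qed
qed

lemma maxid_uminus: "f \<in> maxid \<Longrightarrow> (\<lambda>y. - f y) \<in> maxid"
  using maxid_mult[OF _ const[of "- 1"], of f] by simp

lemma maxid_diff: "f \<in> maxid \<Longrightarrow> g \<in> maxid \<Longrightarrow> (\<lambda>y. f y - g y) \<in> maxid"
  using maxid_add[OF _ maxid_uminus, of f g] by simp

lemma maxid_sum:
  "finite I \<Longrightarrow> (\<And>i. i \<in> I \<Longrightarrow> f i \<in> maxid) \<Longrightarrow> (\<lambda>y. \<Sum>i\<in>I. f i y) \<in> maxid"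
  by (induction I rule: finite_induct) (auto intro: maxid_zero maxid_add)

lemma maxid_prime:
  assumes f: "f \<in> A" and g: "g \<in> A" and fg: "(\<lambda>y. f y * g y) \<in> maxid"
  shows "f \<in> maxid \<or> g \<in> maxid"
proof (rule ccontr)
  assume "\<not> ?thesis"
  then obtain f' g' where f': "f' \<in> A" "eventually (\<lambda>y. f y * f' y = 1) U"
    and g': "g' \<in> A" "eventually (\<lambda>y. g y * g' y = 1) U"
    using f g by (auto simp: maxid_def)
  have "eventually (\<lambda>y. f y * g y * (f' y * g' y) = 1) U"
    using f'(2) g'(2)
  proof eventually_elim
    case (elim y)
    have "f y * g y * (f' y * g' y) = (f y * f' y) * (g y * g' y)" by (simp add: mult_ac)
    then show ?case using elim by simp
  qed
  then show False using maxid_unit[OF fg mult[OF f'(1) g'(1)]] by blast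
qed

lemma inverse_in_maxid:
  assumes "f \<notin> A"
  shows "(\<lambda>y. inverse (f y)) \<in> maxid"
proof (rule maxidI)
  show "(\<lambda>y. inverse (f y)) \<in> A" using val assms by blast
  fix g assume g: "g \<in> A" "eventually (\<lambda>y. inverse (f y) * g y = 1) U"
  have "eventually (\<lambda>y. g y = f y) U"
    using g(2)
  proof eventually_elim
    case (elim y)
    then show ?case by (cases "f y = 0") (auto simp: field_simps)
  qed
  then show False using cong[OF g(1)] assms by blast
qed

lemma eventually_nonzero_notin:
  assumes "f \<notin> A"
  shows "eventually (\<lambda>y. f y \<noteq> 0) U"
proof (rule nonzero, rule notI)
  assume "eventually (\<lambda>y. f y = 0) U"
  then have "eventually (\<lambda>y. 0 = f y) U" by eventually_elim simp
  then show False using cong[OF const[of 0], of f] assms by blast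
qed

text \<open>If \<open>f\<close> were outside, 1/f would lie in the maximal ideal. Dividing the
  equation by f^n writes -1 as a combination of positive powers of 1/f, so 1 would lie in the
  maximal ideal.\<close>

lemma integrally_closed:
  assumes p: "\<And>i. (\<lambda>y. coeff (p y) i) \<in> A" and n: "\<And>y. degree (p y) = n" "\<And>y. lead_coeff (p y) = 1"
    and root: "eventually (\<lambda>y. poly (p y) (f y) = 0) U"
  shows "f \<in> A"
proof (rule ccontr)
  assume f: "f \<notin> A"
  have "(\<lambda>y. - (\<Sum>i<n. inverse (f y) * (inverse (f y) ^ (n - i - 1) * coeff (p y) i))) \<in> maxid"
    using inverse_in_maxid[OF f] p
    by (intro maxid_uminus maxid_sum maxid_mult mult power maxid_in[OF inverse_in_maxid[OF f]]) auto
  moreover have "eventually (\<lambda>y. - (\<Sum>i<n. inverse (f y) * (inverse (f y) ^ (n - i - 1) * coeff (p y) i)) = 1) U"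
    using root eventually_nonzero_notin[OF f]
  proof eventually_elim
    case (elim y)
    have "0 = (\<Sum>i\<le>n. coeff (p y) i * f y ^ i)"
      using elim(1) n by (simp add: poly_altdef)
    also have "\<dots> = (\<Sum>i<n. coeff (p y) i * f y ^ i) + f y ^ n"
      using n[of y] by (simp flip: lessThan_Suc_atMost)
    finally have "(\<Sum>i<n. coeff (p y) i * f y ^ i) = - (f y ^ n)" by (simp add: eq_neg_iff_add_eq_0)
    then have "(\<Sum>i<n. coeff (p y) i * f y ^ i) * inverse (f y ^ n) = - 1"
      using elim(2) by simp
    moreover have "(\<Sum>i<n. coeff (p y) i * f y ^ i) * inverse (f y ^ n)
        = (\<Sum>i<n. inverse (f y) * (inverse (f y) ^ (n - i - 1) * coeff (p y) i))"
      unfolding sum_distrib_right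
    proof (intro sum.cong refl)
      fix i assume "i \<in> {..<n}"
      then obtain k where k: "n = Suc (i + k)" using less_imp_Suc_add by auto
      show "coeff (p y) i * f y ^ i * inverse (f y ^ n)
          = inverse (f y) * (inverse (f y) ^ (n - i - 1) * coeff (p y) i)"
        using elim(2) by (simp add: k power_add field_simps)
    qed
    ultimately show ?case by simp
  qed
  ultimately have "(\<lambda>_. 1) \<in> maxid" by (rule maxid_cong)
  then show False using maxid_const by fastforce
qed

text \<open>Reduction modulo the maximal ideal is a homomorphism. The residue field may exceed the
  ground field, so it is assumed that the generators have constant residues, namely their values at
  \<open>\<alpha>\<close>.\<close>

lemma residue_polys:
  assumes f: "f \<in> polys S"
    and S: "\<And>h. h \<in> S \<Longrightarrow> (\<lambda>y. h (\<gamma> y)) \<in> A"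
    and res: "\<And>h. h \<in> S \<Longrightarrow> (\<lambda>y. h (\<gamma> y) - h \<alpha>) \<in> maxid"
  shows "(\<lambda>y. f (\<gamma> y) - f \<alpha>) \<in> maxid"
  using f
proof induction
  case (add f g)
  have "(\<lambda>y. (f (\<gamma> y) - f \<alpha>) + (g (\<gamma> y) - g \<alpha>)) \<in> maxid"
    by (rule maxid_add[OF add.IH])
  then show ?case by (simp add: algebra_simps)
next
  case (mult f g)
  have "(\<lambda>y. (f (\<gamma> y) - f \<alpha>) * g (\<gamma> y) + (g (\<gamma> y) - g \<alpha>) * f \<alpha>) \<in> maxid"
    by (intro maxid_add maxid_mult mult.IH const pullback[OF mult.hyps(2) S])
  then show ?case by (simp add: algebra_simps)
qed (use res maxid_zero in auto)

end

text \<open>Over the algebraically closed ground field \<open>p\<close> splits into linear factors,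
  and the maximal ideal is prime. So a residue that is algebraic over the ground field is a
  constant.\<close>

lemma residue_root:
  fixes A :: "('y \<Rightarrow> 'k::alg_closed_field) set"
  assumes "valuation_algebra U A" and f: "f \<in> A"
    and p: "p \<noteq> 0" "(\<lambda>y. poly p (f y)) \<in> valuation_algebra.maxid U A"
  shows "\<exists>\<alpha>. poly p \<alpha> = 0 \<and> (\<lambda>y. f y - \<alpha>) \<in> valuation_algebra.maxid U A"
  using p
proof (induction "degree p" arbitrary: p rule: less_induct)
  case (less p)
  interpret valuation_algebra U A by fact
  have "degree p > 0"
  proof (rule ccontr)
    assume "\<not> degree p > 0"
    then obtain c where "p = [:c:]" using degree_eq_zeroE by auto
    then show False using less.prems maxid_const[of c] by simp
  qed
  then obtain \<alpha> where \<alpha>: "poly p \<alpha> = 0" using alg_closed_imp_poly_has_root by blast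
  then obtain q where q: "p = [:- \<alpha>, 1:] * q" by (metis dvdE poly_eq_0_iff_dvd)
  have "q \<noteq> 0" using less.prems(1) q by auto
  then have dq: "degree q < degree p" unfolding q by (subst degree_mult_eq) auto
  have "(\<lambda>y. (f y - \<alpha>) * poly q (f y)) \<in> maxid"
    using less.prems(2) by (simp add: q algebra_simps)
  then have "(\<lambda>y. f y - \<alpha>) \<in> maxid \<or> (\<lambda>y. poly q (f y)) \<in> maxid"
    using f by (intro maxid_prime diff const poly)
  then show ?case
  proof
    assume "(\<lambda>y. poly q (f y)) \<in> maxid"
    from less.hyps[OF dq \<open>q \<noteq> 0\<close> this] show ?thesis by (auto simp: q)
  qed (use \<alpha> in blast)
qed

section \<open>Integral functions\<close>

definition monic_over :: "('y \<Rightarrow> 'k::field) set \<Rightarrow> nat \<Rightarrow> ('y \<Rightarrow> 'k poly) \<Rightarrow> bool" where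
  "monic_over R n p \<longleftrightarrow>
     (\<forall>i. (\<lambda>y. coeff (p y) i) \<in> R) \<and> (\<forall>y. degree (p y) = n \<and> lead_coeff (p y) = 1)"

text \<open>No quotient by the functions vanishing on \<open>Y\<close> is formed: the polynomials
  are monic everywhere, and only the equation is restricted to \<open>Y\<close>.\<close>

definition integral_over :: "'y set \<Rightarrow> ('y \<Rightarrow> 'k) set \<Rightarrow> ('y \<Rightarrow> 'k::field) \<Rightarrow> bool" where
  "integral_over Y R f \<longleftrightarrow> (\<exists>p n. monic_over R n p \<and> (\<forall>y\<in>Y. poly (p y) (f y) = 0))"

lemma monic_overD:
  assumes "monic_over R n p"
  shows "(\<lambda>y. coeff (p y) i) \<in> R" "degree (p y) = n" "coeff (p y) n = 1"
    "p y \<noteq> 0"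
  using assms unfolding monic_over_def by (auto dest: spec[of _ y])

lemma monic_over_mult:
  assumes "function_algebra U R" "monic_over R n p" "monic_over R m q"
  shows "monic_over R (n + m) (\<lambda>y. p y * q y)"
proof -
  have "polyfam R (\<lambda>y. p y * q y) (n + m)"
    using assms by (intro function_algebra.polyfam_mult) (auto simp: polyfam_def monic_over_def)
  moreover have "degree (p y * q y) = n + m" "lead_coeff (p y * q y) = 1" for y
  proof -
    have "p y \<noteq> 0" "q y \<noteq> 0" using assms(2,3) by (auto simp: monic_over_def dest: spec[of _ y])
    then show "degree (p y * q y) = n + m" using assms(2,3) by (simp add: degree_mult_eq monic_over_def)
    have "lead_coeff (p y) = 1" "lead_coeff (q y) = 1" using assms(2,3) by (auto simp: monic_over_def)
    then show "lead_coeff (p y * q y) = 1" by (simp only: lead_coeff_mult mult_1)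
  qed
  ultimately show ?thesis by (simp add: monic_over_def polyfam_def)
qed

text \<open>If \<open>f\<close> is not integral over \<open>R\<close>, then \<open>1 / f\<close> is not a unit of \<open>R[1 / f]\<close>, so it lies in the
  maximal ideal of some valuation ring containing \<open>R\<close>. The ultrafilter makes all the \<open>P(f)\<close> with
  \<open>P\<close> monic over \<open>R\<close> invertible.\<close>

theorem integral_overI_valuation:
  fixes R :: "('y \<Rightarrow> 'k::field) set"
  assumes R: "function_algebra top R"
    and val: "\<And>U B. valuation_algebra U B \<Longrightarrow> eventually (\<lambda>y. y \<in> Y) U \<Longrightarrow> R \<subseteq> B \<Longrightarrow> f \<in> B"
  shows "integral_over Y R f"
proof (rule ccontr)
  assume not_int: "\<not> integral_over Y R f"
  interpret R: function_algebra top R by fact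
  let ?P = "{\<lambda>y. y \<in> Y \<and> poly (p y) (f y) \<noteq> 0 | p n. monic_over R n p}"
  have one: "monic_over R 0 (\<lambda>_. 1)"
    using R.const by (auto simp: monic_over_def)
  have X: "monic_over R 1 (\<lambda>_. [:0, 1:])"
    using R.const by (auto simp: monic_over_def)
  obtain U where U: "ultra U" and UP: "\<And>P. P \<in> ?P \<Longrightarrow> eventually P U"
  proof (rule ultra_multiplicative[of ?P])
    show "?P \<noteq> {}" using one by blast
    show "\<exists>y. P y" if "P \<in> ?P" for P
      using that not_int by (auto simp: integral_over_def)
    show "\<exists>R\<in>?P. \<forall>y. R y \<longrightarrow> P y \<and> Q y" if PQ: "P \<in> ?P" "Q \<in> ?P" for P Q
    proof -
      obtain p n q m where p: "monic_over R n p" "P = (\<lambda>y. y \<in> Y \<and> poly (p y) (f y) \<noteq> 0)"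
        and q: "monic_over R m q" "Q = (\<lambda>y. y \<in> Y \<and> poly (q y) (f y) \<noteq> 0)"
        using PQ by blast
      let ?T = "\<lambda>y. y \<in> Y \<and> poly (p y * q y) (f y) \<noteq> 0"
      show ?thesis
      proof (rule bexI[of _ ?T])
        show "\<forall>y. ?T y \<longrightarrow> P y \<and> Q y" unfolding p q by auto
        show "?T \<in> ?P"
          by (rule CollectI, intro exI conjI, rule refl, rule monic_over_mult[OF R p(1) q(1)])
      qed
    qed
  qed (rule that)
  have ev: "eventually (\<lambda>y. y \<in> Y \<and> poly (p y) (f y) \<noteq> 0) U" if "monic_over R n p" for n p
    by (rule UP, rule CollectI, intro exI conjI, rule refl, rule that)
  have f0: "eventually (\<lambda>y. f y \<noteq> 0) U"
    using ev[OF X] by eventually_elim simp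
  let ?w = "\<lambda>y. inverse (f y)"
  let ?B = "adjoin U R ?w"
  have B: "function_algebra U ?B" by (rule R.function_algebra_adjoin)
  have w: "{?w} \<subseteq> ?B" using R.adjoin_self[of ?w U] by simp
  have single: "\<exists>b\<in>?B. eventually (\<lambda>y. h y = ?w y * b y) U" if "h \<in> ideal_gen U {?w} ?B" for h
    using that
  proof induction
    case zero
    show ?case by (rule bexI[OF _ function_algebra.const[OF B, of 0]]) simp
  next
    case (add h k)
    then obtain b c where b: "b \<in> ?B" "eventually (\<lambda>y. h y = ?w y * b y) U"
      and c: "c \<in> ?B" "eventually (\<lambda>y. k y = ?w y * c y) U" by blast
    have "eventually (\<lambda>y. h y + k y = ?w y * (b y + c y)) U"
      using b(2) c(2) by eventually_elim (simp add: algebra_simps)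
    then show ?case using function_algebra.add[OF B b(1) c(1)] by (rule bexI)
  next
    case (cong h k)
    then obtain b where b: "b \<in> ?B" "eventually (\<lambda>y. h y = ?w y * b y) U" by blast
    have "eventually (\<lambda>y. k y = ?w y * b y) U" using b(2) cong.hyps(2) by eventually_elim simp
    then show ?case using b(1) by (rule bexI)
  next
    case (gen m b)
    then show ?case by (intro bexI[of _ b]) simp_all
  qed
  have "(\<lambda>_. 1) \<notin> ideal_gen U {?w} ?B"
  proof
    assume "(\<lambda>_. 1) \<in> ideal_gen U {?w} ?B"
    then obtain b where b: "b \<in> ?B" "eventually (\<lambda>y. 1 = ?w y * b y) U"
      using single[of "\<lambda>_. 1"] by blast
    then obtain q n where q: "polyfam R q n" "eventually (\<lambda>y. b y = poly (q y) (?w y)) U"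
      unfolding adjoin_def by blast
    \<comment> \<open>Multiplying 1 = (1/f) q(1/f) by f^(n+1) gives a monic equation for
      \<open>f\<close>; \<open>p\<close> is its polynomial.\<close>
    define p where "p = (\<lambda>y. monom 1 (n + 1) - (\<Sum>i\<le>n. monom (coeff (q y) i) (n - i)))"
    have co: "coeff (p y) j = (if n + 1 = j then 1 else 0)
        - (\<Sum>i\<le>n. if n - i = j then coeff (q y) i else 0)" for y j
      by (simp add: p_def coeff_sum)
    have cR: "(\<lambda>y. coeff (p y) j) \<in> R" for j
    proof -
      have "(\<lambda>y. if n - i = j then coeff (q y) i else 0) \<in> R" for i
        using q(1) R.const[of 0] by (cases "n - i = j") (simp_all add: polyfam_def)
      then show ?thesis unfolding co by (intro R.diff R.sum R.const) simp_all
    qed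
    have deg: "degree (p y) \<le> n + 1" for y
      by (rule degree_le) (auto simp: co intro!: sum.neutral)
    have lead: "coeff (p y) (n + 1) = 1" for y
      unfolding co by (auto intro!: sum.neutral)
    have "degree (p y) = n + 1" for y
      using deg[of y] le_degree[of "p y" "n + 1"] lead[of y] by simp
    then have "monic_over R (n + 1) p" using cR lead by (simp add: monic_over_def)
    from ev[OF this] have "eventually (\<lambda>_. False) U"
      using b(2) q(2) f0
    proof eventually_elim
      case (elim y)
      have "f y ^ (n + 1) = f y ^ n * b y" using elim by (simp add: field_simps)
      also have "\<dots> = (\<Sum>i\<le>n. coeff (q y) i * f y ^ (n - i))"
        unfolding elim(3) poly_polyfam[OF q(1)] sum_distrib_left
        using elim(4) by (intro sum.cong) (auto simp: power_diff field_simps)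
      finally have "poly (p y) (f y) = 0"
        by (simp add: p_def poly_sum poly_monom)
      then show False using elim(1) by simp
    qed
    then show False using U by (simp add: ultra_def eventually_False)
  qed
  from valuation_algebra_exists[OF U B w this]
  obtain C where C: "?B \<subseteq> C" "valuation_algebra U C" "{?w} \<subseteq> valuation_algebra.maxid U C" .
  interpret C: valuation_algebra U C by fact
  have "f \<in> C"
    using C(1) R.adjoin_superset[of U ?w] ev[OF one] by (intro val[OF C(2)]) (auto elim: eventually_mono)
  moreover have "eventually (\<lambda>y. ?w y * f y = 1) U" using f0 by eventually_elim simp
  ultimately show False using C.maxid_unit C(3) by blast
qed

section \<open>Krull dimension under closed maps\<close>

lemma irreducible_closed_iff:
  assumes "closedin T A"
  shows "irreducible_space (subtopology T A) \<longleftrightarrow>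
    A \<noteq> {} \<and> (\<forall>B C. closedin T B \<and> closedin T C \<and> A \<subseteq> B \<union> C \<longrightarrow> A \<subseteq> B \<or> A \<subseteq> C)"
proof -
  have top: "topspace (subtopology T A) = A"
    using closedin_subset[OF assms] by auto
  have cl: "closedin (subtopology T A) B \<longleftrightarrow> closedin T B \<and> B \<subseteq> A" for B
    using closedin_closed_subtopology[OF assms] .
  show ?thesis
    unfolding irreducible_space_def top cl
  proof safe
    fix B C x y
    assume *: "\<forall>B C. (closedin T B \<and> B \<subseteq> A) \<and> (closedin T C \<and> C \<subseteq> A) \<and> A = B \<union> C \<longrightarrow> B = A \<or> C = A"
      and B: "closedin T B" and C: "closedin T C" and sub: "A \<subseteq> B \<union> C"
      and x: "x \<in> A" "x \<notin> C" and y: "y \<in> A"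
    have "A = (A \<inter> B) \<union> (A \<inter> C)" using sub by blast
    with *[rule_format, of "A \<inter> B" "A \<inter> C"] have "A \<inter> B = A \<or> A \<inter> C = A"
      using assms B C by (auto intro: closedin_Int)
    then show "y \<in> B" using x y by blast
  qed blast+
qed

lemma irreducible_image:
  assumes f: "continuous_map T1 T2 f" and A: "closedin T1 A" "irreducible_space (subtopology T1 A)"
    and fA: "closedin T2 (f ` A)"
  shows "irreducible_space (subtopology T2 (f ` A))"
  unfolding irreducible_closed_iff[OF fA]
proof (intro conjI allI impI)
  show "f ` A \<noteq> {}" using A by (simp add: irreducible_closed_iff)
  fix B C assume BC: "closedin T2 B \<and> closedin T2 C \<and> f ` A \<subseteq> B \<union> C"
  let ?B = "{x \<in> topspace T1. f x \<in> B}" and ?C = "{x \<in> topspace T1. f x \<in> C}"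
  have "A \<subseteq> ?B \<union> ?C" using BC closedin_subset[OF A(1)] by blast
  moreover have "closedin T1 ?B" "closedin T1 ?C"
    using BC f by (auto intro: closedin_continuous_map_preimage)
  ultimately have "A \<subseteq> ?B \<or> A \<subseteq> ?C"
    using A by (simp add: irreducible_closed_iff)
  then show "f ` A \<subseteq> B \<or> f ` A \<subseteq> C" by blast
qed

text \<open>\<open>D\<close> is a minimal closed subset of \<open>C\<close> lying over
  \<open>W\<close> whose image covers \<open>W\<close>. If it were covered by two closed pieces,
  their images would be closed and cover the irreducible \<open>W\<close>, so one piece would
  already do. Finite fibres make Zorn's lemma applicable.\<close>

lemma lift_irreducible:
  assumes f: "continuous_map T1 T2 f" and cl: "\<And>C. closedin T1 C \<Longrightarrow> closedin T2 (f ` C)"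
    and fin: "\<And>w. w \<in> topspace T2 \<Longrightarrow> finite {y \<in> topspace T1. f y = w}"
    and W: "closedin T2 W" "irreducible_space (subtopology T2 W)"
    and C: "closedin T1 C" "W \<subseteq> f ` C"
  obtains D where "closedin T1 D" "irreducible_space (subtopology T1 D)" "D \<subseteq> C" "f ` D = W"
proof -
  let ?P = "{x \<in> topspace T1. f x \<in> W}"
  have P: "closedin T1 ?P" using f W(1) by (rule closedin_continuous_map_preimage)
  let ?A = "{D. closedin T1 D \<and> D \<subseteq> C \<inter> ?P \<and> W \<subseteq> f ` D}"
  have CA: "C \<inter> ?P \<in> ?A"
    using C P closedin_subset[OF C(1)] by (auto intro: closedin_Int)
  have "\<exists>D\<in>?A. \<forall>E\<in>?A. E \<subseteq> D \<longrightarrow> E = D"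
  proof (rule predicate_Zorn)
    show "partial_order_on ?A (relation_of (\<lambda>D E. E \<subseteq> D) ?A)"
      by (rule partial_order_on_relation_ofI) auto
    fix K assume K: "K \<in> Chains (relation_of (\<lambda>D E. E \<subseteq> D) ?A)"
    have sub: "K \<subseteq> ?A"
    proof
      fix D assume "D \<in> K"
      with K have "(D, D) \<in> relation_of (\<lambda>D E. E \<subseteq> D) ?A" unfolding Chains_def by blast
      then show "D \<in> ?A" unfolding relation_of_def by blast
    qed
    have lin: "D \<subseteq> E \<or> E \<subseteq> D" if "D \<in> K" "E \<in> K" for D E
      using K that unfolding Chains_def relation_of_def by blast
    show "\<exists>u\<in>?A. \<forall>a\<in>K. u \<subseteq> a"
    proof (cases "K = {}")
      case False
      have "W \<subseteq> f ` \<Inter>K"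
      proof
        fix w assume w: "w \<in> W"
        let ?F = "{y \<in> topspace T1. f y = w}"
        have F: "finite ?F" using fin w closedin_subset[OF W(1)] by blast
        \<comment> \<open>On the finite fibre over \<open>w\<close>, the trace of the chain becomes
          stationary: a member with the smallest trace has its trace contained in all the
          others.\<close>
        obtain k where "k \<in> K" using False by blast
        then obtain E where E: "E \<in> K" "\<And>E'. E' \<in> K \<Longrightarrow> card (?F \<inter> E) \<le> card (?F \<inter> E')"
          using ex_has_least_nat[of "\<lambda>E. E \<in> K" k "\<lambda>E. card (?F \<inter> E)"] by blast
        have Esub: "?F \<inter> E \<subseteq> E'" if E': "E' \<in> K" for E'
        proof (cases "E \<subseteq> E'")
          case False
          then have "?F \<inter> E' \<subseteq> ?F \<inter> E" using lin[OF E(1) E'] by blast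
          then have "?F \<inter> E' = ?F \<inter> E" using E(2)[OF E'] F by (intro card_seteq) auto
          then show ?thesis by blast
        qed blast
        obtain y where y: "y \<in> E" "w = f y" using E(1) sub w by blast
        have "y \<in> ?F" using y E(1) sub by blast
        then show "w \<in> f ` \<Inter>K" using Esub y by blast
      qed
      moreover have "closedin T1 (\<Inter>K)" using False sub by (intro closedin_Inter) auto
      moreover have "\<Inter>K \<subseteq> C \<inter> ?P" using False sub by blast
      ultimately show ?thesis by (intro bexI[of _ "\<Inter>K"]) auto
    qed (use CA in blast)
  qed
  then obtain D where "D \<in> ?A" and min: "\<forall>E\<in>?A. E \<subseteq> D \<longrightarrow> E = D" by (elim bexE)
  then have D: "closedin T1 D" "D \<subseteq> C" "D \<subseteq> ?P" "W \<subseteq> f ` D" by auto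
  have minD: "E = D" if "closedin T1 E" "E \<subseteq> D" "W \<subseteq> f ` E" for E
    using min that D by blast
  have "irreducible_space (subtopology T1 D)"
    unfolding irreducible_closed_iff[OF D(1)]
  proof (intro conjI allI impI)
    show "D \<noteq> {}" using W D(4) by (auto simp: irreducible_closed_iff)
    fix A B assume AB: "closedin T1 A \<and> closedin T1 B \<and> D \<subseteq> A \<union> B"
    then have c: "closedin T1 (D \<inter> A)" "closedin T1 (D \<inter> B)" using D(1) by (auto intro: closedin_Int)
    have "W \<subseteq> f ` (D \<inter> A) \<union> f ` (D \<inter> B)" using D(4) AB by blast
    then have "W \<subseteq> f ` (D \<inter> A) \<or> W \<subseteq> f ` (D \<inter> B)"
      using W cl[OF c(1)] cl[OF c(2)] by (simp add: irreducible_closed_iff)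
    then have "D \<inter> A = D \<or> D \<inter> B = D" using minD c by blast
    then show "D \<subseteq> A \<or> D \<subseteq> B" by blast
  qed
  moreover have "f ` D = W" using D by blast
  ultimately show ?thesis using that D by blast
qed

text \<open>Chains are pushed forward, where \<open>inc\<close> keeps the inclusions strict, and
  lifted back from the top down, each member inside the lift of the one above it.\<close>

theorem krull_dim_eq_closed_map:
  assumes f: "continuous_map T1 T2 f" and cl: "\<And>C. closedin T1 C \<Longrightarrow> closedin T2 (f ` C)"
    and surj: "f ` topspace T1 = topspace T2"
    and fin: "\<And>w. w \<in> topspace T2 \<Longrightarrow> finite {y \<in> topspace T1. f y = w}"
    and inc: "\<And>A B. closedin T1 A \<Longrightarrow> closedin T1 B \<Longrightarrow> irreducible_space (subtopology T1 B) \<Longrightarrow>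
      A \<subset> B \<Longrightarrow> f ` A \<noteq> f ` B"
  shows "krull_dim T1 = krull_dim T2"
proof -
  let ?ch = "\<lambda>T n Z. (\<forall>i\<le>n. closedin T (Z i) \<and> irreducible_space (subtopology T (Z i))) \<and>
     (\<forall>i<n. Z i \<subset> Z (Suc i))"
  have 1: "\<exists>W. ?ch T2 n W" if Z: "?ch T1 n Z" for n Z
  proof (rule exI[of _ "\<lambda>i. f ` Z i"], intro conjI allI impI)
    show "closedin T2 (f ` Z i)" if "i \<le> n" for i using cl Z that by blast
    then show "irreducible_space (subtopology T2 (f ` Z i))" if "i \<le> n" for i
      using irreducible_image[OF f] Z that by blast
    show "f ` Z i \<subset> f ` Z (Suc i)" if "i < n" for i
    proof -
      have "closedin T1 (Z i)" "closedin T1 (Z (Suc i))" "irreducible_space (subtopology T1 (Z (Suc i)))"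
        "Z i \<subset> Z (Suc i)" using Z that by auto
      then show ?thesis using inc[of "Z i" "Z (Suc i)"] by blast
    qed
  qed
  \<comment> \<open>The closed set \<open>C\<close> varies in the induction, since the rest of the
    chain has to be lifted inside the set just found for its top member.\<close>
  have 2: "\<exists>Z. ?ch T1 n Z \<and> Z n \<subseteq> C \<and> (\<forall>i\<le>n. f ` Z i = W i)"
    if "?ch T2 n W" "closedin T1 C" "W n \<subseteq> f ` C" for n C W
    using that
  proof (induction n arbitrary: C)
    case 0
    then have W: "closedin T2 (W 0)" "irreducible_space (subtopology T2 (W 0))" by auto
    obtain D where "closedin T1 D" "irreducible_space (subtopology T1 D)" "D \<subseteq> C" "f ` D = W 0"
      using lift_irreducible[OF f cl fin W 0(2,3)] by blast
    then show ?case by (intro exI[of _ "\<lambda>_. D"]) simp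
  next
    case (Suc n)
    then have W: "closedin T2 (W (Suc n))" "irreducible_space (subtopology T2 (W (Suc n)))" by auto
    obtain D where D: "closedin T1 D" "irreducible_space (subtopology T1 D)" "D \<subseteq> C" "f ` D = W (Suc n)"
      using lift_irreducible[OF f cl fin W Suc.prems(2,3)] by blast
    have sub: "W n \<subset> W (Suc n)" using Suc.prems by blast
    have "\<exists>Z. ?ch T1 n Z \<and> Z n \<subseteq> D \<and> (\<forall>i\<le>n. f ` Z i = W i)"
      by (rule Suc.IH) (use Suc.prems D sub in auto)
    then obtain Z where Z: "?ch T1 n Z" "Z n \<subseteq> D" "\<And>i. i \<le> n \<Longrightarrow> f ` Z i = W i" by blast
    let ?Z = "Z(Suc n := D)"
    have "?Z i \<subset> ?Z (Suc i)" if "i < Suc n" for i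
    proof (cases "i = n")
      case True
      have "Z n \<noteq> D" using D(4) Z(3)[of n] sub by auto
      then show ?thesis using True Z(2) by auto
    next
      case False
      then show ?thesis using Z(1) that by auto
    qed
    moreover have "closedin T1 (?Z i) \<and> irreducible_space (subtopology T1 (?Z i))" if "i \<le> Suc n" for i
      using Z(1) D that by (cases "i = Suc n") auto
    moreover have "f ` ?Z i = W i" if "i \<le> Suc n" for i
      using Z(3) D that by (cases "i = Suc n") auto
    ultimately show ?case using D(3) by (intro exI[of _ ?Z]) auto
  qed
  have "(\<exists>Z. ?ch T1 n Z) \<longleftrightarrow> (\<exists>W. ?ch T2 n W)" for n
  proof
    assume "\<exists>W. ?ch T2 n W"
    then obtain W where W: "?ch T2 n W" by (elim exE)
    have "W n \<subseteq> f ` topspace T1" unfolding surj using W closedin_subset by blast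
    from 2[OF W closedin_topspace this] show "\<exists>Z. ?ch T1 n Z" by blast
  qed (use 1 in blast)
  then show ?thesis unfolding krull_dim_def by presburger
qed

section \<open>Integral projections\<close>

lemma subtopology_zariski:
  assumes "C \<subseteq> P"
  shows "subtopology (zariski S P) C = zariski S C"
proof -
  have "(P - zero_locus F P) \<inter> C = C - zero_locus F C" for F
    using assms by (auto simp: zero_locus_def)
  then show ?thesis
    unfolding topology_eq openin_subtopology openin_zariski by metis
qed

lemma polys_mono: "f \<in> polys S \<Longrightarrow> S \<subseteq> S' \<Longrightarrow> f \<in> polys S'"
  by (induction rule: polys.induct) (auto intro: polys.intros)

lemma polys_restrict:
  "f \<in> polys (affine_coord W) \<Longrightarrow> f (restrict y W) = f y"
  by (induction rule: polys.induct) auto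

lemma polys_cong:
  assumes "f \<in> polys (affine_coord W)" "restrict y W = restrict z W"
  shows "f y = f z"
  using polys_restrict[OF assms(1)] assms(2) by metis

text \<open>Take a point \<open>w\<close> at which every function of the
  \<open>W\<close>-coordinates that vanishes on \<open>C\<close> is zero. There is a valuation ring,
  for an ultrafilter on \<open>C\<close>, in whose maximal ideal the functions vanishing at
  \<open>w\<close> lie. The coordinates are integral, so they belong to it and have constant
  residues; these form a point of \<open>C\<close> above \<open>w\<close>.\<close>

lemma closed_projection:
  fixes C :: "('v \<Rightarrow> 'k::alg_closed_field) set"
  assumes WV: "W \<subseteq> V"
    and C: "closedin (zariski (affine_coord V) (V \<rightarrow>\<^sub>E UNIV)) C"
    and int: "\<And>v. v \<in> V \<Longrightarrow> integral_over C (polys (affine_coord W)) (\<lambda>y. y v)"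
  shows "closedin (zariski (affine_coord W) (W \<rightarrow>\<^sub>E UNIV)) ((\<lambda>y. restrict y W) ` C)"
proof -
  let ?R = "polys (affine_coord W) :: (('v \<Rightarrow> 'k) \<Rightarrow> 'k) set"
  let ?F = "{f \<in> ?R. \<forall>y\<in>C. f y = 0}"
  have "w \<in> (\<lambda>y. restrict y W) ` C" if w: "w \<in> zero_locus ?F (W \<rightarrow>\<^sub>E UNIV)" for w
  proof -
    have wF: "f w = 0" if "f \<in> ?R" "\<And>y. y \<in> C \<Longrightarrow> f y = 0" for f
      using w that by (simp add: zero_locus_def)
    let ?P = "{\<lambda>y. y \<in> C \<and> f y \<noteq> 0 | f. f \<in> ?R \<and> f w \<noteq> 0}"
    obtain U where U: "ultra U" and UP: "\<And>P. P \<in> ?P \<Longrightarrow> eventually P U"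
    proof (rule ultra_multiplicative[of ?P])
      show "?P \<noteq> {}" using polys.const[of 1 "affine_coord W"] by fastforce
      show "\<exists>y. P y" if "P \<in> ?P" for P
        using that wF by blast
      show "\<exists>R\<in>?P. \<forall>y. R y \<longrightarrow> P y \<and> Q y" if PQ: "P \<in> ?P" "Q \<in> ?P" for P Q
      proof -
        obtain f g where f: "f \<in> ?R" "f w \<noteq> 0" "P = (\<lambda>y. y \<in> C \<and> f y \<noteq> 0)"
          and g: "g \<in> ?R" "g w \<noteq> 0" "Q = (\<lambda>y. y \<in> C \<and> g y \<noteq> 0)"
          using PQ by blast
        show ?thesis
        proof (rule bexI[of _ "\<lambda>y. y \<in> C \<and> f y * g y \<noteq> 0"])
          show "(\<lambda>y. y \<in> C \<and> f y * g y \<noteq> 0) \<in> ?P"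
            using f(2) g(2) by (intro CollectI exI[of _ "\<lambda>y. f y * g y"] conjI refl
                polys.mult[OF f(1) g(1)]) simp
        qed (simp add: f g)
      qed
    qed (rule that)
    have ev: "eventually (\<lambda>y. y \<in> C \<and> f y \<noteq> 0) U" if "f \<in> ?R" "f w \<noteq> 0" for f
      by (rule UP, rule CollectI, intro exI conjI, rule refl) (fact that)+
    have evC: "eventually (\<lambda>y. y \<in> C) U"
      using ev[of "\<lambda>_. 1"] polys.const[of 1 "affine_coord W"] by simp
    interpret P: function_algebra top ?R by (rule function_algebra_polys)
    \<comment> \<open>Adjoining zero adds nothing but the functions equal almost everywhere to a
      member of the old ring.\<close>
    define R where "R = adjoin U ?R (\<lambda>_. 0)"
    have RR: "?R \<subseteq> R" unfolding R_def by (rule P.adjoin_superset)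
    have R: "function_algebra U R" unfolding R_def by (rule P.function_algebra_adjoin)
    define M where "M = {f \<in> ?R. f w = 0}"
    have MR: "M \<subseteq> R" using RR by (auto simp: M_def)
    have gen: "\<exists>m\<in>M. eventually (\<lambda>y. h y = m y) U" if "h \<in> ideal_gen U M R" for h
      using that
    proof induction
      case zero
      have "(\<lambda>_. 0) \<in> M" by (simp add: M_def polys.const)
      then show ?case by (intro bexI[of _ "\<lambda>_. 0"]) simp_all
    next
      case (gen m b)
      then obtain p n where "polyfam ?R p n" "eventually (\<lambda>y. b y = poly (p y) 0) U"
        unfolding R_def adjoin_def by blast
      then obtain r where r: "r \<in> ?R" "eventually (\<lambda>y. b y = r y) U"
        unfolding polyfam_def poly_0_coeff_0 by blast
      have "(\<lambda>y. m y * r y) \<in> M" using gen(1) r(1) by (simp add: M_def polys.mult)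
      moreover have "eventually (\<lambda>y. m y * b y = m y * r y) U" using r(2) by eventually_elim simp
      ultimately show ?case by (intro bexI)
    next
      case (add f g)
      then obtain m k where m: "m \<in> M" "eventually (\<lambda>y. f y = m y) U"
        and k: "k \<in> M" "eventually (\<lambda>y. g y = k y) U" by blast
      have "(\<lambda>y. m y + k y) \<in> M" using m(1) k(1) by (simp add: M_def polys.add)
      moreover have "eventually (\<lambda>y. f y + g y = m y + k y) U"
        using m(2) k(2) by eventually_elim simp
      ultimately show ?case by (intro bexI)
    next
      case (cong f g)
      then obtain m where m: "m \<in> M" "eventually (\<lambda>y. f y = m y) U" by blast
      have "eventually (\<lambda>y. g y = m y) U" using m(2) cong.hyps(2) by eventually_elim simp
      then show ?case using m(1) by (rule bexI)
    qed
    have "(\<lambda>_. 1) \<notin> ideal_gen U M R"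
    proof
      assume "(\<lambda>_. 1) \<in> ideal_gen U M R"
      then obtain m where m: "m \<in> M" "eventually (\<lambda>y. 1 = m y) U" using gen[of "\<lambda>_. 1"] by blast
      have "(\<lambda>y. 1 + (- 1) * m y) \<in> ?R"
        using m(1) by (intro polys.add polys.mult polys.const) (simp add: M_def)
      from ev[OF this] have "eventually (\<lambda>y. y \<in> C \<and> 1 + (- 1) * m y \<noteq> 0) U"
        using m(1) by (simp add: M_def)
      then have "eventually (\<lambda>_. False) U"
        using m(2) by eventually_elim simp
      then show False using U by (simp add: ultra_def eventually_False)
    qed
    from valuation_algebra_exists[OF U R MR this]
    obtain B where RB: "R \<subseteq> B" and B: "valuation_algebra U B" and MB: "M \<subseteq> valuation_algebra.maxid U B" .
    interpret valuation_algebra U B by fact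
    have "\<exists>a. (\<lambda>y. y v - a) \<in> maxid \<and> (\<lambda>y. y v) \<in> B" if v: "v \<in> V" for v
    proof -
      obtain p n where p: "monic_over ?R n p" "\<And>y. y \<in> C \<Longrightarrow> poly (p y) (y v) = 0"
        using int[OF v] unfolding integral_over_def by blast
      have root: "eventually (\<lambda>y. poly (p y) (y v) = 0) U"
        using evC by eventually_elim (rule p(2))
      have vB: "(\<lambda>y. y v) \<in> B"
        by (rule integrally_closed[OF _ _ _ root, of n]) (use p(1) RR RB in \<open>auto simp: monic_over_def\<close>)
      have "(\<lambda>y. coeff (p w) i - coeff (p y) i) \<in> maxid" for i
      proof -
        have "(\<lambda>y. coeff (p w) i + (- 1) * coeff (p y) i) \<in> M"
          using p(1) unfolding M_def monic_over_def
          by (intro CollectI conjI polys.add polys.mult polys.const) auto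
        then show ?thesis using MB by auto
      qed
      \<comment> \<open>Replacing the coefficients by their values at \<open>w\<close> changes the
        equation only by an element of the maximal ideal and makes its coefficients constant, as
        \<open>residue_root\<close> requires.\<close>
      then have "(\<lambda>y. \<Sum>i\<le>n. (coeff (p w) i - coeff (p y) i) * y v ^ i) \<in> maxid"
        using vB by (intro maxid_sum maxid_mult power) auto
      moreover have "eventually (\<lambda>y. (\<Sum>i\<le>n. (coeff (p w) i - coeff (p y) i) * y v ^ i)
          = poly (p w) (y v)) U"
        using root
      proof eventually_elim
        case (elim y)
        have "poly (p y) x = (\<Sum>i\<le>n. coeff (p y) i * x ^ i)" for x y
          using p(1) by (simp add: poly_altdef monic_over_def)
        then show ?case using elim by (simp add: left_diff_distrib sum_subtractf)
      qed
      ultimately have "(\<lambda>y. poly (p w) (y v)) \<in> maxid" by (rule maxid_cong)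
      moreover have "p w \<noteq> 0" using p(1) by (auto simp: monic_over_def dest: spec[of _ w])
      ultimately show ?thesis using residue_root[OF B vB] vB by blast
    qed
    then obtain a where a: "\<And>v. v \<in> V \<Longrightarrow> (\<lambda>y. y v - a v) \<in> maxid"
      and vB: "\<And>v. v \<in> V \<Longrightarrow> (\<lambda>y. y v) \<in> B" by metis
    let ?a = "restrict a V"
    obtain G where G: "G \<subseteq> polys (affine_coord V)" "C = zero_locus G (V \<rightarrow>\<^sub>E UNIV)"
      using C unfolding closedin_zariski by blast
    have "g ?a = 0" if g: "g \<in> G" for g
    proof -
      have "(\<lambda>y. g y - g ?a) \<in> maxid"
        by (rule residue_polys[where S = "affine_coord V" and \<gamma> = "\<lambda>y. y"]) (use G g a vB in auto)
      moreover have "eventually (\<lambda>y. g y - g ?a = - g ?a) U"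
        using evC by eventually_elim (use G g in \<open>simp add: zero_locus_def\<close>)
      ultimately have "(\<lambda>_. - g ?a) \<in> maxid" by (rule maxid_cong)
      from maxid_const[OF this] show ?thesis by simp
    qed
    then have aC: "?a \<in> C" unfolding G(2) zero_locus_def by simp
    have aw: "restrict ?a W = w"
    proof (rule PiE_ext)
      show "restrict ?a W \<in> W \<rightarrow>\<^sub>E UNIV" "w \<in> W \<rightarrow>\<^sub>E UNIV" using w by (auto simp: zero_locus_def)
      fix v assume v: "v \<in> W"
      then have vV: "v \<in> V" using WV by blast
      have "(\<lambda>y. y v + (- w v)) \<in> M"
        unfolding M_def
      proof (intro CollectI conjI)
        show "(\<lambda>y. y v + (- w v)) \<in> ?R" by (rule polys.add[OF polys.gen polys.const]) (use v in blast)
      qed simp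
      then have "(\<lambda>y. (y v + (- w v)) - (y v - a v)) \<in> maxid" 
        by (intro maxid_diff a[OF vV] subsetD[OF MB])
      then have "(\<lambda>y. a v - w v) \<in> maxid" by simp
      from maxid_const[OF this] show "restrict ?a W v = w v" using v vV by simp
    qed
    show ?thesis using imageI[OF aC, of "\<lambda>y. restrict y W"] unfolding aw .
  qed
  moreover have "(\<lambda>y. restrict y W) ` C \<subseteq> zero_locus ?F (W \<rightarrow>\<^sub>E UNIV)"
    by (auto simp: zero_locus_def polys_restrict)
  ultimately have eq: "(\<lambda>y. restrict y W) ` C = zero_locus ?F (W \<rightarrow>\<^sub>E UNIV)" by blast
  have "?F \<subseteq> ?R" by (rule Collect_restrict)
  then show ?thesis unfolding closedin_zariski eq by (intro exI[of _ ?F] conjI refl)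
qed

lemma integral_over_subset: "integral_over Y R f \<Longrightarrow> C \<subseteq> Y \<Longrightarrow> integral_over C R f"
  unfolding integral_over_def by blast

text \<open>Incomparability: a minimal monic equation over \<open>B\<close> for a function that vanishes on \<open>A\<close> has
  constant term vanishing on \<open>A\<close>, hence on \<open>B\<close>.\<close>

lemma integral_incomparable:
  fixes Y :: "('v \<Rightarrow> 'k::field) set"
  assumes WV: "W \<subseteq> V"
    and int: "\<And>f. f \<in> polys (affine_coord V) \<Longrightarrow> integral_over Y (polys (affine_coord W)) f"
    and A: "closedin (zariski (affine_coord V) Y) A" and B: "closedin (zariski (affine_coord V) Y) B"
    and irr: "irreducible_space (subtopology (zariski (affine_coord V) Y) B)"
    and AB: "A \<subset> B"
  shows "(\<lambda>y. restrict y W) ` A \<noteq> (\<lambda>y. restrict y W) ` B"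
proof
  assume eq: "(\<lambda>y. restrict y W) ` A = (\<lambda>y. restrict y W) ` B"
  let ?R = "polys (affine_coord W) :: (('v \<Rightarrow> 'k) \<Rightarrow> 'k) set"
  have BY: "B \<subseteq> Y" using closedin_subset[OF B] by simp
  obtain F where F: "F \<subseteq> polys (affine_coord V)" "A = zero_locus F Y"
    using A unfolding closedin_zariski by blast
  obtain b where b: "b \<in> B" "b \<notin> A" using AB by blast
  then obtain f where f: "f \<in> F" "f b \<noteq> 0" using F(2) BY by (auto simp: zero_locus_def)
  have fV: "f \<in> polys (affine_coord V)" using f F by blast
  have fA: "f y = 0" if "y \<in> A" for y using that F f by (auto simp: zero_locus_def)
  let ?Q = "\<lambda>n. \<exists>p. monic_over ?R n p \<and> (\<forall>y\<in>B. poly (p y) (f y) = 0)"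
  have "\<exists>n. ?Q n" using int[OF fV] BY unfolding integral_over_def by blast
  then obtain n where "?Q n" and least: "\<And>m. m < n \<Longrightarrow> \<not> ?Q m"
    using exists_least_iff[of ?Q] by blast
  then obtain p where p: "monic_over ?R n p" and pB: "\<And>y. y \<in> B \<Longrightarrow> poly (p y) (f y) = 0" by blast
  have "n \<noteq> 0"
  proof
    assume "n = 0"
    then have "poly (p b) (f b) = 1" using monic_overD(2,3)[OF p, of b] by (simp add: poly_altdef)
    then show False using pB[OF b(1)] by simp
  qed
  then obtain m where m: "n = Suc m" using not0_implies_Suc by blast
  define q where "q = (\<lambda>y. poly_shift 1 (p y))"
  have cq: "coeff (q y) i = coeff (p y) (Suc i)" for y i
    by (simp add: q_def coeff_poly_shift)
  have pq: "p y = pCons (coeff (p y) 0) (q y)" for y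
    by (rule poly_eqI) (simp add: coeff_pCons cq split: nat.split)
  have dp: "degree (p y) = Suc m" "coeff (p y) (Suc m) = 1" for y
    using monic_overD(2,3)[OF p, of y] m by simp_all
  have dq: "degree (q y) = m" for y
    using dp[of y] pq[of y] by (metis degree_pCons_eq_if nat.inject nat.distinct(1))
  have q: "monic_over ?R m q"
    using monic_overD(1)[OF p] dq dp(2) by (simp add: monic_over_def cq)
  have c0: "coeff (p y) 0 = 0" if y: "y \<in> B" for y
  proof -
    have "restrict y W \<in> (\<lambda>y. restrict y W) ` A" unfolding eq using y by blast
    then obtain a where a: "a \<in> A" "restrict y W = restrict a W" by blast
    from polys_cong[OF monic_overD(1)[OF p] a(2)] have "coeff (p y) 0 = coeff (p a) 0" .
    also have "\<dots> = poly (p a) (f a)" using fA[OF a(1)] by (simp add: poly_0_coeff_0)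
    also have "\<dots> = 0" using pB a AB by blast
    finally show ?thesis .
  qed
  \<comment> \<open>On \<open>B\<close> the equation is now f q(f) = 0. Irreducibility of
    \<open>B\<close> and f(b) being nonzero leave q(f) = 0 on all of \<open>B\<close>, an equation
    of smaller degree.\<close>
  have prod: "f y = 0 \<or> poly (q y) (f y) = 0" if "y \<in> B" for y
    using pB[OF that] pq[of y] c0[OF that] by (metis add_0 mult_eq_0_iff poly_pCons)
  let ?g = "\<lambda>y. poly (q y) (f y)"
  interpret P: function_algebra top "polys (affine_coord V) :: (('v \<Rightarrow> 'k) \<Rightarrow> 'k) set"
    by (rule function_algebra_polys)
  have "(\<lambda>y. \<Sum>i\<le>m. coeff (q y) i * f y ^ i) \<in> polys (affine_coord V)"
    using WV by (intro P.sum P.mult P.power fV polys_mono[OF monic_overD(1)[OF q]]) auto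
  then have "?g \<in> polys (affine_coord V)" by (simp add: poly_altdef dq)
  then have "closedin (zariski (affine_coord V) Y) {y \<in> Y. ?g y = 0}"
    "closedin (zariski (affine_coord V) Y) {y \<in> Y. f y = 0}"
    unfolding closedin_zariski zero_locus_def using fV
    by (intro exI[of _ "{?g}"] exI[of _ "{f}"]; auto)+
  moreover have "B \<subseteq> {y \<in> Y. f y = 0} \<union> {y \<in> Y. ?g y = 0}" using prod BY by blast
  ultimately have "B \<subseteq> {y \<in> Y. f y = 0} \<or> B \<subseteq> {y \<in> Y. ?g y = 0}"
    using irr unfolding irreducible_closed_iff[OF B] by blast
  then have "\<forall>y\<in>B. ?g y = 0" using b f by blast
  then show False using least[of m] q m by blast
qed

text \<open>In geometric terms the projection is a finite morphism: closed, with finite fibres and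
  with incomparability, which are the hypotheses of \<open>krull_dim_eq_closed_map\<close>.\<close>

theorem integral_projection:
  fixes Y :: "('v \<Rightarrow> 'k::alg_closed_field) set"
  assumes V: "finite V" and WV: "W \<subseteq> V"
    and Y: "closedin (zariski (affine_coord V) (V \<rightarrow>\<^sub>E UNIV)) Y"
    and int: "\<And>f. f \<in> polys (affine_coord V) \<Longrightarrow> integral_over Y (polys (affine_coord W)) f"
  defines "\<pi> \<equiv> \<lambda>y. restrict y W"
  shows "closedin (zariski (affine_coord W) (W \<rightarrow>\<^sub>E UNIV)) (\<pi> ` Y)"
    and "krull_dim (zariski (affine_coord V) Y) = krull_dim (zariski (affine_coord W) (\<pi> ` Y))"
proof -
  have YV: "Y \<subseteq> V \<rightarrow>\<^sub>E UNIV" using closedin_subset[OF Y] by simp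
  have iv: "integral_over Y (polys (affine_coord W)) (\<lambda>y. y v)" if "v \<in> V" for v
    using that by (intro int polys.gen) blast
  show "closedin (zariski (affine_coord W) (W \<rightarrow>\<^sub>E UNIV)) (\<pi> ` Y)"
    unfolding \<pi>_def by (rule closed_projection[OF WV Y iv])
  show "krull_dim (zariski (affine_coord V) Y) = krull_dim (zariski (affine_coord W) (\<pi> ` Y))"
  proof (rule krull_dim_eq_closed_map[where f = \<pi>])
    show "continuous_map (zariski (affine_coord V) Y) (zariski (affine_coord W) (\<pi> ` Y)) \<pi>"
      unfolding continuous_map_closedin
    proof (intro conjI allI impI ballI)
      fix C assume "closedin (zariski (affine_coord W) (\<pi> ` Y)) C"
      then obtain F where F: "F \<subseteq> polys (affine_coord W)" "C = zero_locus F (\<pi> ` Y)"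
        unfolding closedin_zariski by blast
      have "F \<subseteq> polys (affine_coord V)" using F(1) WV polys_mono[of _ "affine_coord W" "affine_coord V"] by blast
      moreover have "{x \<in> topspace (zariski (affine_coord V) Y). \<pi> x \<in> C} = zero_locus F Y"
      proof -
        have "f (\<pi> y) = f y" if "f \<in> F" for f y
          unfolding \<pi>_def using that F(1) by (intro polys_restrict) blast
        then have fr: "(\<forall>f\<in>F. f (\<pi> y) = 0) \<longleftrightarrow> (\<forall>f\<in>F. f y = 0)" for y
          by metis
        show ?thesis unfolding F(2) zero_locus_def mem_Collect_eq topspace_zariski fr by blast
      qed
      ultimately show "closedin (zariski (affine_coord V) Y) {x \<in> topspace (zariski (affine_coord V) Y). \<pi> x \<in> C}"
        unfolding closedin_zariski by blast
    qed auto
    show "\<pi> ` topspace (zariski (affine_coord V) Y) = topspace (zariski (affine_coord W) (\<pi> ` Y))" by simp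
  next
    fix C assume C: "closedin (zariski (affine_coord V) Y) C"
    have CY: "C \<subseteq> Y" using closedin_subset[OF C] by simp
    have "closedin (subtopology (zariski (affine_coord V) (V \<rightarrow>\<^sub>E UNIV)) Y) C"
      using C by (simp add: subtopology_zariski[OF YV])
    then have "closedin (zariski (affine_coord V) (V \<rightarrow>\<^sub>E UNIV)) C"
      using Y closedin_closed_subtopology by blast
    then have "closedin (zariski (affine_coord W) (W \<rightarrow>\<^sub>E UNIV)) (\<pi> ` C)"
      unfolding \<pi>_def by (rule closed_projection[OF WV]) (use iv CY integral_over_subset in blast)
    then have "closedin (subtopology (zariski (affine_coord W) (W \<rightarrow>\<^sub>E UNIV)) (\<pi> ` Y)) (\<pi> ` C)"
      using CY by (intro closedin_subset_topspace) auto
    then show "closedin (zariski (affine_coord W) (\<pi> ` Y)) (\<pi> ` C)"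
      by (subst (asm) subtopology_zariski) (auto simp: \<pi>_def)
  next
    fix w
    have "\<forall>v\<in>V. \<exists>p. (\<forall>i. (\<lambda>y. coeff (p y) i) \<in> polys (affine_coord W)) \<and>
        (\<forall>y\<in>Y. p y \<noteq> 0 \<and> poly (p y) (y v) = 0)"
    proof
      fix v assume v: "v \<in> V"
      obtain p n where "monic_over (polys (affine_coord W)) n p" "\<forall>y\<in>Y. poly (p y) (y v) = 0"
        using iv[OF v] unfolding integral_over_def by blast
      moreover from this(1) have "p y \<noteq> 0" for y by (rule monic_overD(4))
      ultimately show "\<exists>p. (\<forall>i. (\<lambda>y. coeff (p y) i) \<in> polys (affine_coord W)) \<and>
        (\<forall>y\<in>Y. p y \<noteq> 0 \<and> poly (p y) (y v) = 0)" unfolding monic_over_def by blast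
    qed
    from bchoice[OF this] obtain p where *: "\<forall>v\<in>V.
      (\<forall>i. (\<lambda>y. coeff (p v y) i) \<in> polys (affine_coord W)) \<and>
      (\<forall>y\<in>Y. p v y \<noteq> 0 \<and> poly (p v y) (y v) = 0)" by (elim exE)
    have p: "(\<lambda>y. coeff (p v y) i) \<in> polys (affine_coord W)"
      "y \<in> Y \<Longrightarrow> p v y \<noteq> 0 \<and> poly (p v y) (y v) = 0" if "v \<in> V" for v i y
      using * that by simp_all
    show "finite {y \<in> topspace (zariski (affine_coord V) Y). \<pi> y = w}"
    proof (cases "\<exists>y0\<in>Y. \<pi> y0 = w")
      case True
      then obtain y0 where y0: "y0 \<in> Y" "\<pi> y0 = w" by blast
      \<comment> \<open>The coefficients depend only on the projected point, so the equations of
        \<open>y0\<close> hold on its whole fibre and leave finitely many values for each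
        coordinate.\<close>
      have "{y \<in> Y. \<pi> y = w} \<subseteq> (\<Pi>\<^sub>E v\<in>V. {z. poly (p v y0) z = 0})"
      proof
        fix y assume y: "y \<in> {y \<in> Y. \<pi> y = w}"
        have "p v y = p v y0" if "v \<in> V" for v
          using polys_cong[OF p(1)[OF that]] y y0 by (intro poly_eqI) (auto simp: \<pi>_def)
        then show "y \<in> (\<Pi>\<^sub>E v\<in>V. {z. poly (p v y0) z = 0})"
          using p(2)[of _ y] y YV by (auto simp: PiE_iff)
      qed
      moreover have "finite (\<Pi>\<^sub>E v\<in>V. {z. poly (p v y0) z = 0})"
        using V p(2) y0(1) by (intro finite_PiE poly_roots_finite) auto
      ultimately show ?thesis by (simp add: finite_subset)
    next
      case False
      then have "{y \<in> topspace (zariski (affine_coord V) Y). \<pi> y = w} = {}" by auto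
      then show ?thesis by (simp only: finite.emptyI)
    qed
  next
    fix A B assume *: "closedin (zariski (affine_coord V) Y) A" "closedin (zariski (affine_coord V) Y) B"
      "irreducible_space (subtopology (zariski (affine_coord V) Y) B)" "A \<subset> B"
    show "\<pi> ` A \<noteq> \<pi> ` B"
      unfolding \<pi>_def by (rule integral_incomparable[OF WV _ *]) (rule int)
  qed
qed

section \<open>The group \<open>SL\<^sub>2\<close>\<close>

definition mat2 :: "complex \<Rightarrow> complex \<Rightarrow> complex \<Rightarrow> complex \<Rightarrow> complex^2^2" where
  "mat2 a b c d = vector [vector [a, b], vector [c, d]]"

abbreviation dg :: "complex \<Rightarrow> complex^2^2" where "dg t \<equiv> mat2 t 0 0 (1 / t)"
abbreviation up :: "complex \<Rightarrow> complex^2^2" where "up z \<equiv> mat2 1 z 0 1"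
abbreviation lo :: "complex \<Rightarrow> complex^2^2" where "lo z \<equiv> mat2 1 0 z 1"

lemma mat2_entries [simp]:
  "mat2 a b c d $ 1 $ 1 = a" "mat2 a b c d $ 1 $ 2 = b" "mat2 a b c d $ 2 $ 1 = c" "mat2 a b c d $ 2 $ 2 = d"
  by (simp_all add: mat2_def)

lemma matrix2_eq_iff: "A = B \<longleftrightarrow> A $ 1 $ 1 = B $ 1 $ 1 \<and> A $ 1 $ 2 = B $ 1 $ 2 \<and>
    A $ 2 $ 1 = B $ 2 $ 1 \<and> A $ 2 $ 2 = B $ 2 $ 2" for A B :: "complex^2^2"
  by (auto simp: vec_eq_iff forall_2)

lemma mat2_collapse: "mat2 (A $ 1 $ 1) (A $ 1 $ 2) (A $ 2 $ 1) (A $ 2 $ 2) = A"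
  by (simp add: matrix2_eq_iff)

lemma mult_entry: "(A ** B) $ i $ j = A $ i $ 1 * B $ 1 $ j + A $ i $ 2 * B $ 2 $ j"
  for A B :: "complex^2^2"
  by (simp add: matrix_matrix_mult_def sum_2)

lemma mat2_mult: "mat2 a b c d ** mat2 a' b' c' d' = mat2 (a*a' + b*c') (a*b' + b*d') (c*a' + d*c') (c*b' + d*d')"
  by (simp add: matrix2_eq_iff mult_entry)

lemma mat_1_mk: "mat 1 = mat2 1 0 0 1"
  by (simp add: matrix2_eq_iff mat_def)

lemma mat2_inj: "mat2 a b c d = mat2 a' b' c' d' \<longleftrightarrow> a = a' \<and> b = b' \<and> c = c' \<and> d = d'"
  by (simp add: matrix2_eq_iff)

lemma mem_SL2: "g \<in> SL2 \<longleftrightarrow> g $ 1 $ 1 * g $ 2 $ 2 - g $ 1 $ 2 * g $ 2 $ 1 = 1"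
  by (simp add: SL2_def det_2)

lemma mat2_mem_SL2: "mat2 a b c d \<in> SL2 \<longleftrightarrow> a * d - b * c = 1"
  by (simp add: mem_SL2)

lemma SL2_mult: "g \<in> SL2 \<Longrightarrow> h \<in> SL2 \<Longrightarrow> g ** h \<in> SL2"
  by (simp add: SL2_def det_mul)

lemma SL2_one: "mat 1 \<in> SL2"
  by (simp add: SL2_def)

definition inv2 :: "complex^2^2 \<Rightarrow> complex^2^2" where
  "inv2 g = mat2 (g $ 2 $ 2) (- g $ 1 $ 2) (- g $ 2 $ 1) (g $ 1 $ 1)"

lemma inv2_SL2: "g \<in> SL2 \<Longrightarrow> inv2 g \<in> SL2"
  by (simp add: inv2_def mem_SL2 algebra_simps)

lemma inv2_mult: "g \<in> SL2 \<Longrightarrow> inv2 g ** g = mat 1" "g \<in> SL2 \<Longrightarrow> g ** inv2 g = mat 1"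
  by (simp_all add: inv2_def mem_SL2 matrix2_eq_iff mult_entry mat_1_mk algebra_simps)

lemma mult_entry_in:
  fixes A :: "('y \<Rightarrow> complex) set" and g h :: "'y \<Rightarrow> complex^2^2"
  assumes A: "function_algebra U A"
    and g: "\<And>i j. (\<lambda>y. g y $ i $ j) \<in> A" and h: "\<And>i j. (\<lambda>y. h y $ i $ j) \<in> A"
  shows "(\<lambda>y. (g y ** h y) $ i $ j) \<in> A"
proof -
  interpret function_algebra U A by fact
  show ?thesis unfolding mult_entry by (intro add mult g h)
qed

lemma mat2_entry_in:
  fixes a b c d :: "'y \<Rightarrow> complex"
  assumes "a \<in> A" "b \<in> A" "c \<in> A" "d \<in> A"
  shows "(\<lambda>y. mat2 (a y) (b y) (c y) (d y) $ i $ j) \<in> A"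
  using assms exhaust_2[of i] exhaust_2[of j] by auto

section \<open>Affine \<open>SL\<^sub>2\<close>-varieties\<close>

locale sl2_variety =
  fixes X :: "(complex, 2, 'v) gvar"
  assumes gvar: "affine_gvar SL2 X"
begin

lemma act_pts: "g \<in> SL2 \<Longrightarrow> x \<in> pts X \<Longrightarrow> act X g x \<in> pts X"
  using gvar by (simp add: affine_gvar_def)

lemma act_one: "x \<in> pts X \<Longrightarrow> act X (mat 1) x = x"
  using gvar by (simp add: affine_gvar_def)

lemma act_mult: "g \<in> SL2 \<Longrightarrow> h \<in> SL2 \<Longrightarrow> x \<in> pts X \<Longrightarrow> act X (g ** h) x = act X g (act X h x)"
  using gvar by (simp add: affine_gvar_def)

lemma closed_pts: "closedin (zariski (affine_coord (coords X)) (coords X \<rightarrow>\<^sub>E UNIV)) (pts X)"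
  using gvar by (simp add: affine_gvar_def)

lemma pts_PiE: "pts X \<subseteq> coords X \<rightarrow>\<^sub>E UNIV"
  using closedin_subset[OF closed_pts] by simp

lemma pts_eqI: "x \<in> pts X \<Longrightarrow> y \<in> pts X \<Longrightarrow> (\<And>v. v \<in> coords X \<Longrightarrow> x v = y v) \<Longrightarrow> x = y"
  by (rule PiE_ext[OF subsetD[OF pts_PiE] subsetD[OF pts_PiE]])

lemma act_inv: "g \<in> SL2 \<Longrightarrow> x \<in> pts X \<Longrightarrow> act X (inv2 g) (act X g x) = x"
  by (metis act_mult act_one inv2_SL2 inv2_mult(1))

lemma act_inv': "g \<in> SL2 \<Longrightarrow> x \<in> pts X \<Longrightarrow> act X g (act X (inv2 g) x) = x"
  by (metis act_mult act_one inv2_SL2 inv2_mult(2))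

text \<open>The algebra \<open>A\<close> will be a valuation ring, or consist of the polynomial or Laurent polynomial
  functions of a parameter.\<close>

lemma act_in_algebra:
  assumes A: "function_algebra U A"
    and ev: "eventually (\<lambda>y. g y \<in> SL2 \<and> \<xi> y \<in> pts X) U"
    and g: "\<And>i j. (\<lambda>y. g y $ i $ j) \<in> A" and \<xi>: "\<And>v. v \<in> coords X \<Longrightarrow> (\<lambda>y. \<xi> y v) \<in> A"
    and v: "v \<in> coords X"
  shows "(\<lambda>y. act X (g y) (\<xi> y) v) \<in> A"
proof -
  interpret function_algebra U A by fact
  obtain f where f: "f \<in> polys (GL_affine_coord (coords X))"
    and act: "\<And>g x. g \<in> SL2 \<Longrightarrow> x \<in> pts X \<Longrightarrow> act X g x v = f (g, x)"
    using gvar v unfolding affine_gvar_def by blast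
  have "(\<lambda>y. f ((\<lambda>y. (g y, \<xi> y)) y)) \<in> A"
  proof (rule pullback[OF f])
    fix h :: "(complex^2^2) \<times> ('v \<Rightarrow> complex) \<Rightarrow> complex"
    assume "h \<in> GL_affine_coord (coords X)"
    then consider i j where "h = (\<lambda>(A, x). A $ i $ j)" | "h = (\<lambda>(A, x). inverse (det A))"
      | w where "w \<in> coords X" "h = (\<lambda>(A, x). x w)"
      unfolding GL_affine_coord_def GL_coord_def by blast
    then show "(\<lambda>y. h (g y, \<xi> y)) \<in> A"
    proof cases
      case 2
      \<comment> \<open>On the group the generator 1/det is the constant 1.\<close>
      have "eventually (\<lambda>y. 1 = inverse (det (g y))) U"
        using ev by eventually_elim (simp add: SL2_def)
      then show ?thesis using cong[OF const[of 1], of "\<lambda>y. inverse (det (g y))"] 2 by simp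
    qed (use g \<xi> in auto)
  qed
  moreover have "eventually (\<lambda>y. f (g y, \<xi> y) = act X (g y) (\<xi> y) v) U"
    using ev by eventually_elim (simp add: act)
  ultimately show ?thesis using cong by simp
qed

end

section \<open>Polynomial and Laurent polynomial functions of parameters\<close>

lemma function_algebra_poly:
  "function_algebra (principal D) {F :: 'y \<Rightarrow> complex. \<exists>p. \<forall>t\<in>D. F t = poly p (\<phi> t)}"
proof
  show "(\<lambda>_. c) \<in> {F. \<exists>p. \<forall>t\<in>D. F t = poly p (\<phi> t)}" for c
    by (auto intro: exI[of _ "[:c:]"])
  fix f g assume "f \<in> {F. \<exists>p. \<forall>t\<in>D. F t = poly p (\<phi> t)}"
  then obtain p where p: "\<forall>t\<in>D. f t = poly p (\<phi> t)" by blast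
  show "g \<in> {F. \<exists>p. \<forall>t\<in>D. F t = poly p (\<phi> t)}" if "eventually (\<lambda>y. f y = g y) (principal D)"
    using that p by (auto simp: eventually_principal intro!: exI[of _ p])
  assume "g \<in> {F. \<exists>p. \<forall>t\<in>D. F t = poly p (\<phi> t)}"
  then obtain q where q: "\<forall>t\<in>D. g t = poly q (\<phi> t)" by blast
  show "(\<lambda>y. f y + g y) \<in> {F. \<exists>p. \<forall>t\<in>D. F t = poly p (\<phi> t)}"
    using p q by (auto intro!: exI[of _ "p + q"])
  show "(\<lambda>y. f y * g y) \<in> {F. \<exists>p. \<forall>t\<in>D. F t = poly p (\<phi> t)}"
    using p q by (auto intro!: exI[of _ "p * q"])
qed

text \<open>The outer variable of \<open>P\<close> is \<open>t\<close> and its coefficients are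
  polynomials in \<open>z\<close>; \<open>M\<close> clears the negative powers of
  \<open>t\<close>.\<close>

lemma function_algebra_laurent:
  "function_algebra (principal {(t, z). t \<noteq> 0}) {F :: complex \<times> complex \<Rightarrow> complex.
     \<exists>P M. \<forall>t z. t \<noteq> 0 \<longrightarrow> F (t, z) * t ^ M = poly (poly P [:t:]) z}"
  (is "function_algebra ?U ?A")
proof
  show "(\<lambda>_. c) \<in> ?A" for c
    by (rule CollectI, rule exI[of _ "[:[:c:]:]"], rule exI[of _ 0]) simp
  fix f g assume "f \<in> ?A"
  then obtain P M where P: "\<And>t z. t \<noteq> 0 \<Longrightarrow> f (t, z) * t ^ M = poly (poly P [:t:]) z" by blast
  show "g \<in> ?A" if "eventually (\<lambda>y. f y = g y) ?U"
    by (rule CollectI, rule exI[of _ P], rule exI[of _ M])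
      (use that P in \<open>auto simp: eventually_principal\<close>)
  assume "g \<in> ?A"
  then obtain Q N where Q: "\<And>t z. t \<noteq> 0 \<Longrightarrow> g (t, z) * t ^ N = poly (poly Q [:t:]) z" by blast
  have m: "poly (poly (monom 1 K) [:t:]) z = t ^ K" for t z :: complex and K
    by (simp add: poly_monom poly_power)
  show "(\<lambda>y. f y + g y) \<in> ?A"
    by (intro CollectI exI[of _ "P * monom 1 N + Q * monom 1 M"] exI[of _ "M + N"] allI impI)
       (simp add: P[symmetric] Q[symmetric] m power_add algebra_simps del: poly_monom)
  show "(\<lambda>y. f y * g y) \<in> ?A"
    by (intro CollectI exI[of _ "P * Q"] exI[of _ "M + N"] allI impI)
       (simp add: P[symmetric] Q[symmetric] power_add algebra_simps)
qed

lemma poly_eqI_nonzero: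
  fixes p q :: "complex poly"
  assumes "\<And>t. t \<noteq> 0 \<Longrightarrow> poly p t = poly q t"
  shows "p = q"
proof -
  have "poly ([:0, 1:] * (p - q)) t = 0" for t
    using assms[of t] by (cases "t = 0") auto
  then have "[:0, 1:] * (p - q) = 0" using poly_all_0_iff_0 by blast
  then show ?thesis by simp
qed

text \<open>A function regular both at 0 and at infinity is constant: after clearing the
  denominator, t^(degree q) p has degree at most that of \<open>q\<close>.\<close>

lemma poly_eq_poly_inverse:
  fixes p q :: "complex poly"
  assumes "\<And>t. t \<noteq> 0 \<Longrightarrow> poly p t = poly q (1 / t)"
  shows "poly p t = poly p 0"
proof -
  have "monom 1 (degree q) * p = reflect_poly q"
    by (rule poly_eqI_nonzero)
      (simp add: poly_monom poly_reflect_poly_nz assms divide_inverse)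
  then have "degree (monom 1 (degree q) * p) \<le> degree q"
    using degree_reflect_poly_le by metis
  then have "degree p = 0"
    by (cases "p = 0") (simp_all add: degree_mult_eq degree_monom_eq monom_eq_0_iff)
  then show ?thesis by (auto elim: degree_eq_zeroE)
qed

lemma poly_poly_const:
  "poly (poly P [:t:]) z = (\<Sum>n\<le>degree P. t ^ n * poly (coeff P n) z)" for t z :: complex
  by (simp add: poly_altdef[of P] poly_sum poly_power mult.commute)

text \<open>A Vandermonde argument: constants \<open>\<tau>\<close> separate the homogeneous parts,
  one being eliminated at a time. In \<open>valuation_limit\<close> the scaling by
  \<open>\<tau>\<close> is an additional torus element.\<close>

lemma coeffs_in_algebra:
  fixes w :: "nat \<Rightarrow> 'y \<Rightarrow> complex"
  assumes A: "function_algebra U A"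
    and "\<And>\<tau>. \<tau> \<noteq> 0 \<Longrightarrow> (\<lambda>y. \<Sum>n\<le>N. \<tau> ^ n * w n y) \<in> A"
    and "n \<le> N"
  shows "w n \<in> A"
  using assms(2,3)
proof (induction N arbitrary: w n)
  case 0
  then show ?case using 0(1)[of 1] by simp
next
  case (Suc N)
  interpret function_algebra U A by fact
  \<comment> \<open>\<open>?G (2 * \<tau>) - 2 ^ Suc N * ?G \<tau>\<close> has no top term.\<close>
  let ?G = "\<lambda>\<tau> y. \<Sum>n\<le>Suc N. \<tau> ^ n * w n y"
  have lower: "w k \<in> A" if k: "k \<le> N" for k
  proof -
    have ne: "(2::complex) ^ k - 2 ^ Suc N \<noteq> 0"
    proof
      assume "(2::complex) ^ k - 2 ^ Suc N = 0"
      then have "of_nat (2 ^ k) = (of_nat (2 ^ Suc N) :: complex)" by simp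
      then have "(2::nat) ^ k = 2 ^ Suc N" by (simp only: of_nat_eq_iff)
      then have "k = Suc N" by (rule power_inject_exp[THEN iffD1, rotated]) simp
      then show False using k by simp
    qed
    have "(\<lambda>y. (2 ^ k - 2 ^ Suc N) * w k y) \<in> A"
    proof (rule Suc.IH[of "\<lambda>k y. (2 ^ k - 2 ^ Suc N) * w k y", OF _ k])
      fix \<tau> :: complex assume \<tau>: "\<tau> \<noteq> 0"
      have "(\<lambda>y. ?G (2 * \<tau>) y - 2 ^ Suc N * ?G \<tau> y) \<in> A"
        using \<tau> by (intro diff mult const Suc.prems) auto
      moreover have "?G (2 * \<tau>) y - 2 ^ Suc N * ?G \<tau> y
          = (\<Sum>n\<le>N. \<tau> ^ n * ((2 ^ n - 2 ^ Suc N) * w n y))" for y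
        by (simp add: sum_distrib_left power_mult_distrib algebra_simps sum_subtractf)
      ultimately show "(\<lambda>y. \<Sum>n\<le>N. \<tau> ^ n * ((2 ^ n - 2 ^ Suc N) * w n y)) \<in> A" by simp
    qed
    from mult[OF const[of "inverse (2 ^ k - 2 ^ Suc N)"] this] show ?thesis
      using ne by (simp flip: mult.assoc)
  qed
  show ?case
  proof (cases "n \<le> N")
    case False
    then have n: "n = Suc N" using Suc.prems(2) by simp
    have "(\<lambda>y. ?G 1 y - (\<Sum>n\<le>N. w n y)) \<in> A"
      using lower by (intro diff sum Suc.prems) auto
    then show ?thesis by (simp add: n)
  qed (rule lower)
qed

text \<open>Being a polynomial in \<open>1 / t\<close>, the point \<open>dg t ** h \<cdot> x\<close> has a limit for \<open>t \<rightarrow> \<infinity>\<close>. Up to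
  conjugation these are all one-parameter subgroups, and the existence of the limit depends only on
  the direction of the first row of \<open>h\<close>.\<close>

definition limit_exists :: "(complex, 2, 'v) gvar \<Rightarrow> ('v \<Rightarrow> complex) \<Rightarrow> complex^2^2 \<Rightarrow> bool" where
  "limit_exists X x h \<longleftrightarrow>
     (\<forall>v\<in>coords X. \<exists>p. \<forall>t. t \<noteq> 0 \<longrightarrow> act X (dg t ** h) x v = poly p (1 / t))"

definition torus_fixed :: "(complex, 2, 'v) gvar \<Rightarrow> ('v \<Rightarrow> complex) \<Rightarrow> bool" where
  "torus_fixed X x \<longleftrightarrow> (\<forall>t. t \<noteq> 0 \<longrightarrow> act X (dg t) x = x)"

definition group_fixed :: "(complex, 2, 'v) gvar \<Rightarrow> ('v \<Rightarrow> complex) \<Rightarrow> bool" where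
  "group_fixed X x \<longleftrightarrow> (\<forall>g\<in>SL2. act X g x = x)"

lemma up_SL2: "up z \<in> SL2" and lo_SL2: "lo z \<in> SL2" and dg_SL2: "t \<noteq> 0 \<Longrightarrow> dg t \<in> SL2"
  by (simp_all add: mat2_mem_SL2)

lemma dg_up: "t \<noteq> 0 \<Longrightarrow> dg t ** up z = up (t\<^sup>2 * z) ** dg t"
  by (simp add: mat2_mult mat2_inj power2_eq_square)

section \<open>Limits along one-parameter subgroups\<close>

context sl2_variety
begin

lemma laurent_expansion:
  assumes x: "x \<in> pts X" and v: "v \<in> coords X"
  shows "\<exists>P M. \<forall>t z. t \<noteq> 0 \<longrightarrow> act X (dg t ** up z) x v * t ^ M = poly (poly P [:t:]) z"
proof -
  let ?A = "{F :: complex \<times> complex \<Rightarrow> complex.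
     \<exists>P M. \<forall>t z. t \<noteq> 0 \<longrightarrow> F (t, z) * t ^ M = poly (poly P [:t:]) z}"
  interpret A: function_algebra "principal {(t, z). t \<noteq> 0}" ?A by (rule function_algebra_laurent)
  have t: "fst \<in> ?A"
    by (rule CollectI, rule exI[of _ "[:0, 1:]"], rule exI[of _ 0]) simp
  have z: "snd \<in> ?A"
    by (rule CollectI, rule exI[of _ "[:[:0, 1:]:]"], rule exI[of _ 0]) simp
  have i: "(\<lambda>y. 1 / fst y) \<in> ?A"
    by (rule CollectI, rule exI[of _ 1], rule exI[of _ 1]) simp
  have "(\<lambda>y. act X (dg (fst y) ** up (snd y)) x v) \<in> ?A"
  proof (rule act_in_algebra[OF function_algebra_laurent])
    show "eventually (\<lambda>y. dg (fst y) ** up (snd y) \<in> SL2 \<and> x \<in> pts X) (principal {(t, z). t \<noteq> 0})"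
      using x by (auto simp: eventually_principal intro!: SL2_mult up_SL2 dg_SL2)
    show "(\<lambda>y. (dg (fst y) ** up (snd y)) $ i $ j) \<in> ?A" for i j
      by (intro mult_entry_in[OF function_algebra_laurent] mat2_entry_in A.const t z i)
  qed (use v A.const in auto)
  then show ?thesis by simp
qed

lemma act_polynomial:
  assumes x: "x \<in> pts X" and v: "v \<in> coords X"
    and S: "\<And>s. mat2 (poly a s) (poly b s) (poly c s) (poly d s) \<in> SL2"
  shows "\<exists>p. \<forall>s. act X (mat2 (poly a s) (poly b s) (poly c s) (poly d s)) x v = poly p s"
proof -
  let ?A = "{F :: complex \<Rightarrow> complex. \<exists>p. \<forall>t\<in>UNIV. F t = poly p (id t)}"
  interpret A: function_algebra "principal UNIV" ?A by (rule function_algebra_poly)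
  have p: "poly p \<in> ?A" for p by auto
  have "(\<lambda>s. act X (mat2 (poly a s) (poly b s) (poly c s) (poly d s)) x v) \<in> ?A"
    by (rule act_in_algebra[OF function_algebra_poly _ mat2_entry_in[OF p p p p] A.const v]) (use x S in simp)
  then show ?thesis by simp
qed

lemma up_polynomial: "x \<in> pts X \<Longrightarrow> v \<in> coords X \<Longrightarrow> \<exists>p. \<forall>z. act X (up z) x v = poly p z"
  using act_polynomial[of x v 1 "[:0, 1:]" 0 1] up_SL2 by simp

lemma lo_polynomial: "x \<in> pts X \<Longrightarrow> v \<in> coords X \<Longrightarrow> \<exists>p. \<forall>z. act X (lo z) x v = poly p z"
  using act_polynomial[of x v 1 0 "[:0, 1:]" 1] lo_SL2 by simp

text \<open>A point fixed by a Borel subgroup gives a map from the projective line to an affine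
  variety, which is constant. Concretely, the coordinates along \<open>lo s\<close> are polynomials
  both in s and in 1/s.\<close>

lemma group_fixedI:
  assumes x: "x \<in> pts X" and T: "torus_fixed X x" and U: "\<And>z. act X (up z) x = x"
  shows "group_fixed X x"
proof -
  have L: "act X (lo z) x = x" for z
  proof (rule pts_eqI)
    show "act X (lo z) x \<in> pts X" using x act_pts lo_SL2 by blast
    fix v assume v: "v \<in> coords X"
    let ?w = "mat2 0 (- 1) 1 0"
    have w: "?w \<in> SL2" by (simp add: mat2_mem_SL2)
    obtain p where p: "\<And>z. act X (lo z) x v = poly p z" using lo_polynomial[OF x v] by blast
    obtain q where q: "\<And>z. act X (up z) (act X ?w x) v = poly q z"
      using up_polynomial[OF act_pts[OF w x] v] by blast
    have "poly p s = poly q (1 / s)" if s: "s \<noteq> 0" for s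
    proof -
      \<comment> \<open>The Bruhat decomposition of \<open>lo s\<close>: its two right-hand factors
        fix the point, and what remains involves only 1/s.\<close>
      have "lo s = up (1 / s) ** (?w ** (dg s ** up (1 / s)))"
        using s by (simp add: mat2_mult mat2_inj)
      then have "act X (lo s) x = act X (up (1 / s)) (act X ?w (act X (dg s) (act X (up (1 / s)) x)))"
        using x s by (simp add: act_mult SL2_mult up_SL2 dg_SL2 w act_pts)
      also have "\<dots> = act X (up (1 / s)) (act X ?w x)"
        using T s U by (simp add: torus_fixed_def)
      finally show ?thesis using p q by metis
    qed
    then have "poly p z = poly p 0" by (rule poly_eq_poly_inverse)
    then have "act X (lo z) x v = act X (lo 0) x v" using p by simp
    also have "lo 0 = mat 1" by (simp add: mat_1_mk)
    finally show "act X (lo z) x v = x v" using act_one[OF x] by simp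
  qed (fact x)
  have a: "act X g x = x" if g: "g \<in> SL2" and a0: "g $ 1 $ 1 \<noteq> 0" for g
  proof -
    let ?a = "g $ 1 $ 1"
    have "g = lo (g $ 2 $ 1 / ?a) ** (dg ?a ** up (g $ 1 $ 2 / ?a))"
      using g a0 by (auto simp: matrix2_eq_iff mult_entry mem_SL2 field_simps)
    then have "act X g x = act X (lo (g $ 2 $ 1 / ?a)) (act X (dg ?a) (act X (up (g $ 1 $ 2 / ?a)) x))"
      using x a0 by (metis act_mult SL2_mult up_SL2 dg_SL2 lo_SL2 act_pts)
    then show ?thesis using L U T a0 by (simp add: torus_fixed_def)
  qed
  show ?thesis
    unfolding group_fixed_def
  proof
    fix g assume g: "g \<in> SL2"
    show "act X g x = x"
    proof (cases "g $ 1 $ 1 = 0")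
      case True
      \<comment> \<open>Right multiplication by \<open>lo 1\<close> adds the second column to the
        first, so the corner entry becomes nonzero.\<close>
      let ?h = "g ** lo 1"
      have "?h $ 1 $ 1 \<noteq> 0" using g True by (auto simp: mult_entry mem_SL2)
      then have "act X ?h x = x" using a[of ?h] SL2_mult[OF g lo_SL2] by blast
      then show ?thesis using act_mult[OF g lo_SL2 x] L by simp
    qed (use a g in blast)
  qed
qed

text \<open>The condition on the entries says that \<open>w\<close> normalizes the diagonal
  torus.\<close>

lemma torus_fixed_act:
  assumes x: "x \<in> pts X" and T: "torus_fixed X x" and wS: "w \<in> SL2"
    and w: "w $ 1 $ 2 = 0 \<and> w $ 2 $ 1 = 0 \<or> w $ 1 $ 1 = 0 \<and> w $ 2 $ 2 = 0"
  shows "torus_fixed X (act X w x)"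
  unfolding torus_fixed_def
proof (intro allI impI)
  fix t :: complex assume t: "t \<noteq> 0"
  have "dg t ** w = w ** dg t \<or> dg t ** w = w ** dg (1 / t)"
    using w by (auto simp: matrix2_eq_iff mult_entry)
  then have "\<exists>s. s \<noteq> 0 \<and> dg t ** w = w ** dg s"
  proof
    assume "dg t ** w = w ** dg t"
    then show ?thesis using t by (intro exI[of _ t] conjI)
  next
    assume "dg t ** w = w ** dg (1 / t)"
    then show ?thesis using t by (intro exI[of _ "1 / t"] conjI) simp_all
  qed
  then obtain s where s: "s \<noteq> 0" "dg t ** w = w ** dg s" by (elim exE conjE)
  have "act X (dg t) (act X w x) = act X w (act X (dg s) x)"
    using act_mult[OF dg_SL2[OF t] wS x] act_mult[OF wS dg_SL2[OF s(1)] x] s(2) by simp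
  then show "act X (dg t) (act X w x) = act X w x" using T s by (simp add: torus_fixed_def)
qed

lemma group_fixed_act:
  assumes x: "x \<in> pts X" and g: "g \<in> SL2" and "group_fixed X (act X g x)"
  shows "group_fixed X x"
proof -
  have "x = act X g x" using assms act_inv[OF g x] inv2_SL2[OF g] unfolding group_fixed_def by metis
  then show ?thesis using assms(3) by simp
qed

lemma limit_exists_act:
  assumes x: "x \<in> pts X" and g: "g \<in> SL2" "h \<in> SL2"
  shows "limit_exists X (act X g x) h \<longleftrightarrow> limit_exists X x (h ** g)"
proof -
  have "act X (dg t ** h) (act X g x) = act X (dg t ** (h ** g)) x" if "t \<noteq> 0" for t
    using act_mult[OF SL2_mult[OF dg_SL2[OF that] g(2)] g(1) x] by (simp add: matrix_mul_assoc)
  then show ?thesis unfolding limit_exists_def by simp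
qed

text \<open>Proportional first rows make \<open>h' ** inv2 h\<close> lower triangular, and
  conjugating a lower triangular matrix by \<open>dg t\<close> produces no positive power of t. So
  the direction is a point of the projective line.\<close>

lemma limit_exists_row:
  assumes x: "x \<in> pts X" and h: "h \<in> SL2" "h' \<in> SL2"
    and row: "h $ 1 $ 1 * h' $ 1 $ 2 = h $ 1 $ 2 * h' $ 1 $ 1"
    and lim: "limit_exists X x h"
  shows "limit_exists X x h'"
  unfolding limit_exists_def
proof
  fix v assume v: "v \<in> coords X"
  let ?A = "{F :: complex \<Rightarrow> complex. \<exists>p. \<forall>t\<in>{t. t \<noteq> 0}. F t = poly p (1 / t)}"
  interpret A: function_algebra "principal {t. t \<noteq> 0}" ?A by (rule function_algebra_poly)
  define l where "l = h' ** inv2 h"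
  have lS: "l \<in> SL2" unfolding l_def using h by (intro SL2_mult inv2_SL2)
  have lh: "h' = l ** h"
    using inv2_mult(1)[OF h(1)] by (simp add: l_def flip: matrix_mul_assoc)
  have l12: "l $ 1 $ 2 = 0"
    using row by (simp add: l_def inv2_def mult_entry algebra_simps)
  let ?k = "\<lambda>t. mat2 (l $ 1 $ 1) 0 (l $ 2 $ 1 * (1 / t) * (1 / t)) (l $ 2 $ 2)"
  have k: "?k t \<in> SL2" "dg t ** h' = ?k t ** (dg t ** h)" if t: "t \<noteq> 0" for t
  proof -
    show "?k t \<in> SL2" using lS l12 by (simp add: mem_SL2)
    have "dg t ** l = ?k t ** dg t" using t l12 by (simp add: matrix2_eq_iff mult_entry)
    then show "dg t ** h' = ?k t ** (dg t ** h)" by (simp add: lh matrix_mul_assoc)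
  qed
  have it: "(\<lambda>t. 1 / t) \<in> ?A" by (auto intro!: exI[of _ "[:0, 1:]"])
  have "(\<lambda>t. act X (?k t) (act X (dg t ** h) x) v) \<in> ?A"
  proof (rule act_in_algebra[OF function_algebra_poly])
    show "eventually (\<lambda>t. ?k t \<in> SL2 \<and> act X (dg t ** h) x \<in> pts X) (principal {t. t \<noteq> 0})"
      using k(1) x h by (auto simp: eventually_principal intro!: act_pts SL2_mult dg_SL2)
    show "(\<lambda>t. ?k t $ i $ j) \<in> ?A" for i j
      by (intro mat2_entry_in A.const A.mult it)
    show "(\<lambda>t. act X (dg t ** h) x v) \<in> ?A" if "v \<in> coords X" for v
      using lim that unfolding limit_exists_def by simp
  qed (fact v)
  moreover have "act X (?k t) (act X (dg t ** h) x) = act X (dg t ** h') x" if "t \<noteq> 0" for t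
    using k[OF that] act_mult[OF k(1)[OF that] SL2_mult[OF dg_SL2[OF that] h(1)] x] by simp
  ultimately show "\<exists>p. \<forall>t. t \<noteq> 0 \<longrightarrow> act X (dg t ** h') x v = poly p (1 / t)" by simp
qed

lemma group_fixed_limit:
  assumes "group_fixed X x" "h \<in> SL2"
  shows "limit_exists X x h"
  unfolding limit_exists_def
proof
  fix v assume "v \<in> coords X"
  have "act X (dg t ** h) x v = poly [:x v:] (1 / t)" if "t \<noteq> 0" for t
    using assms that SL2_mult[OF dg_SL2 assms(2)] by (simp add: group_fixed_def)
  then show "\<exists>p. \<forall>t. t \<noteq> 0 \<longrightarrow> act X (dg t ** h) x v = poly p (1 / t)" by blast
qed

text \<open>The first two limits are those for t tending to infinity and to 0, since
  \<open>mat2 0 1 (- 1) 0\<close> inverts the torus; hence the torus orbit is constant. Now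
  \<open>dg t\<close> moves \<open>up s\<close> applied to \<open>x\<close> to
  \<open>up (t\<^sup>2 * s)\<close> applied to \<open>x\<close>, polynomial in t, and the third
  limit makes it polynomial in 1/t as well.\<close>

lemma group_fixed_if_limits:
  assumes x: "x \<in> pts X" and s: "s \<noteq> 0"
    and lim: "limit_exists X x (mat 1)" "limit_exists X x (mat2 0 1 (- 1) 0)" "limit_exists X x (up s)"
  shows "group_fixed X x"
proof -
  let ?w = "mat2 0 1 (- 1) 0" and ?w' = "mat2 0 (- 1) 1 0"
  have w: "?w \<in> SL2" "?w' \<in> SL2" by (simp_all add: mat2_mem_SL2)
  have T: "act X (dg t) x = x" if t: "t \<noteq> 0" for t
  proof (rule pts_eqI)
    fix v assume v: "v \<in> coords X"
    obtain p where p: "\<And>t. t \<noteq> 0 \<Longrightarrow> act X (dg t) x v = poly p (1 / t)"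
      using lim(1) v unfolding limit_exists_def by auto
    let ?A = "{F :: complex \<Rightarrow> complex. \<exists>p. \<forall>t\<in>{t. t \<noteq> 0}. F t = poly p (1 / t)}"
    interpret A: function_algebra "principal {t. t \<noteq> 0}" ?A by (rule function_algebra_poly)
    have "(\<lambda>t. act X ?w' (act X (dg t ** ?w) x) v) \<in> ?A"
    proof (rule act_in_algebra[OF function_algebra_poly])
      show "eventually (\<lambda>t. ?w' \<in> SL2 \<and> act X (dg t ** ?w) x \<in> pts X) (principal {t. t \<noteq> 0})"
        using w x by (auto simp: eventually_principal intro!: act_pts SL2_mult dg_SL2)
      show "(\<lambda>t. act X (dg t ** ?w) x v) \<in> ?A" if "v \<in> coords X" for v
        using lim(2) that unfolding limit_exists_def by simp
    qed (use v A.const in auto)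
    then obtain q where q: "\<And>t. t \<noteq> 0 \<Longrightarrow> act X ?w' (act X (dg t ** ?w) x) v = poly q (1 / t)" by auto
    have "poly p t = poly q (1 / t)" if t: "t \<noteq> 0" for t
    proof -
      have "act X ?w' (act X (dg t ** ?w) x) = act X (?w' ** (dg t ** ?w)) x"
        using t x w by (simp add: act_mult SL2_mult dg_SL2)
      also have "?w' ** (dg t ** ?w) = dg (1 / t)" using t by (simp add: mat2_mult mat2_inj)
      finally show ?thesis using p[of "1 / t"] q[OF t] t by simp
    qed
    then have const: "poly p u = poly p 0" for u by (rule poly_eq_poly_inverse)
    have "dg 1 = mat 1" by (simp add: mat_1_mk)
    then have "act X (dg t) x v = act X (mat 1) x v"
      using p[OF t] p[of 1] const[of "1 / t"] const[of 1] by simp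
    then show "act X (dg t) x v = x v" using act_one[OF x] by simp
  qed (use act_pts dg_SL2 t x in auto)
  have "act X (up z) x = x" for z
  proof (rule pts_eqI)
    fix v assume v: "v \<in> coords X"
    obtain p where p: "\<And>z. act X (up z) x v = poly p z" using up_polynomial[OF x v] by blast
    obtain q where q: "\<And>t. t \<noteq> 0 \<Longrightarrow> act X (dg t ** up s) x v = poly q (1 / t)"
      using lim(3) v unfolding limit_exists_def by auto
    have "poly (pcompose p (monom s 2)) t = poly q (1 / t)" if t: "t \<noteq> 0" for t
    proof -
      have "act X (dg t ** up s) x = act X (up (t\<^sup>2 * s)) x"
        using x t T[OF t] by (simp add: dg_up act_mult up_SL2 dg_SL2)
      then show ?thesis using p q[OF t] by (simp add: poly_pcompose poly_monom mult.commute)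
    qed
    then have const: "poly (pcompose p (monom s 2)) u = poly (pcompose p (monom s 2)) 0" for u
      by (rule poly_eq_poly_inverse)
    \<comment> \<open>Every \<open>z\<close> has the form s t^2.\<close>
    have "poly p z = poly p 0"
      using const[of "csqrt (z / s)"] s by (simp add: poly_pcompose poly_monom)
    moreover have "up 0 = mat 1" by (simp add: mat_1_mk)
    ultimately show "act X (up z) x v = x v" using p[of 0] p[of z] act_one[OF x] by simp
  qed (use act_pts up_SL2 x in auto)
  moreover have "torus_fixed X x" using T by (simp add: torus_fixed_def)
  ultimately show ?thesis using x by (intro group_fixedI)
qed

text \<open>Limits in two directions make a point fixed by a torus, and a limit in a third direction then
  makes it fixed by the whole group.\<close>

lemma two_limit_directions:
  assumes x: "x \<in> pts X" and nf: "\<not> group_fixed X x"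
  obtains h1 h2 where "h1 \<in> SL2" "h2 \<in> SL2"
    "\<And>h. h \<in> SL2 \<Longrightarrow> limit_exists X x h \<Longrightarrow>
       h1 $ 1 $ 1 * h $ 1 $ 2 = h1 $ 1 $ 2 * h $ 1 $ 1 \<or> h2 $ 1 $ 1 * h $ 1 $ 2 = h2 $ 1 $ 2 * h $ 1 $ 1"
proof -
  let ?r = "\<lambda>h h' :: complex^2^2. h $ 1 $ 1 * h' $ 1 $ 2 = h $ 1 $ 2 * h' $ 1 $ 1"
  show ?thesis
  proof (cases "\<exists>h1 h2. h1 \<in> SL2 \<and> h2 \<in> SL2 \<and> limit_exists X x h1 \<and> limit_exists X x h2 \<and> \<not> ?r h1 h2")
    case False
    show ?thesis
    proof (cases "\<exists>h1\<in>SL2. limit_exists X x h1")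
      case True
      then obtain h1 where "h1 \<in> SL2" "limit_exists X x h1" by blast
      then show ?thesis using False that[of h1 h1] by blast
    next
      case no: False
      then show ?thesis using that[OF SL2_one SL2_one] by blast
    qed
  next
    case True
    then obtain h1 h2 where h: "h1 \<in> SL2" "h2 \<in> SL2" "limit_exists X x h1" "limit_exists X x h2"
      and r12: "\<not> ?r h1 h2" by blast
    define D where "D = h1 $ 1 $ 1 * h2 $ 1 $ 2 - h1 $ 1 $ 2 * h2 $ 1 $ 1"
    have D0: "D \<noteq> 0" using r12 by (simp add: D_def)
    \<comment> \<open>The rows of \<open>k\<close> are the two directions, the second divided by
      \<open>D\<close> to give determinant 1. Thus they become the coordinate directions for
      \<open>x'\<close>.\<close>
    define k where "k = mat2 (h1 $ 1 $ 1) (h1 $ 1 $ 2) (h2 $ 1 $ 1 / D) (h2 $ 1 $ 2 / D)"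
    have k: "k \<in> SL2"
      using D0 by (simp add: k_def mat2_mem_SL2 diff_divide_distrib[symmetric]) (simp add: D_def)
    define x' where "x' = act X k x"
    have x': "x' \<in> pts X" using act_pts k x by (simp add: x'_def)
    let ?w = "mat2 0 1 (- 1) 0"
    have w: "?w \<in> SL2" by (simp add: mat2_mem_SL2)
    have "limit_exists X x' (mat 1)"
      unfolding x'_def limit_exists_act[OF x k SL2_one]
      by (rule limit_exists_row[OF x h(1) SL2_mult[OF SL2_one k] _ h(3)]) (simp add: k_def)
    moreover have "limit_exists X x' ?w"
      unfolding x'_def limit_exists_act[OF x k w]
      by (rule limit_exists_row[OF x h(2) SL2_mult[OF w k] _ h(4)]) (simp add: k_def mult_entry)
    ultimately have third: "\<not> limit_exists X x' (up s)" if "s \<noteq> 0" for s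
      using group_fixed_if_limits[OF x' that] group_fixed_act[OF x k] nf x'_def by blast
    have "?r h1 g \<or> ?r h2 g" if g: "g \<in> SL2" "limit_exists X x g" for g
    proof (rule ccontr)
      assume neg: "\<not> (?r h1 g \<or> ?r h2 g)"
      define g' where "g' = g ** inv2 k"
      have g': "g' \<in> SL2" using g k by (simp add: g'_def SL2_mult inv2_SL2)
      have gk: "g' ** k = g"
        using inv2_mult(1)[OF k] by (simp add: g'_def flip: matrix_mul_assoc)
      have e1: "g' $ 1 $ 1 = (g $ 1 $ 1 * h2 $ 1 $ 2 - g $ 1 $ 2 * h2 $ 1 $ 1) / D"
        by (simp add: g'_def inv2_def k_def mult_entry diff_divide_distrib)
      have e2: "g' $ 1 $ 2 = g $ 1 $ 2 * h1 $ 1 $ 1 - g $ 1 $ 1 * h1 $ 1 $ 2"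
        by (simp add: g'_def inv2_def k_def mult_entry)
      have p: "g' $ 1 $ 1 \<noteq> 0" using neg D0 unfolding e1 by (simp add: mult.commute) metis
      have q: "g' $ 1 $ 2 \<noteq> 0" using neg unfolding e2 by (simp add: mult.commute)
      \<comment> \<open>Both entries of the first row of \<open>g'\<close> are nonzero, so its
        direction is that of some \<open>up s\<close> with s nonzero, a third direction.\<close>
      have "limit_exists X x' g'"
        using g(2) limit_exists_act[OF x k g'] by (simp add: x'_def gk)
      then have "limit_exists X x' (up (g' $ 1 $ 2 / g' $ 1 $ 1))"
        by (rule limit_exists_row[OF x' g' up_SL2, rotated]) (simp add: p)
      then show False using third[of "g' $ 1 $ 2 / g' $ 1 $ 1"] p q by simp
    qed
    then show ?thesis using that h by blast
  qed
qed

end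

section \<open>The Hilbert-Mumford criterion over a valuation ring\<close>

context valuation_algebra
begin

text \<open>This compares the valuations of arbitrary functions; neither of them has to lie in
  \<open>A\<close>.\<close>

definition divides where
  "divides f h \<longleftrightarrow> (\<exists>q\<in>A. eventually (\<lambda>y. h y = f y * q y) U)"

lemma divides_refl: "divides f f"
  unfolding divides_def by (rule bexI[OF _ const[of 1]]) simp

lemma divides_trans:
  assumes "divides f g" "divides g h"
  shows "divides f h"
proof -
  obtain p q where p: "p \<in> A" "eventually (\<lambda>y. g y = f y * p y) U"
    and q: "q \<in> A" "eventually (\<lambda>y. h y = g y * q y) U"
    using assms unfolding divides_def by blast
  have "eventually (\<lambda>y. h y = f y * (p y * q y)) U"
    using p(2) q(2) by eventually_elim simp
  then show ?thesis unfolding divides_def using mult[OF p(1) q(1)] by (rule bexI)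
qed

lemma divides_minus: "divides f h \<Longrightarrow> divides f (\<lambda>y. - h y)"
  and minus_divides: "divides f h \<Longrightarrow> divides (\<lambda>y. - f y) h"
proof -
  assume "divides f h"
  then obtain q where q: "q \<in> A" "eventually (\<lambda>y. h y = f y * q y) U" unfolding divides_def by blast
  have "eventually (\<lambda>y. - h y = f y * - q y) U"
    using q(2) by eventually_elim simp
  then show "divides f (\<lambda>y. - h y)"
    unfolding divides_def by (rule bexI[OF _ uminus[OF q(1)]])
  have "eventually (\<lambda>y. h y = - f y * - q y) U"
    using q(2) by eventually_elim simp
  then show "divides (\<lambda>y. - f y) h"
    unfolding divides_def by (rule bexI[OF _ uminus[OF q(1)]])
qed

lemma divides_total: "divides f h \<or> divides h f"
proof -
  have zero: "divides k l" if "eventually (\<lambda>y. l y = 0) U" for k l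
    unfolding divides_def by (rule bexI[OF _ const[of 0]]) (use that in simp)
  show ?thesis
  proof (cases "eventually (\<lambda>y. f y = 0) U \<or> eventually (\<lambda>y. h y = 0) U")
    case False
    then have nz: "eventually (\<lambda>y. f y \<noteq> 0) U" "eventually (\<lambda>y. h y \<noteq> 0) U"
      by (auto intro: nonzero)
    from val[of "\<lambda>y. h y * inverse (f y)"] show ?thesis
    proof
      assume *: "(\<lambda>y. h y * inverse (f y)) \<in> A"
      have "eventually (\<lambda>y. h y = f y * (h y * inverse (f y))) U"
        using nz(1) by eventually_elim simp
      then have "divides f h" unfolding divides_def by (rule bexI[OF _ *])
      then show ?thesis ..
    next
      assume *: "(\<lambda>y. inverse (h y * inverse (f y))) \<in> A"
      have "eventually (\<lambda>y. f y = h y * inverse (h y * inverse (f y))) U"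
        using nz by eventually_elim simp
      then have "divides h f" unfolding divides_def by (rule bexI[OF _ *])
      then show ?thesis ..
    qed
  qed (use zero in blast)
qed

lemma residue_poly_at:
  assumes f: "f \<in> A" and a: "(\<lambda>y. f y - a) \<in> maxid"
    and p: "(\<lambda>y. poly p (f y)) \<in> maxid"
  shows "poly p a = 0"
proof -
  have "poly p x - poly p a = (x - a) * poly (synthetic_div p a) x" for x
    using arg_cong[OF synthetic_div_correct'[of a p], of "\<lambda>q. poly q x"] by (simp add: algebra_simps)
  then have "(\<lambda>y. poly p (f y) - poly p a) \<in> maxid"
    using maxid_mult[OF a poly[OF f]] by simp
  from maxid_diff[OF p this] show ?thesis using maxid_const by simp
qed

text \<open>\<open>f\<close> is a root of p - p(f), which becomes monic over \<open>A\<close> after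
  division by the constant leading coefficient.\<close>

lemma poly_in_imp_in:
  assumes f: "(\<lambda>y. poly p (f y)) \<in> A" and p: "degree p > 0"
  shows "f \<in> A"
proof -
  let ?c = "inverse (lead_coeff p)"
  let ?q = "\<lambda>y. smult ?c (p - [:poly p (f y):])"
  have c0: "?c \<noteq> 0" using p by auto
  have deg: "degree (p - [:poly p (f y):]) = degree p" for y
  proof -
    have "p - [:poly p (f y):] = p + [:- poly p (f y):]" unfolding diff_conv_add_uminus by simp
    then show ?thesis using p by (simp only: degree_add_eq_left degree_pCons_0)
  qed
  show ?thesis
  proof (rule integrally_closed[where p = ?q and n = "degree p"])
    show "(\<lambda>y. coeff (?q y) i) \<in> A" for i
      by (cases i) (auto intro!: mult diff const f)
    show "degree (?q y) = degree p" for y using c0 deg by simp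
    show "lead_coeff (?q y) = 1" for y
      using c0 deg[of y] p by (cases "degree p") auto
  qed simp
qed

end

text \<open>Divisibility is total, so one of the four entries divides all of them. Signed swaps of
  rows and columns, which have determinant 1, bring it to the corner; they are the same for all
  \<open>y\<close>.\<close>

lemma pivot:
  fixes A :: "('y \<Rightarrow> complex) set"
  assumes "valuation_algebra U A"
  obtains w1 w2 where "w1 = mat 1 \<or> w1 = mat2 0 1 (- 1) 0" "w2 = mat 1 \<or> w2 = mat2 0 1 (- 1) 0"
    "\<And>i j. valuation_algebra.divides U A (\<lambda>y. (w1 ** g y ** w2) $ 1 $ 1) (\<lambda>y. (w1 ** g y ** w2) $ i $ j)"
proof -
  interpret valuation_algebra U A by fact
  note result = that
  let ?J = "mat2 0 1 (- 1) 0"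
  define a b c d where "a = (\<lambda>y. g y $ 1 $ 1)" and "b = (\<lambda>y. g y $ 1 $ 2)"
    and "c = (\<lambda>y. g y $ 2 $ 1)" and "d = (\<lambda>y. g y $ 2 $ 2)"
  note defs = a_def b_def c_def d_def
  have two: "\<exists>f\<in>{f1, f2}. divides f f1 \<and> divides f f2" for f1 f2
    using divides_total[of f1 f2] divides_refl by blast
  obtain f1 f2 where f: "f1 \<in> {a, b}" "f2 \<in> {c, d}" "divides f1 a" "divides f1 b" "divides f2 c" "divides f2 d"
    using two[of a b] two[of c d] by blast
  obtain f where "f \<in> {f1, f2}" "divides f f1" "divides f f2" using two[of f1 f2] by blast
  then have F: "f = a \<or> f = b \<or> f = c \<or> f = d" "divides f a" "divides f b" "divides f c" "divides f d"
    using f divides_trans by blast+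
  have F': "divides f (\<lambda>y. - a y)" "divides f (\<lambda>y. - b y)" "divides f (\<lambda>y. - c y)" "divides f (\<lambda>y. - d y)"
    using F by (auto intro: divides_minus)
  have *: ?thesis if w: "w1 = mat 1 \<or> w1 = ?J" "w2 = mat 1 \<or> w2 = ?J"
    and m: "\<And>y. w1 ** g y ** w2 = mat2 (p y) (q y) (r y) (s y)"
    and "divides p p" "divides p q" "divides p r" "divides p s" for w1 w2 p q r s
  proof (rule result[OF w])
    fix i j :: 2
    show "divides (\<lambda>y. (w1 ** g y ** w2) $ 1 $ 1) (\<lambda>y. (w1 ** g y ** w2) $ i $ j)"
      unfolding m using \<open>divides p p\<close> \<open>divides p q\<close> \<open>divides p r\<close> \<open>divides p s\<close>
        exhaust_2[of i] exhaust_2[of j] by auto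
  qed
  from F(1) show ?thesis
  proof (elim disjE)
    assume "f = a"
    then show ?thesis
      by (intro *[of "mat 1" "mat 1" a b c d]) (use F in \<open>auto simp: defs mat2_collapse\<close>)
  next
    assume "f = b"
    then show ?thesis
      by (intro *[of "mat 1" ?J "\<lambda>y. - b y" a "\<lambda>y. - d y" c])
        (use F F' in \<open>auto simp: defs matrix2_eq_iff mult_entry intro: minus_divides\<close>)
  next
    assume "f = c"
    then show ?thesis
      by (intro *[of ?J "mat 1" c d "\<lambda>y. - a y" "\<lambda>y. - b y"])
        (use F F' in \<open>auto simp: defs matrix2_eq_iff mult_entry\<close>)
  next
    assume "f = d"
    then show ?thesis
      by (intro *[of ?J ?J "\<lambda>y. - d y" c b "\<lambda>y. - a y"])
        (use F F' in \<open>auto simp: defs matrix2_eq_iff mult_entry intro: minus_divides\<close>)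
  qed
qed

text \<open>This replaces the Cartan decomposition of the usual proof of the Hilbert-Mumford criterion.\<close>

lemma pivot_decomposition:
  fixes A :: "('y \<Rightarrow> complex) set" and g :: "'y \<Rightarrow> complex^2^2"
  assumes "valuation_algebra U A" and g: "eventually (\<lambda>y. g y \<in> SL2) U"
    and piv: "\<And>i j. valuation_algebra.divides U A (\<lambda>y. g y $ 1 $ 1) (\<lambda>y. g y $ i $ j)"
  obtains b c where "b \<in> A" "c \<in> A"
    "eventually (\<lambda>y. g y $ 1 $ 1 \<noteq> 0 \<and> g y = lo (c y) ** dg (g y $ 1 $ 1) ** up (b y)) U"
proof -
  interpret valuation_algebra U A by fact
  let ?a = "\<lambda>y. g y $ 1 $ 1"
  obtain b where b: "b \<in> A" "eventually (\<lambda>y. g y $ 1 $ 2 = ?a y * b y) U"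
    using piv[of 1 2] unfolding divides_def by blast
  obtain c where c: "c \<in> A" "eventually (\<lambda>y. g y $ 2 $ 1 = ?a y * c y) U"
    using piv[of 2 1] unfolding divides_def by blast
  have nz: "eventually (\<lambda>y. ?a y \<noteq> 0) U"
  proof (rule nonzero, rule notI)
    assume "eventually (\<lambda>y. ?a y = 0) U"
    then have "eventually (\<lambda>_. False) U"
      using g b(2) by eventually_elim (simp add: mem_SL2)
    then show False using not_bot by (simp add: eventually_False)
  qed
  have "eventually (\<lambda>y. ?a y \<noteq> 0 \<and> g y = lo (c y) ** dg (?a y) ** up (b y)) U"
    using g b(2) c(2) nz
  proof eventually_elim
    case (elim y)
    have "g y $ 2 $ 2 = (1 + g y $ 1 $ 2 * g y $ 2 $ 1) / ?a y"
      using elim(1,4) by (simp add: mem_SL2 field_simps)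
    also have "\<dots> = c y * ?a y * b y + 1 / ?a y"
      using elim by (simp add: field_simps)
    finally show ?case
      using elim by (simp add: matrix2_eq_iff mult_entry mult.commute)
  qed
  then show ?thesis by (rule that[OF b(1) c(1)])
qed

context sl2_variety
begin

text \<open>Write P_n(z) t^(n-M) for the terms of a coordinate of \<open>dg t ** up z\<close>
  applied to \<open>x\<close>. With a = g_11 outside the ring, boundedness of a^(n-M) P_n(b) forces
  P_n(b) into the maximal ideal for n > M. At the residue z of \<open>b\<close> these terms vanish,
  so no positive power of t is left.\<close>

lemma valuation_limit:
  fixes A :: "('y \<Rightarrow> complex) set" and g :: "'y \<Rightarrow> complex^2^2"
  assumes "valuation_algebra U A" and x: "x \<in> pts X"
    and g: "eventually (\<lambda>y. g y \<in> SL2) U"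
    and gx: "\<And>v. v \<in> coords X \<Longrightarrow> (\<lambda>y. act X (g y) x v) \<in> A"
    and piv: "\<And>i j. valuation_algebra.divides U A (\<lambda>y. g y $ 1 $ 1) (\<lambda>y. g y $ i $ j)"
    and a: "(\<lambda>y. g y $ 1 $ 1) \<notin> A"
  obtains z where "limit_exists X x (up z)"
proof -
  interpret valuation_algebra U A by fact
  let ?a = "\<lambda>y. g y $ 1 $ 1"
  obtain b c where b: "b \<in> A" and c: "c \<in> A"
    and dec: "eventually (\<lambda>y. ?a y \<noteq> 0 \<and> g y = lo (c y) ** dg (?a y) ** up (b y)) U"
    using pivot_decomposition[OF assms(1) g piv] by blast
  \<comment> \<open>The factor \<open>lo (c y)\<close> lies over the ring and can be cancelled;
    multiplying by \<open>dg \<tau>\<close> for constant \<open>\<tau>\<close> prepares the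
    separation of the powers of a.\<close>
  have moved: "(\<lambda>y. act X (dg (\<tau> * ?a y) ** up (b y)) x v) \<in> A" if \<tau>: "\<tau> \<noteq> 0" and v: "v \<in> coords X" for \<tau> v
  proof -
    let ?k = "\<lambda>y. dg \<tau> ** lo (- c y)"
    have k: "?k y \<in> SL2" for y using \<tau> by (simp add: SL2_mult lo_SL2 dg_SL2)
    have "(\<lambda>y. act X (?k y) (act X (g y) x) v) \<in> A"
    proof (rule act_in_algebra[OF function_algebra_axioms])
      show "eventually (\<lambda>y. ?k y \<in> SL2 \<and> act X (g y) x \<in> pts X) U"
        using g by eventually_elim (use k x act_pts in auto)
      show "(\<lambda>y. ?k y $ i $ j) \<in> A" for i j
        by (intro mult_entry_in[OF function_algebra_axioms] mat2_entry_in const uminus c)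
    qed (use gx v in auto)
    moreover have "eventually (\<lambda>y. act X (?k y) (act X (g y) x) v = act X (dg (\<tau> * ?a y) ** up (b y)) x v) U"
      using g dec
    proof eventually_elim
      case (elim y)
      have "?k y ** g y = ?k y ** (lo (c y) ** dg (?a y) ** up (b y))" using elim(2) by simp
      also have "\<dots> = dg (\<tau> * ?a y) ** up (b y)"
        using \<tau> elim(2) by (simp add: mat2_mult mat2_inj field_simps)
      finally show ?case using act_mult[OF k[of y] elim(1) x] by simp
    qed
    ultimately show ?thesis by (rule cong)
  qed
  have "\<forall>v\<in>coords X. \<exists>PM. \<forall>t z. t \<noteq> 0 \<longrightarrow>
      act X (dg t ** up z) x v * t ^ snd PM = poly (poly (fst PM) [:t:]) z"
    using laurent_expansion[OF x] by simp
  from bchoice[OF this] obtain PM where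
    PM: "\<forall>v\<in>coords X. \<forall>t z. t \<noteq> 0 \<longrightarrow>
      act X (dg t ** up z) x v * t ^ snd (PM v) = poly (poly (fst (PM v)) [:t:]) z" by (elim exE)
  define P M where "P = (\<lambda>v. fst (PM v))" and "M = (\<lambda>v. snd (PM v))"
  have P: "act X (dg t ** up z) x v * t ^ M v = (\<Sum>n\<le>degree (P v). t ^ n * poly (coeff (P v) n) z)"
    if "v \<in> coords X" "t \<noteq> 0" for v t z
    using PM that by (simp add: P_def M_def poly_poly_const)
  have small: "(\<lambda>y. poly (coeff (P v) n) (b y)) \<in> maxid" if v: "v \<in> coords X" and n: "n > M v" for v n
  proof (cases "n \<le> degree (P v)")
    case True
    let ?w = "\<lambda>n y. ?a y ^ n / ?a y ^ M v * poly (coeff (P v) n) (b y)"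
    have wn: "?w n \<in> A"
    proof (rule coeffs_in_algebra[OF function_algebra_axioms _ True])
      fix \<tau> :: complex assume \<tau>: "\<tau> \<noteq> 0"
      have "(\<lambda>y. act X (dg (\<tau> * ?a y) ** up (b y)) x v * \<tau> ^ M v) \<in> A"
        by (intro mult const moved[OF \<tau> v])
      moreover have "eventually (\<lambda>y. act X (dg (\<tau> * ?a y) ** up (b y)) x v * \<tau> ^ M v
          = (\<Sum>n\<le>degree (P v). \<tau> ^ n * ?w n y)) U"
        using dec
      proof eventually_elim
        case (elim y)
        have "act X (dg (\<tau> * ?a y) ** up (b y)) x v * \<tau> ^ M v
            = act X (dg (\<tau> * ?a y) ** up (b y)) x v * (\<tau> * ?a y) ^ M v / ?a y ^ M v"
          using elim by (simp add: power_mult_distrib)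
        also have "\<dots> = (\<Sum>n\<le>degree (P v). \<tau> ^ n * ?w n y)"
          using P[OF v, of "\<tau> * ?a y" "b y"] \<tau> elim
          by (simp add: sum_divide_distrib power_mult_distrib mult_ac)
        finally show ?case .
      qed
      ultimately show "(\<lambda>y. \<Sum>n\<le>degree (P v). \<tau> ^ n * ?w n y) \<in> A" by (rule cong)
    qed
    have "(\<lambda>y. inverse (?a y) * (inverse (?a y) ^ (n - M v - 1) * ?w n y)) \<in> maxid"
      using inverse_in_maxid[OF a] by (intro maxid_mult mult[OF power[OF maxid_in] wn])
    moreover have "eventually (\<lambda>y. inverse (?a y) * (inverse (?a y) ^ (n - M v - 1) * ?w n y)
        = poly (coeff (P v) n) (b y)) U"
      using dec
    proof eventually_elim
      case (elim y)
      obtain k where k: "n = Suc (M v + k)" using n less_imp_Suc_add by blast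
      show ?case using elim by (simp add: k power_add field_simps)
    qed
    ultimately show ?thesis by (rule maxid_cong)
  next
    case False
    then show ?thesis using maxid_zero by (simp add: coeff_eq_0)
  qed
  \<comment> \<open>A nonzero polynomial among the P_n with n > M ensures that the residue of
    \<open>b\<close> is a constant. If all of them are zero, any \<open>z\<close> will do.\<close>
  obtain z where z: "\<And>v n. v \<in> coords X \<Longrightarrow> n > M v \<Longrightarrow> poly (coeff (P v) n) z = 0"
  proof (cases "\<exists>v\<in>coords X. \<exists>n>M v. coeff (P v) n \<noteq> 0")
    case True
    then obtain v n where v: "v \<in> coords X" "n > M v" "coeff (P v) n \<noteq> 0" by blast
    obtain z where "(\<lambda>y. b y - z) \<in> maxid"
      using residue_root[OF assms(1) b v(3) small[OF v(1,2)]] by blast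
    then show ?thesis using that residue_poly_at[OF b] small by blast
  next
    case False
    then show ?thesis using that[of 0] by auto
  qed
  have "limit_exists X x (up z)"
    unfolding limit_exists_def
  proof
    fix v assume v: "v \<in> coords X"
    \<comment> \<open>With the powers above \<open>M v\<close> gone, dividing by t^(M v) leaves a
      polynomial in 1/t.\<close>
    let ?p = "\<Sum>n\<le>M v. monom (poly (coeff (P v) n) z) (M v - n)"
    have "act X (dg t ** up z) x v = poly ?p (1 / t)" if t: "t \<noteq> 0" for t
    proof -
      have "act X (dg t ** up z) x v * t ^ M v = (\<Sum>n\<le>degree (P v). t ^ n * poly (coeff (P v) n) z)"
        by (rule P[OF v t])
      also have "\<dots> = (\<Sum>n\<le>max (degree (P v)) (M v). t ^ n * poly (coeff (P v) n) z)"
        by (rule sum.mono_neutral_left) (auto simp: coeff_eq_0)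
      also have "\<dots> = (\<Sum>n\<le>M v. t ^ n * poly (coeff (P v) n) z)"
        by (rule sum.mono_neutral_right) (auto simp: z[OF v])
      also have "\<dots> = poly ?p (1 / t) * t ^ M v"
        unfolding poly_sum poly_monom sum_distrib_right
        using t by (intro sum.cong) (auto simp: power_divide power_diff)
      finally show ?thesis using t by simp
    qed
    then show "\<exists>p. \<forall>t. t \<noteq> 0 \<longrightarrow> act X (dg t ** up z) x v = poly p (1 / t)" by blast
  qed
  then show ?thesis by (rule that)
qed

lemma pivot_act_in:
  fixes A :: "('y \<Rightarrow> complex) set"
  assumes "valuation_algebra U A" and x: "x \<in> pts X" and g: "eventually (\<lambda>y. g y \<in> SL2) U"
    and w: "w1 \<in> SL2" "w2 \<in> SL2"
    and gx: "\<And>v. v \<in> coords X \<Longrightarrow> (\<lambda>y. act X (g y) x v) \<in> A" and v: "v \<in> coords X"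
  shows "(\<lambda>y. act X (w1 ** g y ** w2) (act X (inv2 w2) x) v) \<in> A"
proof -
  interpret valuation_algebra U A by fact
  have "(\<lambda>y. act X w1 (act X (g y) x) v) \<in> A"
  proof (rule act_in_algebra[OF function_algebra_axioms])
    show "eventually (\<lambda>y. w1 \<in> SL2 \<and> act X (g y) x \<in> pts X) U"
      using g by eventually_elim (use w x act_pts in auto)
  qed (use gx v const in auto)
  moreover have "eventually (\<lambda>y. act X w1 (act X (g y) x) v
      = act X (w1 ** g y ** w2) (act X (inv2 w2) x) v) U"
    using g
  proof eventually_elim
    case (elim y)
    then show ?case
      using w x by (simp add: act_mult SL2_mult inv2_SL2 act_inv' act_pts)
  qed
  ultimately show ?thesis by (rule cong)
qed

text \<open>Without limits the pivot must lie in the ring by \<open>valuation_limit\<close>, and it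
  divides the other entries. In other words the orbit map is finite.\<close>

lemma entries_in_valuation_algebra:
  fixes A :: "('y \<Rightarrow> complex) set" and g :: "'y \<Rightarrow> complex^2^2"
  assumes "valuation_algebra U A" and x: "x \<in> pts X"
    and no_limit: "\<And>h. h \<in> SL2 \<Longrightarrow> \<not> limit_exists X x h"
    and g: "eventually (\<lambda>y. g y \<in> SL2) U"
    and gx: "\<And>v. v \<in> coords X \<Longrightarrow> (\<lambda>y. act X (g y) x v) \<in> A"
  shows "(\<lambda>y. g y $ i $ j) \<in> A"
proof -
  interpret valuation_algebra U A by fact
  obtain w1 w2 where w: "w1 = mat 1 \<or> w1 = mat2 0 1 (- 1) 0" "w2 = mat 1 \<or> w2 = mat2 0 1 (- 1) 0"
    and piv: "\<And>i j. divides (\<lambda>y. (w1 ** g y ** w2) $ 1 $ 1) (\<lambda>y. (w1 ** g y ** w2) $ i $ j)"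
    using pivot[OF assms(1), of g] by blast
  have wS: "w1 \<in> SL2" "w2 \<in> SL2" using w by (auto simp: SL2_one mat2_mem_SL2)
  let ?g = "\<lambda>y. w1 ** g y ** w2" and ?x = "act X (inv2 w2) x"
  have x': "?x \<in> pts X" using x wS by (simp add: act_pts inv2_SL2)
  have g': "eventually (\<lambda>y. ?g y \<in> SL2) U"
    using g by eventually_elim (simp add: SL2_mult wS)
  have a: "(\<lambda>y. ?g y $ 1 $ 1) \<in> A"
  proof (rule ccontr)
    assume "(\<lambda>y. ?g y $ 1 $ 1) \<notin> A"
    from valuation_limit[OF assms(1) x' g' pivot_act_in[OF assms(1) x g wS gx] piv this]
    obtain z where "limit_exists X ?x (up z)" by blast
    then show False
      using no_limit[OF SL2_mult[OF up_SL2 inv2_SL2[OF wS(2)]]] limit_exists_act[OF x inv2_SL2[OF wS(2)] up_SL2]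
      by blast
  qed
  have e: "(\<lambda>y. ?g y $ i $ j) \<in> A" for i j
  proof -
    obtain q where q: "q \<in> A" "eventually (\<lambda>y. ?g y $ i $ j = ?g y $ 1 $ 1 * q y) U"
      using piv unfolding divides_def by blast
    have "eventually (\<lambda>y. ?g y $ 1 $ 1 * q y = ?g y $ i $ j) U" using q(2) by eventually_elim simp
    then show ?thesis by (rule cong[OF mult[OF a q(1)]])
  qed
  have "g y = inv2 w1 ** ?g y ** inv2 w2" for y
  proof -
    have "inv2 w1 ** ?g y ** inv2 w2 = (inv2 w1 ** w1) ** g y ** (w2 ** inv2 w2)"
      by (simp add: matrix_mul_assoc)
    then show ?thesis using inv2_mult wS by simp
  qed
  moreover have "(\<lambda>y. (inv2 w1 ** ?g y ** inv2 w2) $ i $ j) \<in> A"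
    by (intro mult_entry_in[OF function_algebra_axioms] const e)
  ultimately show ?thesis by simp
qed

lemma torus_up:
  assumes "x \<in> pts X" "torus_fixed X x" "t \<noteq> 0"
  shows "act X (dg t ** up z) x = act X (up (t\<^sup>2 * z)) x"
  using assms by (simp add: dg_up act_mult up_SL2 dg_SL2 torus_fixed_def)

text \<open>After cancelling \<open>lo (c y)\<close>, the point is \<open>up\<close> of a^2 b
  applied to \<open>x\<close>. Some coordinate is a nonconstant polynomial in that argument, as
  otherwise \<open>group_fixedI\<close> would apply, so a^2 b itself lies in the ring.\<close>

lemma product_in_valuation_algebra:
  fixes A :: "('y \<Rightarrow> complex) set"
  assumes "valuation_algebra U A" and x: "x \<in> pts X"
    and T: "torus_fixed X x" and nf: "\<not> group_fixed X x"
    and g: "eventually (\<lambda>y. g y \<in> SL2) U" and a: "eventually (\<lambda>y. a y \<noteq> 0) U"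
    and c: "c \<in> A" and dec: "eventually (\<lambda>y. g y = lo (c y) ** dg (a y) ** up (b y)) U"
    and gx: "\<And>v. v \<in> coords X \<Longrightarrow> (\<lambda>y. act X (g y) x v) \<in> A"
  shows "(\<lambda>y. (a y)\<^sup>2 * b y) \<in> A"
proof -
  interpret valuation_algebra U A by fact
  have "\<exists>v\<in>coords X. \<exists>p. (\<forall>z. act X (up z) x v = poly p z) \<and> degree p > 0"
  proof (rule ccontr)
    assume neg: "\<not> ?thesis"
    have "act X (up z) x = x" for z
    proof (rule pts_eqI)
      fix v assume v: "v \<in> coords X"
      obtain p where p: "\<And>z. act X (up z) x v = poly p z" using up_polynomial[OF x v] by blast
      have "degree p = 0"
      proof (rule ccontr)
        assume "degree p \<noteq> 0"
        then have "\<exists>p. (\<forall>z. act X (up z) x v = poly p z) \<and> degree p > 0"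
          by (intro exI[of _ p] conjI allI p) simp
        then show False using neg v by blast
      qed
      then have "poly p z = poly p 0" by (auto elim: degree_eq_zeroE)
      moreover have "up 0 = mat 1" by (simp add: mat_1_mk)
      ultimately show "act X (up z) x v = x v" using p[of z] p[of 0] act_one[OF x] by simp
    qed (use x act_pts up_SL2 in auto)
    then show False using group_fixedI[OF x T] nf by blast
  qed
  then obtain v p where v: "v \<in> coords X" and p: "\<And>z. act X (up z) x v = poly p z" "degree p > 0"
    by blast
  have "(\<lambda>y. act X (lo (- c y)) (act X (g y) x) v) \<in> A"
  proof (rule act_in_algebra[OF function_algebra_axioms])
    show "eventually (\<lambda>y. lo (- c y) \<in> SL2 \<and> act X (g y) x \<in> pts X) U"
      using g by eventually_elim (use x act_pts lo_SL2 in auto)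
    show "(\<lambda>y. lo (- c y) $ i $ j) \<in> A" for i j
      by (intro mat2_entry_in const uminus c)
  qed (use gx v in auto)
  moreover have "eventually (\<lambda>y. act X (lo (- c y)) (act X (g y) x) v = poly p ((a y)\<^sup>2 * b y)) U"
    using g a dec
  proof eventually_elim
    case (elim y)
    have "lo (- c y) ** g y = dg (a y) ** up (b y)"
      by (simp add: elim(3) mat2_mult mat2_inj algebra_simps)
    then have "act X (lo (- c y)) (act X (g y) x) = act X (dg (a y) ** up (b y)) x"
      using act_mult[OF lo_SL2 elim(1) x] by metis
    then show ?case using torus_up[OF x T elim(2)] p(1) by simp
  qed
  ultimately have "(\<lambda>y. poly p ((a y)\<^sup>2 * b y)) \<in> A" by (rule cong)
  then show ?thesis using p(2) by (rule poly_in_imp_in)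
qed

end

text \<open>For torus-fixed points only \<open>c\<close> and a^2 b matter, apart from the pivoting
  matrices. The point \<open>z\<close> bounds a^2 b, and this bounds every other torus-fixed point.
  Pivoting preserves being torus-fixed because the swaps normalize the torus.\<close>

lemma torus_fixed_coords_in:
  fixes A :: "('y \<Rightarrow> complex) set" and g :: "'y \<Rightarrow> complex^2^2"
  assumes V: "valuation_algebra U A" and X: "sl2_variety X" and Z: "sl2_variety Z"
    and x: "x \<in> pts X" "torus_fixed X x"
    and z: "z \<in> pts Z" "torus_fixed Z z" "\<not> group_fixed Z z"
    and g: "eventually (\<lambda>y. g y \<in> SL2) U"
    and gz: "\<And>v. v \<in> coords Z \<Longrightarrow> (\<lambda>y. act Z (g y) z v) \<in> A"
    and v: "v \<in> coords X"
  shows "(\<lambda>y. act X (g y) x v) \<in> A"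
proof -
  interpret valuation_algebra U A by fact
  interpret X: sl2_variety X by fact
  interpret Z: sl2_variety Z by fact
  let ?J = "mat2 0 1 (- 1) 0"
  obtain w1 w2 where w: "w1 = mat 1 \<or> w1 = ?J" "w2 = mat 1 \<or> w2 = ?J"
    and piv: "\<And>i j. divides (\<lambda>y. (w1 ** g y ** w2) $ 1 $ 1) (\<lambda>y. (w1 ** g y ** w2) $ i $ j)"
    using pivot[OF V, of g] by blast
  have wS: "w1 \<in> SL2" "w2 \<in> SL2" using w by (auto simp: SL2_one mat2_mem_SL2)
  have w2: "inv2 w2 \<in> SL2" "inv2 w2 $ 1 $ 2 = 0 \<and> inv2 w2 $ 2 $ 1 = 0 \<or> inv2 w2 $ 1 $ 1 = 0 \<and> inv2 w2 $ 2 $ 2 = 0"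
    using w(2) inv2_SL2[OF wS(2)] by (auto simp: inv2_def mat_1_mk)
  let ?g = "\<lambda>y. w1 ** g y ** w2" and ?x = "act X (inv2 w2) x" and ?z = "act Z (inv2 w2) z"
  have x': "?x \<in> pts X" "torus_fixed X ?x"
    using X.act_pts[OF w2(1) x(1)] X.torus_fixed_act[OF x w2] by auto
  have z': "?z \<in> pts Z" "torus_fixed Z ?z" "\<not> group_fixed Z ?z"
    using Z.act_pts[OF w2(1) z(1)] Z.torus_fixed_act[OF z(1,2) w2] Z.group_fixed_act[OF z(1) w2(1)] z(3)
    by auto
  have g': "eventually (\<lambda>y. ?g y \<in> SL2) U"
    using g by eventually_elim (simp add: SL2_mult wS)
  obtain b c where b: "b \<in> A" and c: "c \<in> A"
    and dec: "eventually (\<lambda>y. ?g y $ 1 $ 1 \<noteq> 0 \<and> ?g y = lo (c y) ** dg (?g y $ 1 $ 1) ** up (b y)) U"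
    using pivot_decomposition[OF V g' piv] by blast
  let ?a = "\<lambda>y. ?g y $ 1 $ 1"
  have s: "(\<lambda>y. (?a y)\<^sup>2 * b y) \<in> A"
    by (rule Z.product_in_valuation_algebra[OF V z' g' _ c _ Z.pivot_act_in[OF V z(1) g wS gz]])
      (use dec in \<open>auto elim: eventually_mono\<close>)
  let ?k = "\<lambda>y. inv2 w1 ** (lo (c y) ** up ((?a y)\<^sup>2 * b y))"
  have "(\<lambda>y. act X (?k y) ?x v) \<in> A"
  proof (rule X.act_in_algebra[OF function_algebra_axioms])
    show "eventually (\<lambda>y. ?k y \<in> SL2 \<and> ?x \<in> pts X) U"
      using x' by (simp add: SL2_mult inv2_SL2 wS lo_SL2 up_SL2)
    show "(\<lambda>y. ?k y $ i $ j) \<in> A" for i j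
      by (intro mult_entry_in[OF function_algebra_axioms] mat2_entry_in const c s)
  qed (use v const in auto)
  moreover have "eventually (\<lambda>y. act X (?k y) ?x v = act X (g y) x v) U"
    using g dec
  proof eventually_elim
    case (elim y)
    have a: "?a y \<noteq> 0" using elim by blast
    have "act X (lo (c y) ** up ((?a y)\<^sup>2 * b y)) ?x = act X (lo (c y)) (act X (dg (?a y) ** up (b y)) ?x)"
      using X.torus_up[OF x' a] x' by (simp add: X.act_mult lo_SL2 up_SL2)
    also have "\<dots> = act X (lo (c y) ** dg (?a y) ** up (b y)) ?x"
      using X.act_mult[OF lo_SL2 SL2_mult[OF dg_SL2[OF a] up_SL2] x'(1)] by (simp add: matrix_mul_assoc)
    also have "\<dots> = act X (?g y) ?x" using elim by simp
    also have "\<dots> = act X w1 (act X (g y) x)"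
      using elim wS x by (simp add: X.act_mult SL2_mult inv2_SL2 X.act_inv' X.act_pts)
    finally have "act X (?k y) ?x = act X (inv2 w1) (act X w1 (act X (g y) x))"
      using X.act_mult[OF inv2_SL2[OF wS(1)] SL2_mult[OF lo_SL2 up_SL2] x'(1)] by simp
    then show ?case using X.act_inv[OF wS(1) X.act_pts[OF elim(1) x(1)]] by simp
  qed
  ultimately show ?thesis by (rule cong)
qed

section \<open>Orbits in products\<close>

lemma orbit_subset:
  assumes "affine_gvar SL2 X" "x \<in> pts X"
  shows "orbit SL2 X x \<subseteq> pts X"
  using assms by (auto simp: orbit_def affine_gvar_def)

lemma closed_orbit_iff:
  assumes X: "affine_gvar SL2 X" and x: "x \<in> pts X"
  shows "closed_orbit SL2 X x \<longleftrightarrow>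
    closedin (zariski (affine_coord (coords X)) (coords X \<rightarrow>\<^sub>E UNIV)) (orbit SL2 X x)"
proof -
  interpret sl2_variety X by unfold_locales fact
  have "gvar_top X = subtopology (zariski (affine_coord (coords X)) (coords X \<rightarrow>\<^sub>E UNIV)) (pts X)"
    unfolding gvar_top_def by (rule subtopology_zariski[OF pts_PiE, symmetric])
  then show ?thesis
    unfolding closed_orbit_def using closedin_closed_subtopology[OF closed_pts] orbit_subset[OF X x] by simp
qed

lemma orbit_dim_eq:
  assumes X: "affine_gvar SL2 X" and x: "x \<in> pts X"
  shows "orbit_dim SL2 X x = krull_dim (zariski (affine_coord (coords X)) (orbit SL2 X x))"
  unfolding orbit_dim_def gvar_top_def subtopology_zariski[OF orbit_subset[OF X x]] ..

lemma (in sl2_variety) orbit_act: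
  assumes g: "g \<in> SL2" and x: "x \<in> pts X"
  shows "orbit SL2 X (act X g x) = orbit SL2 X x"
proof -
  have sub: "orbit SL2 X (act X h y) \<subseteq> orbit SL2 X y" if h: "h \<in> SL2" and y: "y \<in> pts X" for h y
  proof
    fix z assume "z \<in> orbit SL2 X (act X h y)"
    then obtain k where k: "k \<in> SL2" "z = act X k (act X h y)" unfolding orbit_def by blast
    then have "z = act X (k ** h) y" using act_mult[OF k(1) h y] by simp
    then show "z \<in> orbit SL2 X y" unfolding orbit_def using SL2_mult[OF k(1) h] by (rule image_eqI)
  qed
  have "orbit SL2 X x \<subseteq> orbit SL2 X (act X g x)"
    using sub[OF inv2_SL2[OF g] act_pts[OF g x]] act_inv[OF g x] by simp
  then show ?thesis using sub[OF g x] by blast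
qed

text \<open>An equation of \<open>C\<close> restricts to a polynomial on the curve, and one that
  vanishes away from 0 vanishes at 0.\<close>

lemma closed_contains_limit:
  fixes p :: "'v \<Rightarrow> complex poly"
  assumes C: "closedin (zariski (affine_coord V) (V \<rightarrow>\<^sub>E UNIV)) C"
    and curve: "\<And>u. u \<noteq> 0 \<Longrightarrow> (\<lambda>v\<in>V. poly (p v) u) \<in> C"
  shows "(\<lambda>v\<in>V. poly (p v) 0) \<in> C"
proof -
  obtain F where F: "F \<subseteq> polys (affine_coord V)" "C = zero_locus F (V \<rightarrow>\<^sub>E UNIV)"
    using C unfolding closedin_zariski by blast
  let ?A = "{F :: complex \<Rightarrow> complex. \<exists>p. \<forall>t\<in>UNIV. F t = poly p (id t)}"
  have "f (\<lambda>v\<in>V. poly (p v) 0) = 0" if f: "f \<in> F" for f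
  proof -
    have "(\<lambda>u. f (\<lambda>v\<in>V. poly (p v) u)) \<in> ?A"
    proof (rule function_algebra.pullback[OF function_algebra_poly,
          where f = f and S = "affine_coord V" and \<gamma> = "\<lambda>u. \<lambda>v\<in>V. poly (p v) u"])
      show "f \<in> polys (affine_coord V)" using f F(1) by blast
      fix h :: "('v \<Rightarrow> complex) \<Rightarrow> complex" assume "h \<in> affine_coord V"
      then obtain v where "v \<in> V" "h = (\<lambda>x. x v)" by blast
      then show "(\<lambda>u. h (\<lambda>v\<in>V. poly (p v) u)) \<in> ?A" by auto
    qed
    then obtain q where q: "\<And>u. f (\<lambda>v\<in>V. poly (p v) u) = poly q u" by auto
    have "poly q u = poly 0 u" if "u \<noteq> 0" for u
      using curve[OF that] f unfolding F(2) zero_locus_def by (simp flip: q)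
    then have "q = 0" by (rule poly_eqI_nonzero)
    then show ?thesis using q[of 0] by simp
  qed
  then show ?thesis unfolding F(2) zero_locus_def by simp
qed

text \<open>The point is the limit at u = 1/t = 0. It is torus-fixed because
  \<open>dg \<tau>\<close> only reparametrizes the curve by u -> u/\<open>\<tau>\<close>, which
  keeps u = 0.\<close>

lemma (in sl2_variety) limit_point:
  assumes x: "x \<in> pts X" and closed: "closed_orbit SL2 X x"
    and h: "h \<in> SL2" and lim: "limit_exists X x h"
  shows "\<exists>y\<in>orbit SL2 X x. torus_fixed X y"
proof -
  let ?V = "coords X"
  have "\<forall>v\<in>?V. \<exists>p. \<forall>t. t \<noteq> 0 \<longrightarrow> act X (dg t ** h) x v = poly p (1 / t)"
    using lim unfolding limit_exists_def .
  from bchoice[OF this] obtain p where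
    p: "\<forall>v\<in>?V. \<forall>t. t \<noteq> 0 \<longrightarrow> act X (dg t ** h) x v = poly (p v) (1 / t)" by (elim exE)
  let ?c = "\<lambda>u. \<lambda>v\<in>?V. poly (p v) u"
  have curve: "?c u = act X (dg (1 / u) ** h) x" if u: "u \<noteq> 0" for u
  proof (rule PiE_ext)
    show "act X (dg (1 / u) ** h) x \<in> ?V \<rightarrow>\<^sub>E UNIV"
      using pts_PiE act_pts[OF SL2_mult[OF dg_SL2 h] x, of "1 / u"] u by auto
    show "?c u v = act X (dg (1 / u) ** h) x v" if "v \<in> ?V" for v
      using p that u by (auto dest!: bspec[of _ _ v] spec[of _ "1 / u"])
  qed auto
  have orb: "?c u \<in> orbit SL2 X x" if "u \<noteq> 0" for u
    unfolding curve[OF that] orbit_def using SL2_mult[OF dg_SL2 h, of "1 / u"] that by (intro imageI) simp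
  have c0: "?c 0 \<in> orbit SL2 X x"
    using closed unfolding closed_orbit_iff[OF gvar x] by (rule closed_contains_limit) (rule orb)
  have cp: "?c u \<in> pts X" for u
    using c0 orb orbit_subset[OF gvar x] by (cases "u = 0") blast+
  have "act X (dg \<tau>) (?c 0) = ?c 0" if \<tau>: "\<tau> \<noteq> 0" for \<tau>
  proof (rule pts_eqI)
    fix v assume v: "v \<in> ?V"
    let ?A = "{F :: complex \<Rightarrow> complex. \<exists>p. \<forall>t\<in>UNIV. F t = poly p (id t)}"
    interpret A: function_algebra "principal UNIV" ?A by (rule function_algebra_poly)
    have "(\<lambda>u. act X (dg \<tau>) (?c u) v) \<in> ?A"
    proof (rule act_in_algebra[OF function_algebra_poly])
      show "eventually (\<lambda>u. dg \<tau> \<in> SL2 \<and> ?c u \<in> pts X) (principal UNIV)"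
        using cp dg_SL2[OF \<tau>] by simp
    qed (rule A.const, auto simp: v)
    then obtain q where q: "\<And>u. act X (dg \<tau>) (?c u) v = poly q u" by auto
    have "poly q u = poly (pcompose (p v) [:0, 1 / \<tau>:]) u" if u: "u \<noteq> 0" for u
    proof -
      have "dg \<tau> ** (dg (1 / u) ** h) = dg (1 / (u / \<tau>)) ** h"
        using u \<tau> by (simp add: matrix_mul_assoc mat2_mult)
      then have "act X (dg \<tau>) (?c u) = ?c (u / \<tau>)"
        using curve u \<tau> act_mult[OF dg_SL2[OF \<tau>] SL2_mult[OF dg_SL2 h, of "1 / u"] x] by simp
      then show ?thesis using q[of u] v by (simp add: poly_pcompose)
    qed
    then have "q = pcompose (p v) [:0, 1 / \<tau>:]" by (rule poly_eqI_nonzero)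
    then show "act X (dg \<tau>) (?c 0) v = ?c 0 v" using q[of 0] v by (simp add: poly_pcompose)
  qed (use cp act_pts dg_SL2[OF \<tau>] in auto)
  then show ?thesis using c0 unfolding torus_fixed_def by blast
qed

section \<open>Projections of a product onto some of its components\<close>

locale sl2_product =
  fixes X :: "'i \<Rightarrow> (complex, 2, 'v) gvar" and K :: "'i set"
  assumes finite_K: "finite K" and X: "\<And>i. i \<in> K \<Longrightarrow> affine_gvar SL2 (X i)"
begin

lemma prod_variety: "I \<subseteq> K \<Longrightarrow> affine_gvar SL2 (prod_gvar X I)"
  using finite_K X by (intro affine_gvar_prod_gvar linear_algebraic_group_SL2) (auto intro: finite_subset)

lemma coords_prod: "coords (prod_gvar X I) = prod_coords X I"
  by (simp add: prod_gvar_def)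

lemma component_in: "x \<in> pts (prod_gvar X I) \<Longrightarrow> i \<in> I \<Longrightarrow> component X i x \<in> pts (X i)"
  by (simp add: prod_gvar_def)

lemma component_project: "i \<in> I \<Longrightarrow> component X i (project X I x) = component X i x"
  by (auto simp: component_def project_def prod_coords_def restrict_def)

lemma act_prod:
  "(i, v) \<in> prod_coords X I \<Longrightarrow> act (prod_gvar X I) g x (i, v) = act (X i) g (component X i x) v"
  by (simp add: prod_gvar_def)

lemma project_self: "x \<in> pts (prod_gvar X I) \<Longrightarrow> project X I x = x"
  by (auto simp: prod_gvar_def project_def PiE_restrict)

lemma act_project:
  assumes "I \<subseteq> J"
  shows "act (prod_gvar X I) g (project X I x) = project X I (act (prod_gvar X J) g x)"
proof
  fix p
  show "act (prod_gvar X I) g (project X I x) p = project X I (act (prod_gvar X J) g x) p"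
  proof (cases "p \<in> prod_coords X I")
    case True
    obtain i v where p: "p = (i, v)" by force
    then have "i \<in> I" "(i, v) \<in> prod_coords X J" using True assms by (auto simp: prod_coords_def)
    then show ?thesis using True by (simp add: p act_prod component_project) (simp add: project_def act_prod)
  next
    case False
    then show ?thesis by (simp add: prod_gvar_def project_def)
  qed
qed

lemma orbit_project:
  assumes "I \<subseteq> K"
  shows "orbit SL2 (prod_gvar X I) (project X I x)
    = (\<lambda>y. restrict y (prod_coords X I)) ` orbit SL2 (prod_gvar X K) x"
  unfolding orbit_def act_project[OF assms] image_image by (simp add: project_def)

lemma limit_exists_project:
  "limit_exists (prod_gvar X I) (project X I x) h \<longleftrightarrow> (\<forall>i\<in>I. limit_exists (X i) (component X i x) h)"
  unfolding limit_exists_def coords_prod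
proof safe
  fix i v assume i: "i \<in> I" and v: "v \<in> coords (X i)"
    and *: "\<forall>v\<in>prod_coords X I. \<exists>p. \<forall>t. t \<noteq> 0 \<longrightarrow>
      act (prod_gvar X I) (dg t ** h) (project X I x) v = poly p (1 / t)"
  have iv: "(i, v) \<in> prod_coords X I" using i v by (simp add: prod_coords_def)
  from bspec[OF * iv] show "\<exists>p. \<forall>t. t \<noteq> 0 \<longrightarrow> act (X i) (dg t ** h) (component X i x) v = poly p (1 / t)"
    by (simp add: act_prod[OF iv] component_project[OF i])
next
  fix i v assume iv: "(i, v) \<in> prod_coords X I"
    and *: "\<forall>i\<in>I. \<forall>v\<in>coords (X i). \<exists>p. \<forall>t. t \<noteq> 0 \<longrightarrow>
      act (X i) (dg t ** h) (component X i x) v = poly p (1 / t)"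
  have i: "i \<in> I" "v \<in> coords (X i)" using iv by (auto simp: prod_coords_def)
  from bspec[OF bspec[OF * i(1)] i(2)]
  show "\<exists>p. \<forall>t. t \<noteq> 0 \<longrightarrow> act (prod_gvar X I) (dg t ** h) (project X I x) (i, v) = poly p (1 / t)"
    by (simp add: act_prod[OF iv] component_project[OF i(1)])
qed

lemma group_fixed_component:
  assumes I: "I \<subseteq> K" and x: "x \<in> pts (prod_gvar X I)" and i: "i \<in> I"
    and fixed: "group_fixed (prod_gvar X I) x"
  shows "group_fixed (X i) (component X i x)"
  unfolding group_fixed_def
proof
  fix g assume g: "g \<in> SL2"
  interpret sl2_variety "X i" by unfold_locales (use X I i in blast)
  show "act (X i) g (component X i x) = component X i x"
  proof (rule pts_eqI)
    fix v assume v: "v \<in> coords (X i)"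
    have iv: "(i, v) \<in> prod_coords X I" using i v by (simp add: prod_coords_def)
    have "act (prod_gvar X I) g x (i, v) = x (i, v)"
      using fixed g by (simp add: group_fixed_def)
    then show "act (X i) g (component X i x) v = component X i x v"
      using v by (simp add: act_prod[OF iv]) (simp add: component_def)
  qed (use component_in[OF x i] act_pts[OF g] in auto)
qed

lemma group_fixed_prodI:
  assumes I: "I \<subseteq> K" and x: "x \<in> pts (prod_gvar X I)"
    and fixed: "\<And>i. i \<in> I \<Longrightarrow> group_fixed (X i) (component X i x)"
  shows "group_fixed (prod_gvar X I) x"
  unfolding group_fixed_def
proof
  fix g assume g: "g \<in> SL2"
  interpret sl2_variety "prod_gvar X I" by unfold_locales (rule prod_variety[OF I])
  show "act (prod_gvar X I) g x = x"
  proof (rule pts_eqI)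
    fix p assume "p \<in> coords (prod_gvar X I)"
    then have p: "p \<in> prod_coords X I" by (simp add: coords_prod)
    obtain i v where iv: "p = (i, v)" by force
    then have "i \<in> I" "v \<in> coords (X i)" using p by (auto simp: prod_coords_def)
    then show "act (prod_gvar X I) g x p = x p"
      using fixed g p unfolding group_fixed_def by (simp add: iv act_prod) (simp add: component_def)
  qed (use x act_pts[OF g] in auto)
qed

text \<open>\<open>coords_in\<close> is the valuative form of finiteness: no valuation ring sees the
  projected moving point as bounded without seeing the full one as bounded.\<close>

lemma orbit_projection:
  assumes I: "I \<subseteq> K" and x: "x \<in> pts (prod_gvar X K)"
    and closed: "closed_orbit SL2 (prod_gvar X K) x"
    and coords_in: "\<And>U (A :: (('i \<times> 'v \<Rightarrow> complex) \<Rightarrow> complex) set) g v. valuation_algebra U A \<Longrightarrow>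
      eventually (\<lambda>y. g y \<in> SL2) U \<Longrightarrow>
      (\<And>v. v \<in> prod_coords X I \<Longrightarrow> (\<lambda>y. act (prod_gvar X I) (g y) (project X I x) v) \<in> A) \<Longrightarrow>
      v \<in> prod_coords X K \<Longrightarrow> (\<lambda>y. act (prod_gvar X K) (g y) x v) \<in> A"
  shows "closed_orbit SL2 (prod_gvar X I) (project X I x)"
    "orbit_dim SL2 (prod_gvar X I) (project X I x) = orbit_dim SL2 (prod_gvar X K) x"
proof -
  let ?V = "prod_coords X K" and ?W = "prod_coords X I"
  let ?Y = "orbit SL2 (prod_gvar X K) x"
  have XK: "affine_gvar SL2 (prod_gvar X K)" and XI: "affine_gvar SL2 (prod_gvar X I)"
    using prod_variety I by auto
  have V: "finite ?V" using XK by (simp add: affine_gvar_def coords_prod)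
  have WV: "?W \<subseteq> ?V" using I by (auto simp: prod_coords_def)
  have Y: "closedin (zariski (affine_coord ?V) (?V \<rightarrow>\<^sub>E UNIV)) ?Y"
    using closed closed_orbit_iff[OF XK x] by (simp add: coords_prod)
  have xI: "project X I x \<in> pts (prod_gvar X I)" by (rule project_in_pts[OF I x])
  have int: "integral_over ?Y (polys (affine_coord ?W)) f" if f: "f \<in> polys (affine_coord ?V)" for f
  proof (rule integral_overI_valuation[OF function_algebra_polys])
    fix U and B :: "(('i \<times> 'v \<Rightarrow> complex) \<Rightarrow> complex) set"
    assume B: "valuation_algebra U B" and Yev: "eventually (\<lambda>y. y \<in> ?Y) U"
      and RB: "polys (affine_coord ?W) \<subseteq> B"
    interpret valuation_algebra U B by fact
    \<comment> \<open>The choice is made point by point; it requires no regularity because valuation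
      rings here consist of arbitrary functions on the set of points.\<close>
    define g where "g = (\<lambda>y. SOME g. g \<in> SL2 \<and> act (prod_gvar X K) g x = y)"
    have g: "eventually (\<lambda>y. g y \<in> SL2 \<and> act (prod_gvar X K) (g y) x = y) U"
      using Yev
    proof eventually_elim
      case (elim y)
      then have "\<exists>g. g \<in> SL2 \<and> act (prod_gvar X K) g x = y" unfolding orbit_def by blast
      then show ?case unfolding g_def by (rule someI_ex)
    qed
    have "(\<lambda>y. act (prod_gvar X K) (g y) x v) \<in> B" if v: "v \<in> ?V" for v
    proof (rule coords_in[OF B _ _ v])
      show "eventually (\<lambda>y. g y \<in> SL2) U" using g by eventually_elim simp
      fix v assume v: "v \<in> ?W"
      have "(\<lambda>y. y v) \<in> polys (affine_coord ?W)" by (rule polys.gen) (use v in blast)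
      with RB have "(\<lambda>y. y v) \<in> B" by (rule subsetD)
      moreover have "eventually (\<lambda>y. y v = act (prod_gvar X I) (g y) (project X I x) v) U"
        using g unfolding act_project[OF I] by eventually_elim (use v in \<open>simp add: project_def\<close>)
      ultimately show "(\<lambda>y. act (prod_gvar X I) (g y) (project X I x) v) \<in> B"
        by (rule cong)
    qed
    moreover have "eventually (\<lambda>y. act (prod_gvar X K) (g y) x v = y v) U" for v
      using g by eventually_elim simp
    ultimately have yB: "(\<lambda>y. y v) \<in> B" if "v \<in> ?V" for v
      using cong[of "\<lambda>y. act (prod_gvar X K) (g y) x v" "\<lambda>y. y v"] that by simp
    show "f \<in> B"
      by (rule pullback[OF f, where \<gamma> = "\<lambda>y. y"]) (use yB in auto)
  qed
  note proj = integral_projection[OF V WV Y int]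
  show "closed_orbit SL2 (prod_gvar X I) (project X I x)"
    unfolding closed_orbit_iff[OF XI xI] coords_prod orbit_project[OF I] by (rule proj(1))
  show "orbit_dim SL2 (prod_gvar X I) (project X I x) = orbit_dim SL2 (prod_gvar X K) x"
    unfolding orbit_dim_eq[OF XI xI] orbit_dim_eq[OF XK x] coords_prod orbit_project[OF I]
    by (rule proj(2)[symmetric])
qed

text \<open>A valuation ring that contains the projected moving point contains the entries of the
  group element, hence all coordinates of the moved \<open>x\<close>.\<close>

lemma projection_without_limits:
  assumes I: "I \<subseteq> K" and x: "x \<in> pts (prod_gvar X K)"
    and closed: "closed_orbit SL2 (prod_gvar X K) x"
    and no_limit: "\<And>h. h \<in> SL2 \<Longrightarrow> \<not> limit_exists (prod_gvar X I) (project X I x) h"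
  shows "closed_orbit SL2 (prod_gvar X I) (project X I x) \<and>
    orbit_dim SL2 (prod_gvar X I) (project X I x) = orbit_dim SL2 (prod_gvar X K) x"
proof -
  interpret XI: sl2_variety "prod_gvar X I" by unfold_locales (rule prod_variety[OF I])
  interpret XK: sl2_variety "prod_gvar X K" by unfold_locales (rule prod_variety[OF order_refl])
  have xI: "project X I x \<in> pts (prod_gvar X I)" by (rule project_in_pts[OF I x])
  have "(\<lambda>y. act (prod_gvar X K) (g y) x v) \<in> A"
    if A: "valuation_algebra U A" and g: "eventually (\<lambda>y. g y \<in> SL2) U"
      and gx: "\<And>v. v \<in> prod_coords X I \<Longrightarrow> (\<lambda>y. act (prod_gvar X I) (g y) (project X I x) v) \<in> A"
      and v: "v \<in> prod_coords X K" for U v g and A :: "(('i \<times> 'v \<Rightarrow> complex) \<Rightarrow> complex) set"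
  proof -
    interpret valuation_algebra U A by fact
    show ?thesis
    proof (rule XK.act_in_algebra[OF function_algebra_axioms])
      show "eventually (\<lambda>y. g y \<in> SL2 \<and> x \<in> pts (prod_gvar X K)) U" using g x by simp
      show "(\<lambda>y. g y $ i $ j) \<in> A" for i j
        by (rule XI.entries_in_valuation_algebra[OF A xI no_limit g]) (use gx in \<open>auto simp: coords_prod\<close>)
    qed (use v const in \<open>auto simp: coords_prod\<close>)
  qed
  then show ?thesis by (intro conjI orbit_projection[OF I x closed]) blast+
qed

lemma projection_torus_fixed:
  assumes I: "I \<subseteq> K" and x: "x \<in> pts (prod_gvar X K)"
    and closed: "closed_orbit SL2 (prod_gvar X K) x"
    and T: "torus_fixed (prod_gvar X K) x"
    and fixed: "group_fixed (prod_gvar X K) x \<or> \<not> group_fixed (prod_gvar X I) (project X I x)"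
  shows "closed_orbit SL2 (prod_gvar X I) (project X I x) \<and>
    orbit_dim SL2 (prod_gvar X I) (project X I x) = orbit_dim SL2 (prod_gvar X K) x"
proof -
  have XI: "sl2_variety (prod_gvar X I)" by unfold_locales (rule prod_variety[OF I])
  have XK: "sl2_variety (prod_gvar X K)" by unfold_locales (rule prod_variety[OF order_refl])
  have xI: "project X I x \<in> pts (prod_gvar X I)" by (rule project_in_pts[OF I x])
  have TI: "torus_fixed (prod_gvar X I) (project X I x)"
    using T unfolding torus_fixed_def act_project[OF I] by simp
  have "(\<lambda>y. act (prod_gvar X K) (g y) x v) \<in> A"
    if A: "valuation_algebra U A" and g: "eventually (\<lambda>y. g y \<in> SL2) U"
      and gx: "\<And>v. v \<in> prod_coords X I \<Longrightarrow> (\<lambda>y. act (prod_gvar X I) (g y) (project X I x) v) \<in> A"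
      and v: "v \<in> prod_coords X K" for U v g and A :: "(('i \<times> 'v \<Rightarrow> complex) \<Rightarrow> complex) set"
  proof -
    interpret valuation_algebra U A by fact
    from fixed show ?thesis
    proof
      assume f: "group_fixed (prod_gvar X K) x"
      have "eventually (\<lambda>y. x v = act (prod_gvar X K) (g y) x v) U"
        using g by eventually_elim (use f in \<open>simp add: group_fixed_def\<close>)
      then show ?thesis by (rule cong[OF const])
    next
      assume "\<not> group_fixed (prod_gvar X I) (project X I x)"
      then show ?thesis
        using gx v by (intro torus_fixed_coords_in[OF A XK XI x T xI TI _ g]) (auto simp: coords_prod)
    qed
  qed
  then show ?thesis by (intro conjI orbit_projection[OF I x closed]) blast+
qed

theorem three_components_suffice:
  assumes card: "card K \<ge> 3" and x: "x \<in> pts (prod_gvar X K)"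
    and closed: "closed_orbit SL2 (prod_gvar X K) x"
  shows "\<exists>I\<subseteq>K. card I = 3 \<and> closed_orbit SL2 (prod_gvar X I) (project X I x) \<and>
    orbit_dim SL2 (prod_gvar X I) (project X I x) = orbit_dim SL2 (prod_gvar X K) x"
proof -
  interpret XK: sl2_variety "prod_gvar X K" by unfold_locales (rule prod_variety[OF order_refl])
  \<comment> \<open>The definition demands exactly three components; both projection criteria
    survive passing to a larger index set.\<close>
  have extend: "\<exists>I. J \<subseteq> I \<and> I \<subseteq> K \<and> card I = 3" if "J \<subseteq> K" "card J \<le> 3" for J
    using exists_subset_between[of J 3 K] that card finite_K by blast
  show ?thesis
  proof (cases "\<exists>h\<in>SL2. limit_exists (prod_gvar X K) x h")
    case True
    then obtain y where "y \<in> orbit SL2 (prod_gvar X K) x" and T: "torus_fixed (prod_gvar X K) y"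
      using XK.limit_point[OF x closed] by blast
    then obtain g where g: "g \<in> SL2" and y: "y = act (prod_gvar X K) g x" by (auto simp: orbit_def)
    have yK: "y \<in> pts (prod_gvar X K)" unfolding y by (rule XK.act_pts[OF g x])
    have oy: "orbit SL2 (prod_gvar X K) y = orbit SL2 (prod_gvar X K) x"
      unfolding y by (rule XK.orbit_act[OF g x])
    then have closed_y: "closed_orbit SL2 (prod_gvar X K) y"
      using closed by (simp add: closed_orbit_def)
    obtain I where I: "I \<subseteq> K" "card I = 3"
      "group_fixed (prod_gvar X K) y \<or> \<not> group_fixed (prod_gvar X I) (project X I y)"
    proof (cases "group_fixed (prod_gvar X K) y")
      case True
      then show ?thesis using that extend[of "{}"] by auto
    next
      case False
      then obtain i where i: "i \<in> K" "\<not> group_fixed (X i) (component X i y)"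
        using group_fixed_prodI[OF order_refl yK] by blast
      then obtain I where I: "i \<in> I" "I \<subseteq> K" "card I = 3" using extend[of "{i}"] by auto
      have "\<not> group_fixed (prod_gvar X I) (project X I y)"
        using group_fixed_component[OF I(2) project_in_pts[OF I(2) yK] I(1)] i(2)
        by (auto simp: component_project[OF I(1)])
      then show ?thesis using that I by blast
    qed
    interpret XI: sl2_variety "prod_gvar X I" by unfold_locales (rule prod_variety[OF I(1)])
    \<comment> \<open>The results obtained for \<open>y\<close> carry over to \<open>x\<close>,
      since the projected points also share their orbit.\<close>
    have "project X I y = act (prod_gvar X I) g (project X I x)"
      by (simp add: y act_project[OF I(1)])
    then have "orbit SL2 (prod_gvar X I) (project X I y) = orbit SL2 (prod_gvar X I) (project X I x)"
      using XI.orbit_act[OF g project_in_pts[OF I(1) x]] by simp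
    then show ?thesis
      using projection_torus_fixed[OF I(1) yK closed_y T I(3)] I oy
      unfolding closed_orbit_def orbit_dim_def by auto
  next
    case False
    have no_lim: "\<exists>i\<in>K. \<not> limit_exists (X i) (component X i x) h" if "h \<in> SL2" for h
      using False that limit_exists_project[of K x h] project_self[OF x] by auto
    have v: "sl2_variety (X i)" "component X i x \<in> pts (X i)" if "i \<in> K" for i
      using X that component_in[OF x] by (auto intro: sl2_variety.intro)
    \<comment> \<open>Any direction serves here: a component lacking some limit is not fixed by the
      group, so it has limits in at most two directions.\<close>
    obtain i1 where i1: "i1 \<in> K" "\<not> limit_exists (X i1) (component X i1 x) (mat 1)"
      using no_lim[OF SL2_one] by blast
    then have "\<not> group_fixed (X i1) (component X i1 x)"
      using sl2_variety.group_fixed_limit[OF v(1)[OF i1(1)] _ SL2_one] by blast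
    then obtain h1 h2 where h: "h1 \<in> SL2" "h2 \<in> SL2" and
      dirs: "\<And>h. h \<in> SL2 \<Longrightarrow> limit_exists (X i1) (component X i1 x) h \<Longrightarrow>
       h1 $ 1 $ 1 * h $ 1 $ 2 = h1 $ 1 $ 2 * h $ 1 $ 1 \<or> h2 $ 1 $ 1 * h $ 1 $ 2 = h2 $ 1 $ 2 * h $ 1 $ 1"
      using sl2_variety.two_limit_directions[OF v[OF i1(1)]] by metis
    obtain i2 where i2: "i2 \<in> K" "\<not> limit_exists (X i2) (component X i2 x) h1" using no_lim[OF h(1)] by blast
    obtain i3 where i3: "i3 \<in> K" "\<not> limit_exists (X i3) (component X i3 x) h2" using no_lim[OF h(2)] by blast
    have "{i1, i2, i3} \<subseteq> K" "card {i1, i2, i3} \<le> 3"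
      using i1 i2 i3 by (auto simp: card_insert_if)
    from extend[OF this] obtain I where I: "{i1, i2, i3} \<subseteq> I" "I \<subseteq> K" "card I = 3"
      by (elim exE conjE)
    have "\<not> limit_exists (prod_gvar X I) (project X I x) h" if hS: "h \<in> SL2" for h
    proof
      assume "limit_exists (prod_gvar X I) (project X I x) h"
      then have lim: "limit_exists (X i) (component X i x) h" if "i \<in> {i1, i2, i3}" for i
        using that I(1) unfolding limit_exists_project by blast
      \<comment> \<open>By the choice of \<open>i1\<close> the direction of \<open>h\<close> is that
        of \<open>h1\<close> or of \<open>h2\<close>, and these are excluded by \<open>i2\<close>
        and \<open>i3\<close>.\<close>
      have "limit_exists (X i2) (component X i2 x) h1 \<or> limit_exists (X i3) (component X i3 x) h2"
        using dirs[OF hS lim[of i1]] sl2_variety.limit_exists_row[OF v[OF i2(1)] hS h(1) _ lim[of i2]]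
          sl2_variety.limit_exists_row[OF v[OF i3(1)] hS h(2) _ lim[of i3]]
        by (auto simp: mult.commute)
      then show False using i2 i3 by blast
    qed
    then show ?thesis using projection_without_limits[OF I(2) x closed] I by blast
  qed
qed

end

lemma delta_prod_le_3:
  fixes X :: "nat \<Rightarrow> (complex, 2, 'v) gvar"
  assumes X: "\<forall>i\<in>{1..m}. affine_gvar SL2 (X i)"
  shows "delta_prod SL2 m X \<le> 3"
    and "\<forall>x\<in>pts (prod_gvar X {1..m}). closed_orbit SL2 (prod_gvar X {1..m}) x \<longrightarrow>
      (\<exists>I\<subseteq>{1..m}. card I = delta_prod SL2 m X \<and> closed_orbit SL2 (prod_gvar X I) (project X I x) \<and>
        orbit_dim SL2 (prod_gvar X I) (project X I x) = orbit_dim SL2 (prod_gvar X {1..m}) x)"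
proof -
  interpret sl2_product X "{1..m}" by unfold_locales (use X in auto)
  let ?P = "\<lambda>d. \<forall>x\<in>pts (prod_gvar X {1..m}). closed_orbit SL2 (prod_gvar X {1..m}) x \<longrightarrow>
        (\<exists>I\<subseteq>{1..m}. card I = d \<and> closed_orbit SL2 (prod_gvar X I) (project X I x) \<and>
           orbit_dim SL2 (prod_gvar X I) (project X I x) = orbit_dim SL2 (prod_gvar X {1..m}) x)"
  \<comment> \<open>No subset of \<open>{1..m}\<close> has more than m elements; for m below 3 the
    whole index set is taken.\<close>
  have P: "?P (min m 3)"
  proof (cases "m \<ge> 3")
    case True
    then have "min m 3 = 3" by simp
    show ?thesis
      unfolding \<open>min m 3 = 3\<close> by (intro ballI impI three_components_suffice) (use True in auto)
  next
    case False
    then show ?thesis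
      by (intro ballI impI exI[of _ "{1..m}"]) (simp add: project_self)
  qed
  from P have "delta_prod SL2 m X \<le> min m 3"
    unfolding delta_prod_def by (rule Least_le)
  then show "delta_prod SL2 m X \<le> 3" by simp
  from P show "?P (delta_prod SL2 m X)"
    unfolding delta_prod_def by (rule LeastI)
qed

section \<open>Triples of binary quadratic forms\<close>

definition tri :: "complex \<Rightarrow> complex \<Rightarrow> complex \<Rightarrow> nat \<Rightarrow> complex" where
  "tri p q r v = (if v = 0 then p else if v = 1 then q else r)"

lemma tri_simps [simp]: "tri p q r 0 = p" "tri p q r (Suc 0) = q" "tri p q r 1 = q" "tri p q r 2 = r"
  by (simp_all add: tri_def)

text \<open>The coordinates \<open>0\<close>, \<open>1\<close>, \<open>2\<close> are the entries \<open>p\<close>, \<open>q\<close>, \<open>r\<close> of the symmetric matrix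
  \<open>S = ((p, q), (q, r))\<close>, on which \<open>g\<close> acts by \<open>g S g\<^sup>T\<close>.\<close>

definition gact :: "complex^2^2 \<Rightarrow> (nat \<Rightarrow> complex) \<Rightarrow> nat \<Rightarrow> complex" where
  "gact g s = tri
     (g $ 1 $ 1 * g $ 1 $ 1 * s 0 + 2 * g $ 1 $ 1 * g $ 1 $ 2 * s 1 + g $ 1 $ 2 * g $ 1 $ 2 * s 2)
     (g $ 1 $ 1 * g $ 2 $ 1 * s 0 + (g $ 1 $ 1 * g $ 2 $ 2 + g $ 1 $ 2 * g $ 2 $ 1) * s 1 + g $ 1 $ 2 * g $ 2 $ 2 * s 2)
     (g $ 2 $ 1 * g $ 2 $ 1 * s 0 + 2 * g $ 2 $ 1 * g $ 2 $ 2 * s 1 + g $ 2 $ 2 * g $ 2 $ 2 * s 2)"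

definition sym2 :: "(complex, 2, nat) gvar" where
  "sym2 = \<lparr>coords = {0, 1, 2}, pts = {0, 1, 2} \<rightarrow>\<^sub>E UNIV, act = (\<lambda>g s. \<lambda>v\<in>{0, 1, 2}. gact g s v)\<rparr>"

lemma gact_mult: "gact (g ** h) s v = gact g (gact h s) v"
  by (simp add: gact_def tri_def mult_entry algebra_simps)

lemma gact_cong: "s 0 = s' 0 \<Longrightarrow> s 1 = s' 1 \<Longrightarrow> s 2 = s' 2 \<Longrightarrow> gact g s = gact g s'"
  by (simp add: gact_def)

lemma affine_gvar_sym2: "affine_gvar SL2 sym2"
proof -
  let ?V = "{0, 1, 2 :: nat}"
  interpret P: function_algebra top "polys (GL_affine_coord ?V) :: ((complex^2^2) \<times> (nat \<Rightarrow> complex) \<Rightarrow> complex) set"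
    by (rule function_algebra_polys)
  have e: "(\<lambda>p. fst p $ i $ j) \<in> polys (GL_affine_coord ?V :: ((complex^2^2) \<times> (nat \<Rightarrow> complex) \<Rightarrow> complex) set)" for i j :: 2
  proof (rule polys.gen)
    have 1: "(\<lambda>A :: complex^2^2. A $ i $ j) \<in> GL_coord" unfolding GL_coord_def by blast
    have 2: "(\<lambda>p. fst p $ i $ j) = (\<lambda>(A :: complex^2^2, x :: nat \<Rightarrow> complex). A $ i $ j)" by auto
    show "(\<lambda>p. fst p $ i $ j) \<in> (GL_affine_coord ?V :: ((complex^2^2) \<times> (nat \<Rightarrow> complex) \<Rightarrow> complex) set)"
      unfolding GL_affine_coord_def
      by (rule UnI1, rule CollectI, rule exI[of _ "\<lambda>A. A $ i $ j"], rule conjI[OF 2 1])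
  qed
  have c: "(\<lambda>p. snd p w) \<in> polys (GL_affine_coord ?V :: ((complex^2^2) \<times> (nat \<Rightarrow> complex) \<Rightarrow> complex) set)" if "w \<in> ?V" for w
  proof (rule polys.gen)
    have 1: "(\<lambda>p. snd p w) = (\<lambda>(A :: complex^2^2, x :: nat \<Rightarrow> complex). x w)" by auto
    show "(\<lambda>p. snd p w) \<in> (GL_affine_coord ?V :: ((complex^2^2) \<times> (nat \<Rightarrow> complex) \<Rightarrow> complex) set)"
      unfolding GL_affine_coord_def by (rule UnI2, rule CollectI, rule exI[of _ w], rule conjI[OF 1 that])
  qed
  have "(\<lambda>p. gact (fst p) (snd p) v) \<in> polys (GL_affine_coord ?V)" if "v \<in> ?V" for v
  proof -
    have "v = 0 \<or> v = 1 \<or> v = 2" using that by blast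
    then show ?thesis
      unfolding gact_def
      by (elim disjE; simp only: tri_simps) (intro P.add P.mult P.const e c; simp)+
  qed
  then have poly: "\<exists>f\<in>polys (GL_affine_coord ?V). \<forall>g\<in>SL2. \<forall>x\<in>?V \<rightarrow>\<^sub>E UNIV.
      (\<lambda>v\<in>?V. gact g x v) v = f (g, x)" if "v \<in> ?V" for v
    using that by (intro bexI[of _ "\<lambda>p. gact (fst p) (snd p) v"]) simp_all
  have closed: "closedin (zariski (affine_coord ?V) (?V \<rightarrow>\<^sub>E UNIV)) (?V \<rightarrow>\<^sub>E (UNIV :: complex set))"
    using closedin_topspace[of "zariski (affine_coord ?V) (?V \<rightarrow>\<^sub>E (UNIV :: complex set))"] by simp
  have one: "(\<lambda>v\<in>?V. gact (mat 1) x v) = x" if x: "x \<in> ?V \<rightarrow>\<^sub>E UNIV" for x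
    by (rule PiE_ext[OF _ x]) (auto simp: gact_def mat_def)
  have mult: "(\<lambda>v\<in>?V. gact (g ** h) x v) = (\<lambda>v\<in>?V. gact g (\<lambda>v\<in>?V. gact h x v) v)" for g h x
    using gact_cong[of "\<lambda>v\<in>?V. gact h x v" "gact h x" g] by (simp add: gact_mult)
  show ?thesis
    unfolding affine_gvar_def sym2_def using poly closed one mult by simp
qed

section \<open>Orbits of tuples of forms\<close>

definition tup :: "nat set \<Rightarrow> (nat \<Rightarrow> nat \<Rightarrow> complex) \<Rightarrow> (nat \<times> nat \<Rightarrow> complex)" where
  "tup I f = (\<lambda>p\<in>I \<times> {0, 1, 2}. f (fst p) (snd p))"

abbreviation sym2s :: "nat \<Rightarrow> (complex, 2, nat) gvar" where "sym2s \<equiv> \<lambda>_. sym2"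

interpretation S: sl2_product sym2s "{1..3}"
  by unfold_locales (simp_all add: affine_gvar_sym2)

lemma prod_coords_sym2s: "prod_coords sym2s I = I \<times> {0, 1, 2}"
  by (simp add: prod_coords_def sym2_def)

lemma component_sym2s: "component sym2s i x = (\<lambda>v\<in>{0, 1, 2}. x (i, v))"
  by (simp add: component_def sym2_def)

lemma pts_prod_sym2: "pts (prod_gvar sym2s I) = (I \<times> {0, 1, 2}) \<rightarrow>\<^sub>E UNIV"
proof -
  have "component sym2s i x \<in> pts sym2" for i x
    unfolding component_sym2s by (simp add: sym2_def)
  then show ?thesis by (simp add: prod_gvar_def prod_coords_sym2s)
qed

lemma tup_pts: "tup I f \<in> pts (prod_gvar sym2s I)"
  by (simp add: pts_prod_sym2 tup_def)

lemma pts_tup: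
  assumes "x \<in> pts (prod_gvar sym2s I)"
  shows "x = tup I (\<lambda>i v. x (i, v))"
  by (rule PiE_ext[of x "I \<times> {0, 1, 2}" "\<lambda>_. UNIV"]) (use assms in \<open>auto simp: pts_prod_sym2 tup_def\<close>)

lemma act_tup: "act (prod_gvar sym2s I) g (tup I f) = tup I (\<lambda>i. gact g (f i))"
proof
  fix p :: "nat \<times> nat"
  show "act (prod_gvar sym2s I) g (tup I f) p = tup I (\<lambda>i. gact g (f i)) p"
  proof (cases "p \<in> I \<times> {0, 1, 2}")
    case True
    then obtain i v where p: "p = (i, v)" "i \<in> I" "v \<in> {0, 1, 2}" by blast
    have "gact g (component sym2s i (tup I f)) = gact g (f i)"
      using p(2) by (intro gact_cong) (simp_all add: component_sym2s tup_def)
    then show ?thesis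
      using p by (simp add: prod_gvar_def prod_coords_sym2s) (simp add: sym2_def tup_def)
  qed (simp add: prod_gvar_def prod_coords_sym2s tup_def)
qed

lemma tup_apply: "i \<in> I \<Longrightarrow> v \<in> {0, 1, 2} \<Longrightarrow> tup I f (i, v) = f i v"
  by (simp add: tup_def)

lemma project_tup: "I \<subseteq> J \<Longrightarrow> project sym2s I (tup J f) = tup I f"
  by (rule ext) (auto simp: project_def prod_coords_sym2s restrict_def tup_def)

lemma tup_eq_iff: "tup I f = tup I f' \<longleftrightarrow> (\<forall>i\<in>I. f i 0 = f' i 0 \<and> f i 1 = f' i 1 \<and> f i 2 = f' i 2)"
proof
  assume *: "tup I f = tup I f'"
  have "f i v = f' i v" if "i \<in> I" "v \<in> {0, 1, 2}" for i v
    using fun_cong[OF *, of "(i, v)"] that by (auto simp: tup_def)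
  then show "\<forall>i\<in>I. f i 0 = f' i 0 \<and> f i 1 = f' i 1 \<and> f i 2 = f' i 2" by simp
next
  assume "\<forall>i\<in>I. f i 0 = f' i 0 \<and> f i 1 = f' i 1 \<and> f i 2 = f' i 2"
  then show "tup I f = tup I f'" unfolding tup_def by (intro restrict_ext) auto
qed

lemma orbit_tup: "orbit SL2 (prod_gvar sym2s I) (tup I f) = {tup I (\<lambda>i. gact g (f i)) | g. g \<in> SL2}"
  unfolding orbit_def act_tup by blast

text \<open>The polynomials \<open>p\<close> describe a curve inside the orbit for nonzero u whose
  limit at 0 lies outside.\<close>

lemma not_closed_orbit_tup:
  assumes I: "I \<subseteq> {1..3}"
    and curve: "\<And>u. u \<noteq> 0 \<Longrightarrow> \<exists>g\<in>SL2. \<forall>i\<in>I. \<forall>v\<in>{0, 1, 2}. gact g (f i) v = poly (p i v) u"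
    and limit: "\<And>g. g \<in> SL2 \<Longrightarrow> \<exists>i\<in>I. \<exists>v\<in>{0, 1, 2}. gact g (f i) v \<noteq> poly (p i v) 0"
  shows "\<not> closed_orbit SL2 (prod_gvar sym2s I) (tup I f)"
proof
  let ?O = "orbit SL2 (prod_gvar sym2s I) (tup I f)"
  assume "closed_orbit SL2 (prod_gvar sym2s I) (tup I f)"
  then have "closedin (zariski (affine_coord (I \<times> {0, 1, 2})) ((I \<times> {0, 1, 2}) \<rightarrow>\<^sub>E UNIV)) ?O"
    using closed_orbit_iff[OF S.prod_variety[OF I] tup_pts] by (simp add: S.coords_prod prod_coords_sym2s)
  then have "tup I (\<lambda>i v. poly (p i v) 0) \<in> ?O"
    unfolding tup_def[of I "\<lambda>i v. poly (p i v) 0"]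
  proof (rule closed_contains_limit[where p = "\<lambda>q. p (fst q) (snd q)"])
    fix u :: complex assume "u \<noteq> 0"
    from curve[OF this] obtain g where "g \<in> SL2" "\<forall>i\<in>I. \<forall>v\<in>{0, 1, 2}. gact g (f i) v = poly (p i v) u"
      by blast
    then have "tup I (\<lambda>i v. poly (p i v) u) = tup I (\<lambda>i. gact g (f i))" unfolding tup_eq_iff by simp
    then show "(\<lambda>q\<in>I \<times> {0, 1, 2}. poly (p (fst q) (snd q)) u) \<in> ?O"
      unfolding orbit_tup tup_def[of I "\<lambda>i v. poly (p i v) u", symmetric] using \<open>g \<in> SL2\<close> by blast
  qed
  then obtain g where g: "g \<in> SL2" "tup I (\<lambda>i v. poly (p i v) 0) = tup I (\<lambda>i. gact g (f i))"
    unfolding orbit_tup by blast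
  then show False using limit[OF g(1)] unfolding tup_eq_iff by auto
qed

lemma closed_orbit_tupI:
  assumes I: "I \<subseteq> {1..3}" and F: "F \<subseteq> polys (affine_coord (I \<times> {0, 1, 2}))"
    and orbit: "\<And>x. x \<in> (I \<times> {0, 1, 2}) \<rightarrow>\<^sub>E UNIV \<Longrightarrow> x \<in> orbit SL2 (prod_gvar sym2s I) (tup I f) \<longleftrightarrow> (\<forall>h\<in>F. h x = 0)"
  shows "closed_orbit SL2 (prod_gvar sym2s I) (tup I f)"
proof -
  have sub: "orbit SL2 (prod_gvar sym2s I) (tup I f) \<subseteq> (I \<times> {0, 1, 2}) \<rightarrow>\<^sub>E UNIV"
    using orbit_subset[OF S.prod_variety[OF I] tup_pts] by (simp add: pts_prod_sym2)
  have eq: "orbit SL2 (prod_gvar sym2s I) (tup I f) = zero_locus F ((I \<times> {0, 1, 2}) \<rightarrow>\<^sub>E UNIV)"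
  proof (rule set_eqI)
    fix x
    show "x \<in> orbit SL2 (prod_gvar sym2s I) (tup I f) \<longleftrightarrow> x \<in> zero_locus F ((I \<times> {0, 1, 2}) \<rightarrow>\<^sub>E UNIV)"
    proof (cases "x \<in> (I \<times> {0, 1, 2}) \<rightarrow>\<^sub>E (UNIV :: complex set)")
      case True
      then show ?thesis unfolding zero_locus_def mem_Collect_eq orbit[OF True] by (simp only: simp_thms)
    next
      case False
      then show ?thesis
        using contra_subsetD[OF sub False] unfolding zero_locus_def mem_Collect_eq by (simp only: simp_thms)
    qed
  qed
  show ?thesis
    unfolding closed_orbit_iff[OF S.prod_variety[OF I] tup_pts] S.coords_prod prod_coords_sym2s closedin_zariski
    by (intro exI[of _ F] conjI F eq)
qed

lemma one_to_three: "{1..3::nat} = {1, 2, 3}"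
  by auto

text \<open>The squares of the two coordinate forms; the third entry merely repeats the first. One
  square degenerates to zero, but the two together cannot, as the determinant of the linear forms is
  preserved.\<close>

definition squares :: "nat \<Rightarrow> nat \<Rightarrow> complex" where
  "squares i = (if i = 2 then tri 0 0 1 else tri 1 0 0)"

text \<open>Any two of the three forms have a common linear factor, and degenerate under the torus that
  scales it; the three together have none.\<close>

definition products :: "nat \<Rightarrow> nat \<Rightarrow> complex" where
  "products i = (if i = 1 then tri 0 1 0 else if i = 2 then tri 0 1 2 else tri 2 1 0)"

lemma rank_one:
  fixes p q r :: complex
  assumes "q * q = p * r"
  obtains a c where "p = a * a" "q = a * c" "r = c * c"
proof (cases "p = 0")
  case True
  then show ?thesis using that[of 0 "csqrt r"] assms by (simp flip: power2_eq_square)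
next
  case False
  have a: "csqrt p * csqrt p = p" by (simp flip: power2_eq_square)
  then have "r = q / csqrt p * (q / csqrt p)" using assms False by (simp add: field_simps)
  then show ?thesis using that[of "csqrt p" "q / csqrt p"] a False by auto
qed

text \<open>The equations say that the entries 1 and 3 agree, that 1 and 2 are squares of linear
  forms, and that the determinant of these linear forms has square 1. The last is the polarized
  discriminant of the two squares.\<close>

lemma closed_orbit_squares:
  "closed_orbit SL2 (prod_gvar sym2s {1..3}) (tup {1..3} squares)"
proof -
  let ?V = "{1, 2, 3} \<times> {0, 1, 2 :: nat}"
  let ?F = "{\<lambda>x :: nat \<times> nat \<Rightarrow> complex. x (3, 0) - x (1, 0), \<lambda>x. x (3, 1) - x (1, 1), \<lambda>x. x (3, 2) - x (1, 2),
    \<lambda>x. x (1, 1) * x (1, 1) - x (1, 0) * x (1, 2), \<lambda>x. x (2, 1) * x (2, 1) - x (2, 0) * x (2, 2),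
    \<lambda>x. 2 * x (1, 1) * x (2, 1) - x (1, 0) * x (2, 2) - x (2, 0) * x (1, 2) + 1}"
  interpret P: function_algebra top "polys (affine_coord ?V) :: ((nat \<times> nat \<Rightarrow> complex) \<Rightarrow> complex) set"
    by (rule function_algebra_polys)
  have c: "(\<lambda>x. x w) \<in> polys (affine_coord ?V)" if "w \<in> ?V" for w
    by (rule polys.gen) (use that in blast)
  show ?thesis
    unfolding one_to_three
  proof (rule closed_orbit_tupI[where F = ?F])
    show "?F \<subseteq> polys (affine_coord ?V)"
      by (intro insert_subsetI empty_subsetI P.diff P.add P.mult P.const c) simp_all
    fix x :: "nat \<times> nat \<Rightarrow> complex" assume x: "x \<in> ?V \<rightarrow>\<^sub>E UNIV"
    have xt: "x = tup {1, 2, 3} (\<lambda>i v. x (i, v))" using pts_tup x by (simp add: pts_prod_sym2)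
    show "x \<in> orbit SL2 (prod_gvar sym2s {1, 2, 3}) (tup {1, 2, 3} squares) \<longleftrightarrow> (\<forall>h\<in>?F. h x = 0)"
    proof
      assume "x \<in> orbit SL2 (prod_gvar sym2s {1, 2, 3}) (tup {1, 2, 3} squares)"
      then obtain g where g: "g \<in> SL2" and x: "x = tup {1, 2, 3} (\<lambda>i. gact g (squares i))"
        unfolding orbit_tup by blast
      define a b c d where "a = g $ 1 $ 1" and "b = g $ 1 $ 2" and "c = g $ 2 $ 1" and "d = g $ 2 $ 2"
      have "(a * d - b * c) * (a * d - b * c) = 1" using g by (simp add: mem_SL2 a_def b_def c_def d_def)
      moreover have "x (i, v) = gact g (squares i) v" if "i \<in> {1, 2, 3}" "v \<in> {0, 1, 2}" for i v
        unfolding x by (rule tup_apply[OF that])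
      then have "x (1, 0) = a * a" "x (1, 1) = a * c" "x (1, 2) = c * c"
        "x (2, 0) = b * b" "x (2, 1) = b * d" "x (2, 2) = d * d"
        "x (3, 0) = a * a" "x (3, 1) = a * c" "x (3, 2) = c * c"
        by (simp_all add: squares_def gact_def a_def b_def c_def d_def)
      ultimately show "\<forall>h\<in>?F. h x = 0"
        by (simp add: algebra_simps)
    next
      assume F: "\<forall>h\<in>?F. h x = 0"
      obtain a c where ac: "x (1, 0) = a * a" "x (1, 1) = a * c" "x (1, 2) = c * c"
        using rank_one[of "x (1, 1)" "x (1, 0)" "x (1, 2)"] F by auto
      obtain b d where bd: "x (2, 0) = b * b" "x (2, 1) = b * d" "x (2, 2) = d * d"
        using rank_one[of "x (2, 1)" "x (2, 0)" "x (2, 2)"] F by auto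
      have "x (3, 0) = x (1, 0)" "x (3, 1) = x (1, 1)" "x (3, 2) = x (1, 2)"
        "2 * x (1, 1) * x (2, 1) - x (1, 0) * x (2, 2) - x (2, 0) * x (1, 2) + 1 = 0"
        using F by simp_all
      note eqs = this[unfolded ac bd]
      have "(a * d - b * c) * (a * d - b * c)
          = 1 - (2 * (a * c) * (b * d) - a * a * (d * d) - b * b * (c * c) + 1)"
        by (simp add: algebra_simps)
      then have "(a * d - b * c) * (a * d - b * c) = 1" using eqs(4) by simp
      then have "(a * d - b * c - 1) * (a * d - b * c + 1) = 0" by (simp add: algebra_simps)
      then have "a * d - b * c = 1 \<or> a * d - b * c = - 1" by (auto simp: eq_neg_iff_add_eq_0)
      \<comment> \<open>A square determines its linear form only up to sign. Multiplying the second
        form by s = 1 or -1 corrects the determinant and keeps the square.\<close>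
      then obtain s where s: "s * s = 1" "s * (a * d - b * c) = 1"
      proof (elim disjE)
        assume "a * d - b * c = 1"
        then show ?thesis using that[of 1] by simp
      next
        assume "a * d - b * c = - 1"
        then show ?thesis using that[of "- 1"] by simp
      qed
      let ?g = "mat2 a (s * b) c (s * d)"
      have "?g \<in> SL2" using s(2) by (simp add: mat2_mem_SL2 algebra_simps)
      moreover
      have "tup {1, 2, 3} (\<lambda>i v. x (i, v)) = tup {1, 2, 3} (\<lambda>i. gact ?g (squares i))"
      proof -
        have "s * b * (s * b) = b * b" "s * b * (s * d) = b * d" "s * d * (s * d) = d * d"
          using s(1) by (simp_all add: mult.left_commute mult.assoc[symmetric])
        then show ?thesis
          unfolding tup_eq_iff using ac bd eqs by (simp add: squares_def gact_def)
      qed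
      with xt have "x = tup {1, 2, 3} (\<lambda>i. gact ?g (squares i))" by (rule trans)
      ultimately show "x \<in> orbit SL2 (prod_gvar sym2s {1, 2, 3}) (tup {1, 2, 3} squares)"
        unfolding orbit_tup by blast
    qed
  qed simp
qed

lemma gact_one: "v \<in> {0, 1, 2} \<Longrightarrow> gact (mat 1) s v = s v"
  by (auto simp: gact_def mat_def)

text \<open>The last three equations say that the cross product of \<open>s2\<close> and \<open>s3\<close> is \<open>- (s2 + s3)\<close>.
  They distinguish the orbit from that of the negated triple, which has the same Gram matrix.\<close>

definition product_eqs :: "(nat \<Rightarrow> complex) \<Rightarrow> (nat \<Rightarrow> complex) \<Rightarrow> (nat \<Rightarrow> complex) \<Rightarrow> bool" where
  "product_eqs s1 s2 s3 \<longleftrightarrow>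
     s1 1 * s1 1 - s1 0 * s1 2 = 1 \<and>
     2 * s1 1 * s2 1 - s1 0 * s2 2 - s1 2 * s2 0 = 2 \<and>
     2 * s1 1 * s3 1 - s1 0 * s3 2 - s1 2 * s3 0 = 2 \<and>
     s2 0 * s3 1 - s2 1 * s3 0 + (s2 0 + s3 0) = 0 \<and>
     s2 0 * s3 2 - s2 2 * s3 0 + 2 * (s2 1 + s3 1) = 0 \<and>
     s2 1 * s3 2 - s2 2 * s3 1 + (s2 2 + s3 2) = 0"

text \<open>The polarized discriminant is multiplied by the square of the determinant. With its
  middle entry halved, the cross product transforms like a form times the determinant, so the last
  three equations relate quadratic forms equivariantly.\<close>

lemma product_eqs_gact:
  assumes g: "g \<in> SL2" and E: "product_eqs s1 s2 s3"
  shows "product_eqs (gact g s1) (gact g s2) (gact g s3)"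
proof -
  define a b c d where "a = g $ 1 $ 1" and "b = g $ 1 $ 2" and "c = g $ 2 $ 1" and "d = g $ 2 $ 2"
  have D: "a * d - b * c = 1" using g by (simp add: mem_SL2 a_def b_def c_def d_def)
  note act = gact_def a_def[symmetric] b_def[symmetric] c_def[symmetric] d_def[symmetric]
  have form: "2 * gact g s 1 * gact g s' 1 - gact g s 0 * gact g s' 2 - gact g s 2 * gact g s' 0
      = (a * d - b * c) * (a * d - b * c) * (2 * s 1 * s' 1 - s 0 * s' 2 - s 2 * s' 0)" for s s'
    unfolding act tri_simps by (simp add: algebra_simps)
  have form1: "gact g s 1 * gact g s 1 - gact g s 0 * gact g s 2
      = (a * d - b * c) * (a * d - b * c) * (s 1 * s 1 - s 0 * s 2)" for s
    unfolding act tri_simps by (simp add: algebra_simps)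
  let ?X = "s2 0 * s3 1 - s2 1 * s3 0" and ?Y = "s2 0 * s3 2 - s2 2 * s3 0"
    and ?Z = "s2 1 * s3 2 - s2 2 * s3 1"
  have "gact g s2 0 * gact g s3 1 - gact g s2 1 * gact g s3 0
      = (a * d - b * c) * (a * a * ?X + a * b * ?Y + b * b * ?Z)"
    "gact g s2 0 * gact g s3 2 - gact g s2 2 * gact g s3 0
      = (a * d - b * c) * (2 * a * c * ?X + (a * d + b * c) * ?Y + 2 * b * d * ?Z)"
    "gact g s2 1 * gact g s3 2 - gact g s2 2 * gact g s3 1
      = (a * d - b * c) * (c * c * ?X + c * d * ?Y + d * d * ?Z)"
    unfolding act tri_simps by (simp_all add: algebra_simps)
  moreover have X: "?X = - (s2 0 + s3 0)" "?Y = - (2 * (s2 1 + s3 1))" "?Z = - (s2 2 + s3 2)"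
    using E unfolding product_eqs_def eq_neg_iff_add_eq_0 by blast+
  ultimately have cross: "gact g s2 0 * gact g s3 1 - gact g s2 1 * gact g s3 0 + (gact g s2 0 + gact g s3 0) = 0"
    "gact g s2 0 * gact g s3 2 - gact g s2 2 * gact g s3 0 + 2 * (gact g s2 1 + gact g s3 1) = 0"
    "gact g s2 1 * gact g s3 2 - gact g s2 2 * gact g s3 1 + (gact g s2 2 + gact g s3 2) = 0"
    unfolding D X by (simp_all only: act tri_simps) (simp_all add: algebra_simps)
  show ?thesis
    using E cross unfolding product_eqs_def form form1 D by simp
qed

text \<open>A form of discriminant 1 is twice a product of two linear forms of determinant 1, so the
  group carries \<open>products 1\<close> to it.\<close>

lemma split_form:
  fixes p q r :: complex
  assumes "q * q - p * r = 1"
  obtains a b c d where "a * d - b * c = 1" "2 * a * b = p" "a * d + b * c = q" "2 * c * d = r"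
proof (cases "p = 0")
  case False
  have "(q - 1) * (q + 1) = p * r" using assms by (simp add: algebra_simps)
  then have "(q - 1) * (q + 1) / p = r" using False by simp
  moreover have "2 * (x / p) * (y / 2) = x * y / p" for x y by simp
  ultimately have "2 * ((q - 1) / p) * ((q + 1) / 2) = r" by (simp only:)
  moreover have "1 * ((q + 1) / 2) - p / 2 * ((q - 1) / p) = 1" "1 * ((q + 1) / 2) + p / 2 * ((q - 1) / p) = q"
    using False by (simp_all add: field_simps)
  \<comment> \<open>Taking a = 1 forces b = p/2; the values 1 and q of ad - bc and ad + bc then give
    d and c. The instantiation order is a, d, b, c.\<close>
  ultimately show ?thesis using that[of 1 "(q + 1) / 2" "p / 2" "(q - 1) / p"] by simp
next
  case True
  then have "(q - 1) * (q + 1) = 0" using assms by (simp add: algebra_simps)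
  then have "q = 1 \<or> q = - 1" by (auto simp: eq_neg_iff_add_eq_0)
  then show ?thesis
  proof
    assume "q = 1"
    then show ?thesis using that[of 1 1 0 "r / 2"] True by simp
  next
    assume "q = - 1"
    then show ?thesis using that[of 0 "- r / 2" 1 "- 1"] True by simp
  qed
qed

text \<open>Once the first form is normalized by \<open>split_form\<close>, the equations leave the
  second and third as (0, 1, r) and (p, 1, 0) with pr = 4. The torus fixes the first form and moves
  all such pairs into each other.\<close>

lemma product_eqs_orbit:
  assumes E: "product_eqs s1 s2 s3"
  obtains g where "g \<in> SL2"
    "\<And>v. v \<in> {0, 1, 2} \<Longrightarrow> s1 v = gact g (products 1) v \<and> s2 v = gact g (products 2) v \<and> s3 v = gact g (products 3) v"
proof -
  obtain a b c d where abcd: "a * d - b * c = 1" "2 * a * b = s1 0" "a * d + b * c = s1 1" "2 * c * d = s1 2"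
    using split_form[of "s1 1" "s1 0" "s1 2"] E unfolding product_eqs_def by metis
  define g where "g = mat2 a b c d"
  have g: "g \<in> SL2" using abcd(1) by (simp add: g_def mat2_mem_SL2)
  have cancel: "gact g (gact (inv2 g) s) v = s v" if "v \<in> {0, 1, 2}" for s v
    using gact_mult[of g "inv2 g" s v] gact_one[OF that] inv2_mult(2)[OF g] by simp
  define t1 t2 t3 where "t1 = gact (inv2 g) s1" and "t2 = gact (inv2 g) s2" and "t3 = gact (inv2 g) s3"
  have E': "product_eqs t1 t2 t3"
    unfolding t1_def t2_def t3_def by (rule product_eqs_gact[OF inv2_SL2[OF g] E])
  have s1: "gact g (products 1) v = s1 v" if "v \<in> {0, 1, 2}" for v
    using that abcd by (auto simp: products_def gact_def g_def)
  have "t1 = gact (inv2 g) (gact g (products 1))"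
    unfolding t1_def by (rule gact_cong; rule s1[symmetric]; simp)
  then have t1: "t1 v = products 1 v" if "v \<in> {0, 1, 2}" for v
    using gact_mult[of "inv2 g" g "products 1" v] gact_one[OF that] inv2_mult(1)[OF g] by simp
  have t1': "t1 0 = 0" "t1 1 = 1" "t1 2 = 0" using t1[of 0] t1[of 1] t1[of 2] by (simp_all add: products_def)
  have q: "t2 1 = 1" "t3 1 = 1" using E' unfolding product_eqs_def t1' by simp_all
  have *: "t2 0 * 1 - 1 * t3 0 + (t2 0 + t3 0) = 0" "1 * t3 2 - t2 2 * 1 + (t2 2 + t3 2) = 0"
    "t2 0 * t3 2 - t2 2 * t3 0 + 2 * (1 + 1) = 0"
    using E' unfolding product_eqs_def q by blast+
  have z: "t2 0 = 0" "t3 2 = 0" using *(1,2) by simp_all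
  have pr: "t2 2 * t3 0 = 4" using *(3) unfolding z by simp
  \<comment> \<open>\<open>dg t\<close> multiplies the leading coefficient 2 of
    \<open>products 3\<close> by t^2, which has to give \<open>t3 0\<close>.\<close>
  define t where "t = csqrt (t3 0 / 2)"
  have tt: "t * t = t3 0 / 2" by (simp add: t_def flip: power2_eq_square)
  then have t0: "t \<noteq> 0" using pr by auto
  have t3: "t3 0 = 2 * (t * t)" unfolding tt by simp
  have r: "t2 2 = 1 / t * (1 / t) * 2" using pr t0 unfolding t3 by (simp add: field_simps)
  have t1g: "gact (dg t) (products 1) v = t1 v" and t2g: "gact (dg t) (products 2) v = t2 v"
    and t3g: "gact (dg t) (products 3) v = t3 v" if "v \<in> {0, 1, 2}" for v
    using that t0 tt r q z t1' by (auto simp: gact_def products_def)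
  have s: "gact (g ** dg t) (products 1) v = s1 v" "gact (g ** dg t) (products 2) v = s2 v"
    "gact (g ** dg t) (products 3) v = s3 v" if v: "v \<in> {0, 1, 2}" for v
  proof -
    have "gact g (gact (dg t) (products 1)) = gact g t1" by (rule gact_cong; rule t1g; simp)
    moreover have "gact g (gact (dg t) (products 2)) = gact g t2" by (rule gact_cong; rule t2g; simp)
    moreover have "gact g (gact (dg t) (products 3)) = gact g t3" by (rule gact_cong; rule t3g; simp)
    ultimately show "gact (g ** dg t) (products 1) v = s1 v" "gact (g ** dg t) (products 2) v = s2 v"
      "gact (g ** dg t) (products 3) v = s3 v"
      using cancel[OF v] by (simp_all add: gact_mult t1_def t2_def t3_def)
  qed
  show ?thesis using that[OF SL2_mult[OF g dg_SL2[OF t0]]] s by simp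
qed

lemma closed_orbit_products:
  "closed_orbit SL2 (prod_gvar sym2s {1..3}) (tup {1..3} products)"
proof -
  let ?V = "{1, 2, 3} \<times> {0, 1, 2 :: nat}"
  let ?F = "{\<lambda>x :: nat \<times> nat \<Rightarrow> complex. x (1, 1) * x (1, 1) - x (1, 0) * x (1, 2) - 1,
    \<lambda>x. 2 * x (1, 1) * x (2, 1) - x (1, 0) * x (2, 2) - x (1, 2) * x (2, 0) - 2,
    \<lambda>x. 2 * x (1, 1) * x (3, 1) - x (1, 0) * x (3, 2) - x (1, 2) * x (3, 0) - 2,
    \<lambda>x. x (2, 0) * x (3, 1) - x (2, 1) * x (3, 0) + (x (2, 0) + x (3, 0)),
    \<lambda>x. x (2, 0) * x (3, 2) - x (2, 2) * x (3, 0) + 2 * (x (2, 1) + x (3, 1)),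
    \<lambda>x. x (2, 1) * x (3, 2) - x (2, 2) * x (3, 1) + (x (2, 2) + x (3, 2))}"
  interpret P: function_algebra top "polys (affine_coord ?V) :: ((nat \<times> nat \<Rightarrow> complex) \<Rightarrow> complex) set"
    by (rule function_algebra_polys)
  have c: "(\<lambda>x. x w) \<in> polys (affine_coord ?V)" if "w \<in> ?V" for w
    by (rule polys.gen) (use that in blast)
  show ?thesis
    unfolding one_to_three
  proof (rule closed_orbit_tupI[where F = ?F])
    show "?F \<subseteq> polys (affine_coord ?V)"
      by (intro insert_subsetI empty_subsetI P.diff P.add P.mult P.const c) simp_all
    fix x :: "nat \<times> nat \<Rightarrow> complex" assume x: "x \<in> ?V \<rightarrow>\<^sub>E UNIV"
    have xt: "x = tup {1, 2, 3} (\<lambda>i v. x (i, v))" using pts_tup x by (simp add: pts_prod_sym2)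
    have F: "(\<forall>h\<in>?F. h x = 0) \<longleftrightarrow> product_eqs (\<lambda>v. x (1, v)) (\<lambda>v. x (2, v)) (\<lambda>v. x (3, v))"
      unfolding product_eqs_def by simp
    show "x \<in> orbit SL2 (prod_gvar sym2s {1, 2, 3}) (tup {1, 2, 3} products) \<longleftrightarrow> (\<forall>h\<in>?F. h x = 0)"
      unfolding F
    proof
      assume "x \<in> orbit SL2 (prod_gvar sym2s {1, 2, 3}) (tup {1, 2, 3} products)"
      then obtain g where g: "g \<in> SL2" and x: "x = tup {1, 2, 3} (\<lambda>i. gact g (products i))"
        unfolding orbit_tup by blast
      have "product_eqs (products 1) (products 2) (products 3)"
        by (simp add: product_eqs_def products_def)
      from product_eqs_gact[OF g this]
      show "product_eqs (\<lambda>v. x (1, v)) (\<lambda>v. x (2, v)) (\<lambda>v. x (3, v))"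
        unfolding product_eqs_def x by (simp add: tup_apply)
    next
      assume "product_eqs (\<lambda>v. x (1, v)) (\<lambda>v. x (2, v)) (\<lambda>v. x (3, v))"
      from product_eqs_orbit[OF this] obtain g where g: "g \<in> SL2"
        "\<And>v. v \<in> {0, 1, 2} \<Longrightarrow> x (1, v) = gact g (products 1) v \<and> x (2, v) = gact g (products 2) v \<and> x (3, v) = gact g (products 3) v"
        by blast
      have "tup {1, 2, 3} (\<lambda>i v. x (i, v)) = tup {1, 2, 3} (\<lambda>i. gact g (products i))"
        unfolding tup_eq_iff using g(2)[of 0] g(2)[of 1] g(2)[of 2] by simp
      with xt have "x = tup {1, 2, 3} (\<lambda>i. gact g (products i))" by (rule trans)
      then show "x \<in> orbit SL2 (prod_gvar sym2s {1, 2, 3}) (tup {1, 2, 3} products)"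
        unfolding orbit_tup using g(1) by blast
    qed
  qed simp
qed

text \<open>The torus scales a square by an arbitrary u, but the zero form reached at u = 0 is in no
  other orbit. The square root appears because \<open>dg t\<close> scales by t^2.\<close>

lemma not_closed_single:
  assumes "i \<in> {1..3}"
  shows "\<not> closed_orbit SL2 (prod_gvar sym2s {i}) (tup {i} squares)"
proof (rule not_closed_orbit_tup[where p = "\<lambda>j v. if v = (if i = 2 then 2 else 0) then [:0, 1:] else 0"])
  show "{i} \<subseteq> {1..3}" using assms by simp
  fix u :: complex assume u: "u \<noteq> 0"
  have uu: "csqrt u * csqrt u = u" by (simp flip: power2_eq_square)
  show "\<exists>g\<in>SL2. \<forall>j\<in>{i}. \<forall>v\<in>{0, 1, 2}. gact g (squares j) v
      = poly (if v = (if i = 2 then 2 else 0) then [:0, 1:] else 0) u"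
  proof (rule bexI)
    show "dg (if i = 2 then 1 / csqrt u else csqrt u) \<in> SL2" using u by (simp add: mat2_mem_SL2)
    show "\<forall>j\<in>{i}. \<forall>v\<in>{0, 1, 2}. gact (dg (if i = 2 then 1 / csqrt u else csqrt u)) (squares j) v
      = poly (if v = (if i = 2 then 2 else 0) then [:0, 1:] else 0) u"
      using uu by (simp add: squares_def gact_def)
  qed
next
  fix g :: "complex^2^2" assume g: "g \<in> SL2"
  show "\<exists>j\<in>{i}. \<exists>v\<in>{0, 1, 2}. gact g (squares j) v \<noteq> poly (if v = (if i = 2 then 2 else 0) then [:0, 1:] else 0) 0"
    using g by (auto simp: squares_def gact_def mem_SL2)
qed

lemma not_closed_pair:
  assumes "I \<subseteq> {1..3}" "card I = 2"
  shows "\<not> closed_orbit SL2 (prod_gvar sym2s I) (tup I products)"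
proof -
  \<comment> \<open>The coordinates of the degenerating pair. For the pair 2, 3 the matrix
    \<open>lo (- 1)\<close> first turns the common factor into a coordinate form, which makes the
    middle coefficient of the third form -1.\<close>
  define p :: "nat \<Rightarrow> nat \<Rightarrow> complex poly" where
    "p = (\<lambda>i v. if v = 1 then (if i = 3 \<and> 2 \<in> I then - 1 else 1)
      else if i = 2 \<and> 1 \<in> I \<and> v = 2 \<or> i = 3 \<and> v = 0 then [:0, 2:] else 0)"
  obtain i j where "I = {i, j}" "i \<noteq> j" using assms(2) by (auto simp: card_2_iff)
  moreover have "i = 1 \<or> i = 2 \<or> i = 3" "j = 1 \<or> j = 2 \<or> j = 3"
    using assms(1) \<open>I = {i, j}\<close> by auto
  ultimately have "I = {1, 2} \<or> I = {1, 3} \<or> I = {2, 3}" by (elim disjE) auto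
  then show ?thesis
  proof (elim disjE)
    assume I: "I = {1, 2}"
    show ?thesis
    proof (rule not_closed_orbit_tup[OF assms(1), where p = p])
      fix u :: complex assume u: "u \<noteq> 0"
      have "csqrt u * csqrt u = u" by (simp flip: power2_eq_square)
      then show "\<exists>g\<in>SL2. \<forall>i\<in>I. \<forall>v\<in>{0, 1, 2}. gact g (products i) v = poly (p i v) u"
        using u by (intro bexI[of _ "dg (1 / csqrt u)"]) (simp_all add: I p_def products_def gact_def mat2_mem_SL2)
    next
      fix g :: "complex^2^2" assume g: "g \<in> SL2"
      show "\<exists>i\<in>I. \<exists>v\<in>{0, 1, 2}. gact g (products i) v \<noteq> poly (p i v) 0"
      proof (rule ccontr)
        assume "\<not> ?thesis"
        then have *: "gact g (products i) v = poly (p i v) 0" if "i \<in> {1, 2}" "v \<in> {0, 2}" for i v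
          using that I by auto
        \<comment> \<open>In the limit the two forms coincide, whereas the original ones differ by
          twice the square of the common factor, which no group element annihilates. The other pairs
          are alike, with the sum in place of the difference for 2, 3.\<close>
        have "g $ 1 $ 2 * g $ 1 $ 2 * 2 = gact g (products 2) 0 - gact g (products 1) 0"
          "g $ 2 $ 2 * g $ 2 $ 2 * 2 = gact g (products 2) 2 - gact g (products 1) 2"
          by (simp_all add: gact_def products_def algebra_simps)
        then have "g $ 1 $ 2 = 0" "g $ 2 $ 2 = 0"
          using *[of 2 0] *[of 2 2] *[of 1 0] *[of 1 2] by (simp_all add: p_def I)
        then show False using g by (simp add: mem_SL2)
      qed
    qed
  next
    assume I: "I = {1, 3}"
    show ?thesis
    proof (rule not_closed_orbit_tup[OF assms(1), where p = p])
      fix u :: complex assume u: "u \<noteq> 0"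
      have "csqrt u * csqrt u = u" by (simp flip: power2_eq_square)
      then show "\<exists>g\<in>SL2. \<forall>i\<in>I. \<forall>v\<in>{0, 1, 2}. gact g (products i) v = poly (p i v) u"
        using u by (intro bexI[of _ "dg (csqrt u)"]) (simp_all add: I p_def products_def gact_def mat2_mem_SL2)
    next
      fix g :: "complex^2^2" assume g: "g \<in> SL2"
      show "\<exists>i\<in>I. \<exists>v\<in>{0, 1, 2}. gact g (products i) v \<noteq> poly (p i v) 0"
      proof (rule ccontr)
        assume "\<not> ?thesis"
        then have *: "gact g (products i) v = poly (p i v) 0" if "i \<in> {1, 3}" "v \<in> {0, 2}" for i v
          using that I by auto
        have "g $ 1 $ 1 * g $ 1 $ 1 * 2 = gact g (products 3) 0 - gact g (products 1) 0"
          "g $ 2 $ 1 * g $ 2 $ 1 * 2 = gact g (products 3) 2 - gact g (products 1) 2"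
          by (simp_all add: gact_def products_def algebra_simps)
        then have "g $ 1 $ 1 = 0" "g $ 2 $ 1 = 0"
          using *[of 3 0] *[of 3 2] *[of 1 0] *[of 1 2] by (simp_all add: p_def I)
        then show False using g by (simp add: mem_SL2)
      qed
    qed
  next
    assume I: "I = {2, 3}"
    show ?thesis
    proof (rule not_closed_orbit_tup[OF assms(1), where p = p])
      fix u :: complex assume u: "u \<noteq> 0"
      have "csqrt u * csqrt u = u" by (simp flip: power2_eq_square)
      then show "\<exists>g\<in>SL2. \<forall>i\<in>I. \<forall>v\<in>{0, 1, 2}. gact g (products i) v = poly (p i v) u"
        using u by (intro bexI[of _ "dg (csqrt u) ** lo (- 1)"])
          (simp_all add: I p_def products_def gact_def mat2_mult mat2_mem_SL2)
    next
      fix g :: "complex^2^2" assume g: "g \<in> SL2"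
      show "\<exists>i\<in>I. \<exists>v\<in>{0, 1, 2}. gact g (products i) v \<noteq> poly (p i v) 0"
      proof (rule ccontr)
        assume "\<not> ?thesis"
        then have *: "gact g (products i) v = poly (p i v) 0" if "i \<in> {2, 3}" "v \<in> {0, 2}" for i v
          using that I by auto
        have "(g $ 1 $ 1 + g $ 1 $ 2) * (g $ 1 $ 1 + g $ 1 $ 2) * 2 = gact g (products 2) 0 + gact g (products 3) 0"
          "(g $ 2 $ 1 + g $ 2 $ 2) * (g $ 2 $ 1 + g $ 2 $ 2) * 2 = gact g (products 2) 2 + gact g (products 3) 2"
          by (simp_all add: gact_def products_def algebra_simps)
        then have "g $ 1 $ 2 = - g $ 1 $ 1" "g $ 2 $ 2 = - g $ 2 $ 1"
          using *[of 2 0] *[of 2 2] *[of 3 0] *[of 3 2]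
          by (simp_all add: p_def I add_eq_0_iff)
        then show False using g by (simp add: mem_SL2)
      qed
    qed
  qed
qed

section \<open>A lower bound for the dimension, and the value of the invariant\<close>

lemma krull_dim_singleton: "topspace T = {x} \<Longrightarrow> krull_dim T \<le> 0"
  unfolding krull_dim_def
proof (rule Sup_least, clarify)
  fix n and Z :: "nat \<Rightarrow> 'a set"
  assume T: "topspace T = {x}"
    and Z: "\<forall>i\<le>n. closedin T (Z i) \<and> irreducible_space (subtopology T (Z i))" "\<forall>i<n. Z i \<subset> Z (Suc i)"
  have "n = 0"
  proof (rule ccontr)
    assume "n \<noteq> 0"
    then have sub: "Z 0 \<subset> Z 1" and ne: "Z 0 \<noteq> {}" and top: "Z 1 \<subseteq> {x}"
      using Z irreducible_closed_iff[of T "Z 0"] closedin_subset[of T "Z 1"] T by auto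
    then show False by blast
  qed
  then show "enat n \<le> 0" by (simp add: zero_enat_def)
qed

text \<open>The matrices \<open>up s\<close> fix the entries 1 and 3 and move entry 2 along a curve.
  It is closed in the orbit, being given by the value of entry 1, and irreducible as an image of the
  line; with one of its points it forms a chain of length 1.\<close>

lemma krull_dim_orbit_squares:
  "orbit_dim SL2 (prod_gvar sym2s {1..3}) (tup {1..3} squares) \<ge> 1"
proof -
  let ?V = "{1..3 :: nat} \<times> {0, 1, 2 :: nat}"
  let ?O = "orbit SL2 (prod_gvar sym2s {1..3}) (tup {1..3} squares)"
  let ?T = "zariski (affine_coord ?V) ?O"
  let ?c = "\<lambda>s. tup {1..3} (\<lambda>i. gact (up s) (squares i))"
  interpret P: function_algebra top "polys (affine_coord ?V) :: ((nat \<times> nat \<Rightarrow> complex) \<Rightarrow> complex) set"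
    by (rule function_algebra_polys)
  have w: "(\<lambda>x. x w) \<in> polys (affine_coord ?V)" if "w \<in> ?V" for w
    by (rule polys.gen) (use that in blast)
  have cO: "?c s \<in> ?O" for s unfolding orbit_tup using up_SL2 by blast
  define C where "C = range ?c"
  let ?F = "{\<lambda>x :: nat \<times> nat \<Rightarrow> complex. x (1, 0) - 1, \<lambda>x. x (1, 1), \<lambda>x. x (1, 2)}"
  have C: "closedin ?T C"
    unfolding closedin_zariski
  proof (intro exI[of _ ?F] conjI)
    show "?F \<subseteq> polys (affine_coord ?V)"
      by (intro insert_subsetI empty_subsetI P.diff P.const w) simp_all
    show "C = zero_locus ?F ?O"
    proof (intro set_eqI iffI)
      fix x assume "x \<in> C"
      then obtain s where x: "x = ?c s" by (auto simp: C_def)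
      have "x \<in> ?O" unfolding x by (rule cO)
      moreover have "x (1, 0) = 1" "x (1, 1) = 0" "x (1, 2) = 0"
        by (simp_all add: x tup_apply squares_def gact_def)
      ultimately show "x \<in> zero_locus ?F ?O" by (simp add: zero_locus_def)
    next
      fix x assume x: "x \<in> zero_locus ?F ?O"
      then obtain g where g: "g \<in> SL2" "x = tup {1..3} (\<lambda>i. gact g (squares i))"
        unfolding zero_locus_def orbit_tup by blast
      define a b c d where "a = g $ 1 $ 1" and "b = g $ 1 $ 2" and "c = g $ 2 $ 1" and "d = g $ 2 $ 2"
      have "x (1, 0) = a * a" "x (1, 1) = a * c" "x (1, 2) = c * c"
        by (simp_all add: g(2) tup_apply squares_def gact_def a_def b_def c_def d_def)
      moreover have "x (1, 0) - 1 = 0" "x (1, 1) = 0" "x (1, 2) = 0"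
        using x by (simp_all add: zero_locus_def)
      ultimately have ac: "a * a = 1" "c = 0" by auto
      have ad: "a * d = 1" using g(1) ac by (simp add: mem_SL2 a_def b_def c_def d_def)
      have "d = a * a * d" using ac(1) by simp
      also have "\<dots> = a" using ad by (simp only: mult.assoc mult_1_right)
      finally have dd: "d * d = 1" using ac(1) by simp
      have "(b * d) * (b * d) = b * b * (d * d)" by (simp only: mult_ac)
      then have bb: "b * d * (b * d) = b * b" using dd by simp
      \<comment> \<open>Here a = d is 1 or -1, so g is \<open>up (b * d)\<close> up to sign, and the
        sign acts trivially on quadratic forms.\<close>
      have "x = ?c (b * d)"
        unfolding g(2) tup_eq_iff using ac dd bb
        by (simp add: squares_def gact_def flip: a_def b_def c_def d_def)
      then show "x \<in> C" by (auto simp: C_def)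
    qed
  qed
  have irrC: "irreducible_space (subtopology ?T C)"
    unfolding irreducible_closed_iff[OF C]
  proof (intro conjI allI impI)
    show "C \<noteq> {}" by (simp add: C_def)
    fix A B assume AB: "closedin ?T A \<and> closedin ?T B \<and> C \<subseteq> A \<union> B"
    obtain F G where F: "F \<subseteq> polys (affine_coord ?V)" "A = zero_locus F ?O"
      and G: "G \<subseteq> polys (affine_coord ?V)" "B = zero_locus G ?O"
      using AB unfolding closedin_zariski by blast
    have pol: "\<exists>p. \<forall>s. f (?c s) = poly p s" if f: "f \<in> polys (affine_coord ?V)" for f
    proof -
      let ?A = "{F :: complex \<Rightarrow> complex. \<exists>p. \<forall>t\<in>UNIV. F t = poly p (id t)}"
      interpret A: function_algebra "principal UNIV" ?A by (rule function_algebra_poly)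
      have s: "(\<lambda>s. s) \<in> ?A" by (auto intro: exI[of _ "[:0, 1:]"])
      have "(\<lambda>s. f (?c s)) \<in> ?A"
      proof (rule A.pullback[OF f, where \<gamma> = ?c])
        fix h :: "(nat \<times> nat \<Rightarrow> complex) \<Rightarrow> complex" assume "h \<in> affine_coord ?V"
        then obtain i v where h: "h = (\<lambda>x. x (i, v))" "i \<in> {1..3}" "v \<in> {0, 1, 2}" by blast
        have "(\<lambda>s. gact (up s) (squares i) v) \<in> ?A"
        proof -
          have "v = 0 \<or> v = 1 \<or> v = 2" using h(3) by blast
          then show ?thesis
            unfolding gact_def mat2_entries
            by (elim disjE; simp only: tri_simps) (intro A.add A.mult A.const s)+
        qed
        then show "(\<lambda>s. h (?c s)) \<in> ?A" unfolding h(1) tup_apply[OF h(2,3)] .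
      qed
      then show ?thesis by simp
    qed
    show "C \<subseteq> A \<or> C \<subseteq> B"
    proof (rule ccontr)
      assume "\<not> ?thesis"
      then obtain s1 s2 where s: "?c s1 \<notin> A" "?c s2 \<notin> B" by (auto simp: C_def)
      then obtain f g where f: "f \<in> F" "f (?c s1) \<noteq> 0" and g: "g \<in> G" "g (?c s2) \<noteq> 0"
        using cO unfolding F(2) G(2) zero_locus_def by blast
      obtain p q where p: "\<And>s. f (?c s) = poly p s" and q: "\<And>s. g (?c s) = poly q s"
        using pol f(1) g(1) F(1) G(1) by (meson subsetD)
      have "poly (p * q) s = 0" for s
      proof -
        have "?c s \<in> A \<or> ?c s \<in> B" using AB by (auto simp: C_def)
        then have "f (?c s) = 0 \<or> g (?c s) = 0" using f(1) g(1) by (auto simp: F(2) G(2) zero_locus_def)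
        then show ?thesis unfolding p q by auto
      qed
      then have "p * q = 0" using poly_all_0_iff_0 by blast
      then show False using f(2) g(2) unfolding p q by auto
    qed
  qed
  let ?y = "?c 0"
  let ?G = "(\<lambda>w x. x w - ?y w) ` ?V"
  have Y: "closedin ?T {?y}"
    unfolding closedin_zariski
  proof (intro exI[of _ ?G] conjI)
    show "?G \<subseteq> polys (affine_coord ?V)"
    proof (rule image_subsetI)
      fix w' assume "w' \<in> ?V"
      then show "(\<lambda>x. x w' - ?y w') \<in> polys (affine_coord ?V)" by (intro P.diff P.const w)
    qed
    have eqY: "x = ?y" if "x \<in> ?O" "\<And>w. w \<in> ?V \<Longrightarrow> x w - ?y w = 0" for x
    proof (rule PiE_ext[of _ ?V "\<lambda>_. UNIV"])
      have "?O \<subseteq> ?V \<rightarrow>\<^sub>E UNIV"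
        using orbit_subset[OF S.prod_variety[OF order_refl] tup_pts] by (simp add: pts_prod_sym2)
      then show "x \<in> ?V \<rightarrow>\<^sub>E UNIV" "?y \<in> ?V \<rightarrow>\<^sub>E UNIV" using that(1) cO by blast+
      show "x w = ?y w" if "w \<in> ?V" for w using \<open>\<And>w. w \<in> ?V \<Longrightarrow> x w - ?y w = 0\<close>[OF that] by simp
    qed
    show "{?y} = zero_locus ?G ?O"
    proof (intro set_eqI iffI)
      fix x assume "x \<in> {?y}"
      then have x: "x = ?y" by simp
      have "\<forall>f\<in>?G. f x = 0" unfolding x by simp
      then show "x \<in> zero_locus ?G ?O" unfolding zero_locus_def x using cO[of 0] by (intro CollectI conjI)
    next
      fix x assume "x \<in> zero_locus ?G ?O"
      then have x: "x \<in> ?O" "\<forall>f\<in>?G. f x = 0" unfolding zero_locus_def by simp_all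
      have "x w - ?y w = 0" if "w \<in> ?V" for w
        using bspec[OF x(2) imageI[OF that]] .
      then have "x = ?y" by (rule eqY[OF x(1)])
      then show "x \<in> {?y}" by simp
    qed
  qed
  have irrY: "irreducible_space (subtopology ?T {?y})"
    unfolding irreducible_closed_iff[OF Y] by blast
  have "{?y} \<subset> C"
  proof -
    have "?c 1 \<noteq> ?y" by (auto simp: tup_eq_iff squares_def gact_def intro!: bexI[of _ 2])
    moreover have "?c 1 \<in> C" "?y \<in> C" by (auto simp: C_def)
    ultimately show ?thesis by blast
  qed
  then have "enat 1 \<in> {enat n | n. \<exists>Z. (\<forall>i\<le>n. closedin ?T (Z i) \<and> irreducible_space (subtopology ?T (Z i))) \<and>
     (\<forall>i<n. Z i \<subset> Z (Suc i))}"
    using C irrC Y irrY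
    by (intro CollectI exI[of _ 1] conjI exI[of _ "\<lambda>i. if i = 0 then {?y} else C"]) auto
  then have "enat 1 \<le> krull_dim ?T" unfolding krull_dim_def by (rule Sup_upper)
  then show ?thesis
    unfolding orbit_dim_eq[OF S.prod_variety[OF order_refl] tup_pts] S.coords_prod prod_coords_sym2s
    by (simp add: one_enat_def)
qed

text \<open>Failure for two components does not by definition exclude fewer. Single entries of
  \<open>products\<close> have closed orbits and would call for a comparison of dimensions, so
  \<open>squares\<close> is used for 1; for 0 the orbit is a point.\<close>

lemma delta_prod_sym2: "delta_prod SL2 3 sym2s = 3"
proof -
  let ?d = "delta_prod SL2 3 sym2s"
  have X: "\<forall>i\<in>{1..3}. affine_gvar SL2 (sym2s i)" by (simp add: affine_gvar_sym2)
  have works: "\<exists>I\<subseteq>{1..3}. card I = ?d \<and> closed_orbit SL2 (prod_gvar sym2s I) (tup I f) \<and>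
      orbit_dim SL2 (prod_gvar sym2s I) (tup I f) = orbit_dim SL2 (prod_gvar sym2s {1..3}) (tup {1..3} f)"
    if "closed_orbit SL2 (prod_gvar sym2s {1..3}) (tup {1..3} f)" for f
    using delta_prod_le_3(2)[OF X, rule_format, OF tup_pts that] project_tup by metis
  obtain I where I: "I \<subseteq> {1..3}" "card I = ?d" "closed_orbit SL2 (prod_gvar sym2s I) (tup I products)"
    using works[OF closed_orbit_products] by blast
  obtain J where J: "J \<subseteq> {1..3}" "card J = ?d" "closed_orbit SL2 (prod_gvar sym2s J) (tup J squares)"
    "orbit_dim SL2 (prod_gvar sym2s J) (tup J squares) = orbit_dim SL2 (prod_gvar sym2s {1..3}) (tup {1..3} squares)"
    using works[OF closed_orbit_squares] by blast
  have "?d \<noteq> 2" using not_closed_pair[OF I(1)] I by auto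
  moreover have "?d \<noteq> 1"
    using not_closed_single J(1-3) by (auto simp: card_1_singleton_iff)
  moreover have "?d \<noteq> 0"
  proof
    assume "?d = 0"
    then have J0: "J = {}" using J(1,2) finite_subset[OF J(1)] by simp
    let ?O = "orbit SL2 (prod_gvar sym2s {}) (tup {} squares)"
    have "?O = {tup {} squares}"
      unfolding orbit_tup using SL2_one by (auto simp: tup_eq_iff)
    then have "krull_dim (zariski (affine_coord (coords (prod_gvar sym2s {}))) ?O) \<le> 0"
      by (intro krull_dim_singleton) simp
    then have "orbit_dim SL2 (prod_gvar sym2s {}) (tup {} squares) \<le> 0"
      using orbit_dim_eq[OF S.prod_variety[of "{}"] tup_pts] by simp
    then show False using J(4) krull_dim_orbit_squares unfolding J0 by simp
  qed
  ultimately show ?thesis using delta_prod_le_3(1)[OF X] by linarith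
qed

theorem theorem5p6:
  shows "delta SL2 = 3"
proof (rule antisym)
  show "delta SL2 \<le> 3"
    unfolding delta_def
  proof (rule Sup_least, clarify)
    fix m and X :: "nat \<Rightarrow> (complex, 2, nat) gvar"
    assume "\<forall>i\<in>{1..m}. affine_gvar SL2 (X i)"
    from delta_prod_le_3(1)[OF this] show "enat (delta_prod SL2 m X) \<le> 3"
      by (simp add: numeral_eq_enat)
  qed
  have "enat (delta_prod SL2 3 sym2s) \<le> delta SL2"
    unfolding delta_def by (rule Sup_upper) (use affine_gvar_sym2 in blast)
  then show "3 \<le> delta SL2" by (simp add: delta_prod_sym2 numeral_eq_enat)
qed

end
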